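(* Let $G$ be a Cohen--Macaulay Cameron--Walker graph, consisting of a connected bipartite graph with vertex partition $\{x_1,\ldots,x_n\}\cup\{y_1,\ldots,y_m\}$, exactly one leaf edge $\{x_i,w_i\}$ attached to each $x_i$, and exactly one pendant triangle on $\{y_j,z_j,w_{n+j}\}$ attached to each $y_j$. Put $V'=\{x_1,\ldots,x_n\}\cup\{y_1,\ldots,y_m\}\cup\{z_1,\ldots,z_m\}$ and $S=\Bbbk[V(G)]$. Then the Hilbert series of $H^{n+m}_{\mathfrak{m}}(S/I(G))$ is $$F(H^{n+m}_{\mathfrak{m}}(S/I(G)),t)=\sum_j\dim_\Bbbk[H^{n+m}_{\mathfrak{m}}(S/I(G))]_j\,t^j=\sum_i\ \sum_{C\in\mathrm{Min}(G)}\binom{|V'\setminus C|}{i}\left(\frac{t^{-1}}{1-t^{-1}}\right)^{n+m-i}.$$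
   Context: Graphs are finite simple graphs; $\Bbbk$ is an arbitrary field. $\mathrm{m}(G)$ is the maximal size of a matching and $\mathrm{im}(G)$ the maximal size of an induced matching of $G$. A Cameron--Walker graph is a finite connected simple graph $G$ with $\mathrm{im}(G)=\mathrm{m}(G)$ which is neither a star graph nor a star triangle. The edge ideal $I(G)\subseteq\Bbbk[V(G)]$ is generated by $uv$, $\{u,v\}\in E(G)$; $G$ is Cohen--Macaulay if $\Bbbk[V(G)]/I(G)$ is. By a known theorem (Hibi--Higashitani--Kimura--O'Keefe) a Cameron--Walker graph is Cohen--Macaulay if and only if it has the structure described in the claim. $\mathrm{Min}(G)$ is the set of inclusion-minimal vertex covers of $G$. $\mathfrak{m}$ is the homogeneous maximal ideal of $S$ (standard grading); the right-hand side is read as a power series in $t^{-1}$. *)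

theory Defs
  imports
    "HOL-Library.Poly_Mapping"
    "HOL-Library.Disjoint_Sets"
    "HOL-Library.Extended_Nat"
    "HOL-Computational_Algebra.Formal_Laurent_Series"
    "HOL-Algebra.QuotRing"
    "HOL-Algebra.Ring_Divisibility"
    "Jordan_Normal_Form.VS_Connect"
begin

section \<open>Graphs\<close>

text \<open>A graph is given by its vertex set and its set of edges, an edge being a two-element set.\<close>

definition simple_graph :: "'v set \<Rightarrow> 'v set set \<Rightarrow> bool" where
  "simple_graph V E \<longleftrightarrow> finite V \<and> (\<forall>e\<in>E. e \<subseteq> V \<and> card e = 2)"

definition connected_graph :: "'v set \<Rightarrow> 'v set set \<Rightarrow> bool" where
  "connected_graph V E \<longleftrightarrow> V \<noteq> {} \<and> (\<forall>u\<in>V. \<forall>v\<in>V. (u, v) \<in> {(a, b). {a, b} \<in> E}\<^sup>*)"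

definition matching :: "'v set set \<Rightarrow> 'v set set \<Rightarrow> bool" where
  "matching E M \<longleftrightarrow> M \<subseteq> E \<and> disjoint M"

definition induced_matching :: "'v set set \<Rightarrow> 'v set set \<Rightarrow> bool" where
  "induced_matching E M \<longleftrightarrow> matching E M \<and> {e\<in>E. e \<subseteq> \<Union>M} = M"

definition matching_number :: "'v set set \<Rightarrow> nat" where
  "matching_number E = Max (card ` {M. matching E M})"

definition induced_matching_number :: "'v set set \<Rightarrow> nat" where
  "induced_matching_number E = Max (card ` {M. induced_matching E M})"

text \<open>The one-vertex graph counts as a star (with no edges).\<close>

definition star_graph :: "'v set \<Rightarrow> 'v set set \<Rightarrow> bool" where
  "star_graph V E \<longleftrightarrow> (\<exists>c\<in>V. E = {{c, v} | v. v \<in> V - {c}})"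

text \<open>A star triangle consists of triangles glued along one common vertex \<open>c\<close>; \<open>P\<close> is the set of
  the edges opposite to \<open>c\<close>.\<close>

definition star_triangle :: "'v set \<Rightarrow> 'v set set \<Rightarrow> bool" where
  "star_triangle V E \<longleftrightarrow>
     (\<exists>c\<in>V. \<exists>P. P \<noteq> {} \<and> partition_on (V - {c}) P \<and> (\<forall>p\<in>P. card p = 2) \<and>
        E = P \<union> {{c, v} | v. v \<in> V - {c}})"

definition cameron_walker :: "'v set \<Rightarrow> 'v set set \<Rightarrow> bool" where
  "cameron_walker V E \<longleftrightarrow>
     simple_graph V E \<and> connected_graph V E \<and>
     induced_matching_number E = matching_number E \<and>
     \<not> star_graph V E \<and> \<not> star_triangle V E"

text \<open>The vertices are \<open>x 1, \<dots>, x n\<close>, \<open>y 1, \<dots>, y m\<close>, \<open>z 1, \<dots>, z m\<close>, \<open>w 1, \<dots>, w (n + m)\<close>, all of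
  them different; \<open>B\<close> is the edge set of the connected bipartite graph.\<close>

definition leaf_triangle_structure ::
  "'v set \<Rightarrow> 'v set set \<Rightarrow> nat \<Rightarrow> nat \<Rightarrow> (nat \<Rightarrow> 'v) \<Rightarrow> (nat \<Rightarrow> 'v) \<Rightarrow> (nat \<Rightarrow> 'v) \<Rightarrow> (nat \<Rightarrow> 'v) \<Rightarrow> bool"
where
  "leaf_triangle_structure V E n m x y z w \<longleftrightarrow>
     inj_on x {1..n} \<and> inj_on y {1..m} \<and> inj_on z {1..m} \<and> inj_on w {1..n + m} \<and>
     x ` {1..n} \<inter> y ` {1..m} = {} \<and> x ` {1..n} \<inter> z ` {1..m} = {} \<and> x ` {1..n} \<inter> w ` {1..n + m} = {} \<and>
     y ` {1..m} \<inter> z ` {1..m} = {} \<and> y ` {1..m} \<inter> w ` {1..n + m} = {} \<and> z ` {1..m} \<inter> w ` {1..n + m} = {} \<and>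
     V = x ` {1..n} \<union> y ` {1..m} \<union> z ` {1..m} \<union> w ` {1..n + m} \<and>
     (\<exists>B. B \<subseteq> {{x i, y j} | i j. i \<in> {1..n} \<and> j \<in> {1..m}} \<and>
          connected_graph (x ` {1..n} \<union> y ` {1..m}) B \<and>
          E = B \<union> {{x i, w i} | i. i \<in> {1..n}}
                \<union> {{y j, z j} | j. j \<in> {1..m}}
                \<union> {{y j, w (n + j)} | j. j \<in> {1..m}}
                \<union> {{z j, w (n + j)} | j. j \<in> {1..m}})"

definition vertex_cover :: "'v set \<Rightarrow> 'v set set \<Rightarrow> 'v set \<Rightarrow> bool" where
  "vertex_cover V E C \<longleftrightarrow> C \<subseteq> V \<and> (\<forall>e\<in>E. e \<inter> C \<noteq> {})"

definition min_vertex_covers :: "'v set \<Rightarrow> 'v set set \<Rightarrow> 'v set set" where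
  "min_vertex_covers V E = {C. vertex_cover V E C \<and> (\<forall>D. D \<subset> C \<longrightarrow> \<not> vertex_cover V E D)}"


section \<open>Cohen--Macaulay rings\<close>

definition regular_sequence :: "('a, 'm) ring_scheme \<Rightarrow> 'a list \<Rightarrow> bool" where
  "regular_sequence R as \<longleftrightarrow>
     set as \<subseteq> carrier R \<and>
     (\<forall>i<length as. \<forall>b\<in>carrier R.
        as ! i \<otimes>\<^bsub>R\<^esub> b \<in> genideal R (set (take i as)) \<longrightarrow> b \<in> genideal R (set (take i as))) \<and>
     genideal R (set as) \<noteq> carrier R"

definition ideal_grade :: "('a, 'm) ring_scheme \<Rightarrow> 'a set \<Rightarrow> enat" where
  "ideal_grade R J = Sup {enat (length as) | as. regular_sequence R as \<and> set as \<subseteq> J}"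

definition ideal_height :: "('a, 'm) ring_scheme \<Rightarrow> 'a set \<Rightarrow> enat" where
  "ideal_height R P =
     Sup {enat h | h. \<exists>Q :: nat \<Rightarrow> 'a set.
            Q h = P \<and> (\<forall>i\<le>h. primeideal (Q i) R) \<and> (\<forall>i<h. Q i \<subset> Q (Suc i))}"

text \<open>For a maximal ideal \<open>M\<close>, the height of \<open>M\<close> is the dimension of the local ring at \<open>M\<close>, and the
  maximal length of a regular sequence in \<open>M\<close> is the depth of that local ring.\<close>

definition cohen_macaulay :: "('a, 'm) ring_scheme \<Rightarrow> bool" where
  "cohen_macaulay R \<longleftrightarrow>
     cring R \<and> noetherian_ring R \<and> (\<forall>M. maximalideal M R \<longrightarrow> ideal_grade R M = ideal_height R M)"


section \<open>Edge ideals and their residue rings\<close>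

text \<open>Algebras over a field \<open>'k\<close> are represented as \<open>module\<close> records, the ring of scalars being
  \<^term>\<open>class_ring\<close>. Monomials are finitely supported exponent functions.\<close>

definition poly_algebra :: "'v set \<Rightarrow> ('k::field, ('v \<Rightarrow>\<^sub>0 nat) \<Rightarrow>\<^sub>0 'k) module" where
  "poly_algebra V =
     \<lparr>carrier = {p. \<forall>\<mu>\<in>Poly_Mapping.keys p. Poly_Mapping.keys \<mu> \<subseteq> V},
      mult = (*), one = 1, zero = 0, add = (+),
      smult = (\<lambda>c p. Poly_Mapping.single 0 c * p)\<rparr>"

definition poly_var :: "'v \<Rightarrow> ('v \<Rightarrow>\<^sub>0 nat) \<Rightarrow>\<^sub>0 'k::field" where
  "poly_var v = Poly_Mapping.single (Poly_Mapping.single v 1) 1"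

definition homogeneous_polys :: "'v set \<Rightarrow> int \<Rightarrow> (('v \<Rightarrow>\<^sub>0 nat) \<Rightarrow>\<^sub>0 'k::field) set" where
  "homogeneous_polys V d =
     {p \<in> carrier (poly_algebra V).
        \<forall>\<mu>\<in>Poly_Mapping.keys p. int (\<Sum>v\<in>Poly_Mapping.keys \<mu>. Poly_Mapping.lookup \<mu> v) = d}"

definition edge_ideal :: "'v set \<Rightarrow> 'v set set \<Rightarrow> (('v \<Rightarrow>\<^sub>0 nat) \<Rightarrow>\<^sub>0 'k::field) set" where
  "edge_ideal V E = genideal (poly_algebra V) {poly_var u * poly_var v | u v. {u, v} \<in> E}"

text \<open>The quotient of a module by a submodule, and of an algebra by an ideal. In the former case the
  fields \<open>mult\<close> and \<open>one\<close> carry no meaning.\<close>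

definition quotient_module :: "('k, 'a, 'm) module_scheme \<Rightarrow> 'a set \<Rightarrow> ('k, 'a set) module" where
  "quotient_module M N =
     ring.extend (M Quot N) (module.fields (\<lambda>c X. \<Union>a\<in>X. N +>\<^bsub>M\<^esub> (c \<odot>\<^bsub>M\<^esub> a)))"

definition edge_ring :: "'v set \<Rightarrow> 'v set set \<Rightarrow> ('k::field, (('v \<Rightarrow>\<^sub>0 nat) \<Rightarrow>\<^sub>0 'k) set) module" where
  "edge_ring V E = quotient_module (poly_algebra V) (edge_ideal V E)"

definition edge_ring_var :: "'v set \<Rightarrow> 'v set set \<Rightarrow> 'v \<Rightarrow> (('v \<Rightarrow>\<^sub>0 nat) \<Rightarrow>\<^sub>0 'k::field) set" where
  "edge_ring_var V E v = edge_ideal V E +>\<^bsub>poly_algebra V\<^esub> poly_var v"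

definition edge_ring_grading ::
  "'v set \<Rightarrow> 'v set set \<Rightarrow> int \<Rightarrow> (('v \<Rightarrow>\<^sub>0 nat) \<Rightarrow>\<^sub>0 'k::field) set set" where
  "edge_ring_grading V E d = (\<lambda>p. edge_ideal V E +>\<^bsub>poly_algebra V\<^esub> p) ` homogeneous_polys V d"


section \<open>Localization at the powers of an element\<close>

text \<open>The fraction \<open>a / f\<^sup>k\<close>, as an equivalence class of pairs.\<close>

definition loc_frac :: "('a, 'm) ring_scheme \<Rightarrow> 'a \<Rightarrow> 'a \<Rightarrow> nat \<Rightarrow> ('a \<times> nat) set" where
  "loc_frac R f a k =
     {(b, l). b \<in> carrier R \<and>
        (\<exists>N::nat. f [^]\<^bsub>R\<^esub> N \<otimes>\<^bsub>R\<^esub> (f [^]\<^bsub>R\<^esub> l \<otimes>\<^bsub>R\<^esub> a) = f [^]\<^bsub>R\<^esub> N \<otimes>\<^bsub>R\<^esub> (f [^]\<^bsub>R\<^esub> k \<otimes>\<^bsub>R\<^esub> b))}"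

text \<open>The unions below run over all representatives and are unions of one and the same class.\<close>

definition localization :: "('k, 'a, 'm) module_scheme \<Rightarrow> 'a \<Rightarrow> ('k, ('a \<times> nat) set) module" where
  "localization R f =
     \<lparr>carrier = {loc_frac R f a k | a k. a \<in> carrier R},
      mult = (\<lambda>X Y. \<Union>(a, k)\<in>X. \<Union>(b, l)\<in>Y. loc_frac R f (a \<otimes>\<^bsub>R\<^esub> b) (k + l)),
      one = loc_frac R f \<one>\<^bsub>R\<^esub> 0,
      zero = loc_frac R f \<zero>\<^bsub>R\<^esub> 0,
      add = (\<lambda>X Y. \<Union>(a, k)\<in>X. \<Union>(b, l)\<in>Y.
               loc_frac R f (f [^]\<^bsub>R\<^esub> l \<otimes>\<^bsub>R\<^esub> a \<oplus>\<^bsub>R\<^esub> f [^]\<^bsub>R\<^esub> k \<otimes>\<^bsub>R\<^esub> b) (k + l)),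
      smult = (\<lambda>c X. \<Union>(a, k)\<in>X. loc_frac R f (c \<odot>\<^bsub>R\<^esub> a) k)\<rparr>"

text \<open>The canonical map \<open>R\<^sub>f \<rightarrow> R\<^sub>h\<close>, \<open>a / f\<^sup>k \<mapsto> a g\<^sup>k / h\<^sup>k\<close>, where \<open>h = f g\<close>.\<close>

definition loc_map :: "('a, 'm) ring_scheme \<Rightarrow> 'a \<Rightarrow> 'a \<Rightarrow> ('a \<times> nat) set \<Rightarrow> ('a \<times> nat) set" where
  "loc_map R g h X = (\<Union>(a, k)\<in>X. loc_frac R h (a \<otimes>\<^bsub>R\<^esub> g [^]\<^bsub>R\<^esub> k) k)"

text \<open>The degree \<open>j\<close> part of \<open>R\<^sub>f\<close>, where \<open>R\<close> is graded by \<open>gr\<close> and \<open>f\<close> is homogeneous of degree \<open>e\<close>.\<close>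

definition loc_grading ::
  "('a, 'm) ring_scheme \<Rightarrow> (int \<Rightarrow> 'a set) \<Rightarrow> 'a \<Rightarrow> nat \<Rightarrow> int \<Rightarrow> ('a \<times> nat) set set" where
  "loc_grading R gr f e j = {loc_frac R f a k | a k. a \<in> gr (j + int (e * k))}"


section \<open>Local cohomology\<close>

text \<open>Local cohomology of an algebra \<open>R\<close> with support in the ideal generated by a finite sequence
  \<open>fs\<close>, defined as the cohomology of the Cech complex of \<open>fs\<close>. The component of this complex in
  cohomological degree \<open>p\<close> is the product, over the \<open>p\<close>-element sets \<open>F\<close> of positions in \<open>fs\<close>, of the
  localizations of \<open>R\<close> at the product of the \<open>fs ! i\<close>, \<open>i \<in> F\<close>.\<close>

definition faces :: "'a list \<Rightarrow> nat \<Rightarrow> nat set set" where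
  "faces fs p = {F. F \<subseteq> {..<length fs} \<and> card F = p}"

definition face_elem :: "('a, 'm) ring_scheme \<Rightarrow> 'a list \<Rightarrow> nat set \<Rightarrow> 'a" where
  "face_elem R fs F = (\<Otimes>\<^bsub>R\<^esub>i\<in>F. fs ! i)"

definition product_algebra :: "'i set \<Rightarrow> ('i \<Rightarrow> ('k, 'a) module) \<Rightarrow> ('k, 'i \<Rightarrow> 'a) module" where
  "product_algebra I A =
     \<lparr>carrier = (\<Pi>\<^sub>E i\<in>I. carrier (A i)),
      mult = (\<lambda>c d. \<lambda>i\<in>I. c i \<otimes>\<^bsub>A i\<^esub> d i),
      one = (\<lambda>i\<in>I. \<one>\<^bsub>A i\<^esub>),
      zero = (\<lambda>i\<in>I. \<zero>\<^bsub>A i\<^esub>),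
      add = (\<lambda>c d. \<lambda>i\<in>I. c i \<oplus>\<^bsub>A i\<^esub> d i),
      smult = (\<lambda>a c. \<lambda>i\<in>I. a \<odot>\<^bsub>A i\<^esub> c i)\<rparr>"

definition cech ::
  "('k, 'a, 'm) module_scheme \<Rightarrow> 'a list \<Rightarrow> nat \<Rightarrow> ('k, nat set \<Rightarrow> ('a \<times> nat) set) module" where
  "cech R fs p = product_algebra (faces fs p) (\<lambda>F. localization R (face_elem R fs F))"

definition cech_diff ::
  "('k::field, 'a, 'm) module_scheme \<Rightarrow> 'a list \<Rightarrow> nat \<Rightarrow>
     (nat set \<Rightarrow> ('a \<times> nat) set) \<Rightarrow> (nat set \<Rightarrow> ('a \<times> nat) set)" where
  "cech_diff R fs p c =
     (\<lambda>F\<in>faces fs (Suc p).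
        \<Oplus>\<^bsub>localization R (face_elem R fs F)\<^esub>i\<in>F.
          (-1) ^ card {l\<in>F. l < i} \<odot>\<^bsub>localization R (face_elem R fs F)\<^esub>
            loc_map R (fs ! i) (face_elem R fs F) (c (F - {i})))"

definition cech_cocycles ::
  "('k::field, 'a, 'm) module_scheme \<Rightarrow> 'a list \<Rightarrow> nat \<Rightarrow> (nat set \<Rightarrow> ('a \<times> nat) set) set" where
  "cech_cocycles R fs p = a_kernel (cech R fs p) (cech R fs (Suc p)) (cech_diff R fs p)"

definition cech_coboundaries ::
  "('k::field, 'a, 'm) module_scheme \<Rightarrow> 'a list \<Rightarrow> nat \<Rightarrow> (nat set \<Rightarrow> ('a \<times> nat) set) set" where
  "cech_coboundaries R fs p =
     (case p of 0 \<Rightarrow> {\<zero>\<^bsub>cech R fs 0\<^esub>} | Suc q \<Rightarrow> cech_diff R fs q ` carrier (cech R fs q))"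

definition local_cohomology ::
  "('k::field, 'a, 'm) module_scheme \<Rightarrow> 'a list \<Rightarrow> nat \<Rightarrow>
     ('k, (nat set \<Rightarrow> ('a \<times> nat) set) set) module" where
  "local_cohomology R fs p =
     quotient_module ((cech R fs p)\<lparr>carrier := cech_cocycles R fs p\<rparr>) (cech_coboundaries R fs p)"

text \<open>The degree \<open>j\<close> part of local cohomology, for \<open>R\<close> graded by \<open>gr\<close> and elements \<open>fs ! i\<close> of
  degree \<open>1\<close>: the classes of the cocycles all of whose components are homogeneous of degree \<open>j\<close>.\<close>

definition local_cohomology_part ::
  "('k::field, 'a, 'm) module_scheme \<Rightarrow> (int \<Rightarrow> 'a set) \<Rightarrow> 'a list \<Rightarrow> nat \<Rightarrow> int \<Rightarrow>
     ('k, (nat set \<Rightarrow> ('a \<times> nat) set) set) module" where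
  "local_cohomology_part R gr fs p j =
     (local_cohomology R fs p)
       \<lparr>carrier := {cech_coboundaries R fs p +>\<^bsub>cech R fs p\<^esub> c | c.
          c \<in> cech_cocycles R fs p \<and>
          (\<forall>F\<in>faces fs p. c F \<in> loc_grading R gr (face_elem R fs F) (card F) j)}\<rparr>"

text \<open>Local cohomology of the edge ring with support in the homogeneous maximal ideal. The list \<open>vs\<close>
  enumerates the vertices.\<close>

definition edge_ring_lc_part ::
  "'v set \<Rightarrow> 'v set set \<Rightarrow> 'v list \<Rightarrow> nat \<Rightarrow> int \<Rightarrow>
     ('k::field, (nat set \<Rightarrow> ((('v \<Rightarrow>\<^sub>0 nat) \<Rightarrow>\<^sub>0 'k) set \<times> nat) set) set) module" where
  "edge_ring_lc_part V E vs =
     local_cohomology_part (edge_ring V E) (edge_ring_grading V E) (map (edge_ring_var V E) vs)"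

text \<open>The Hilbert series of a \<open>\<int>\<close>-graded vector space \<open>H\<close> whose degrees are bounded above is a
  Laurent series in \<open>t\<^sup>-\<^sup>1\<close>: the formal variable \<^term>\<open>fls_X\<close> stands for \<open>t\<^sup>-\<^sup>1\<close>, so the coefficient
  of \<open>t\<^sup>j\<close> is the one with index \<open>-j\<close>.\<close>

definition has_hilbert_series :: "(int \<Rightarrow> ('k::field, 'h) module) \<Rightarrow> rat fls \<Rightarrow> bool" where
  "has_hilbert_series H \<Phi> \<longleftrightarrow>
     (\<forall>j. vectorspace class_ring (H j) \<and> vectorspace.fin_dim class_ring (H j) \<and>
          of_nat (vectorspace.dim class_ring (H j)) = fls_nth \<Phi> (- j))"

end

theory Submission
  imports Defs
begin

text \<open>Put \<open>d = n + m\<close>. The leaf edges and the pendant triangles partition the vertex set into \<open>d\<close> cliques,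
  and each of these cliques contains a vertex, its whisker \<open>w\<^sub>i\<close>, all of whose neighbours lie in the
  clique. Let \<open>W\<close> be the set of whiskers, so that \<open>V' = V - W\<close>. An independent set has at most one vertex
  in each clique, and if it misses a clique, then the whisker can be added. So the facets \<open>F\<close> of the
  independence complex have exactly \<open>d\<close> elements, and their complements are the minimal vertex covers.

  The local cohomology in degree \<open>d\<close> is computed directly from the Cech complex on the variables. The
  localization of the edge ring at a set of variables vanishes unless the set is independent, so the
  complex ends in degree \<open>d\<close>, where all cochains are cocycles and the localization at a facet \<open>F\<close>
  is the Laurent polynomial ring on \<open>F\<close>. Hence the cohomology is spanned by Laurent monomials at facets,
  modulo the coboundaries that come from the ridges \<open>G\<close>, the independent sets with \<open>d - 1\<close> vertices.
  The coboundaries make a monomial at \<open>F\<close> zero if one of its exponents is positive, and they allow one to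
  replace a monomial in which a whisker of \<open>F\<close> has exponent zero by monomials at facets with fewer
  whiskers. What remains are the monomials at \<open>F\<close> with exponent \<open>- b\<close>, where \<open>b\<close> has values in the
  natural numbers and is positive at the whiskers in \<open>F\<close> (\<open>monomial_cochain_in_span\<close>).

  These monomials form a basis. For a facet \<open>F\<close>, choosing in each clique either the vertex of \<open>F\<close> or
  the whisker always gives an independent set. If \<open>F\<close> contains no whisker, these sets form the boundary of
  a cross polytope; in general the cliques whose whisker belongs to \<open>F\<close> contribute only one vertex.
  Evaluation of cochains on the fundamental chain, in the multidegree \<open>- b\<close>, vanishes on coboundaries
  (\<open>cycle_functional_coboundary\<close>), because \<open>b\<close> is positive at the whiskers in \<open>F\<close>, and the functionals
  obtained in this way are dual to the monomials up to signs (\<open>cycle_functional_class\<close>).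

  Finally the basis is counted. With \<open>X = t\<^sup>-\<^sup>1\<close> and \<open>v = X / (1 - X)\<close>, a facet \<open>F\<close> with \<open>a\<close> vertices in
  \<open>V'\<close> and \<open>d - a\<close> whiskers contributes \<open>(1 + v)\<^sup>a v\<^sup>d\<^sup>-\<^sup>a\<close>, since a vertex with arbitrary exponent
  contributes \<open>1 / (1 - X) = 1 + v\<close> and a whisker \<open>v\<close>. The binomial theorem gives the stated sum.\<close>

section \<open>Linear algebra\<close>

text \<open>Vector spaces are modules over \<^term>\<open>class_ring\<close>. Closure under negation is not
  demanded of a subspace: it follows from closure under multiplication by \<open>-1\<close>.\<close>

definition linear_subspace :: "('k::field, 'a, 'm) module_scheme \<Rightarrow> 'a set \<Rightarrow> bool" where
  "linear_subspace M T \<longleftrightarrow> T \<subseteq> carrier M \<and> \<zero>\<^bsub>M\<^esub> \<in> T \<and>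
     (\<forall>x\<in>T. \<forall>y\<in>T. x \<oplus>\<^bsub>M\<^esub> y \<in> T) \<and> (\<forall>c. \<forall>x\<in>T. c \<odot>\<^bsub>M\<^esub> x \<in> T)"

text \<open>A linear functional need only behave linearly on the carrier. Its values off the carrier are
  irrelevant.\<close>

definition linear_functional :: "('k::field, 'a, 'm) module_scheme \<Rightarrow> ('a \<Rightarrow> 'k) \<Rightarrow> bool" where
  "linear_functional M \<phi> \<longleftrightarrow>
     (\<forall>x\<in>carrier M. \<forall>y\<in>carrier M. \<phi> (x \<oplus>\<^bsub>M\<^esub> y) = \<phi> x + \<phi> y) \<and>
     (\<forall>c. \<forall>x\<in>carrier M. \<phi> (c \<odot>\<^bsub>M\<^esub> x) = c * \<phi> x)"

text \<open>Linear maps from \<open>A\<close> to \<open>B\<close>.\<close>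

definition linear_between ::
  "('k::field, 'a, 'm) module_scheme \<Rightarrow> ('k, 'b, 'n) module_scheme \<Rightarrow> ('a \<Rightarrow> 'b) \<Rightarrow> bool" where
  "linear_between A B f \<longleftrightarrow> f \<in> carrier A \<rightarrow> carrier B \<and>
     (\<forall>x\<in>carrier A. \<forall>y\<in>carrier A. f (x \<oplus>\<^bsub>A\<^esub> y) = f x \<oplus>\<^bsub>B\<^esub> f y) \<and>
     (\<forall>c. \<forall>x\<in>carrier A. f (c \<odot>\<^bsub>A\<^esub> x) = c \<odot>\<^bsub>B\<^esub> f x)"

lemma cring_class_ring: "cring (class_ring :: 'k::field ring)"
  using class_field[where ?'a = 'k] by (simp add: field_def domain_def)

lemma linear_functional_zero:
  assumes "module class_ring M" and "linear_functional M \<phi>"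
  shows "\<phi> \<zero>\<^bsub>M\<^esub> = 0"
proof -
  interpret module class_ring M by fact
  have "\<phi> (0 \<odot>\<^bsub>M\<^esub> \<zero>\<^bsub>M\<^esub>) = 0 * \<phi> \<zero>\<^bsub>M\<^esub>"
    using assms(2) unfolding linear_functional_def by blast
  moreover have "0 \<odot>\<^bsub>M\<^esub> \<zero>\<^bsub>M\<^esub> = \<zero>\<^bsub>M\<^esub>" using smult_r_null[of 0] by simp
  ultimately show ?thesis by simp
qed

lemma linear_functional_finsum:
  assumes "module class_ring M" and "linear_functional M \<phi>"
    and "f \<in> A \<rightarrow> carrier M"
  shows "\<phi> (\<Oplus>\<^bsub>M\<^esub>i\<in>A. f i) = (\<Sum>i\<in>A. \<phi> (f i))"
proof -
  interpret module class_ring M by fact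
  show ?thesis using assms(3)
  proof (induction A rule: infinite_finite_induct)
    case (infinite A)
    then show ?case by (simp add: M.finsum_infinite linear_functional_zero[OF assms(1,2)])
  next
    case empty
    then show ?case by (simp add: linear_functional_zero[OF assms(1,2)])
  next
    case (insert x F)
    then have "\<phi> (f x \<oplus>\<^bsub>M\<^esub> finsum M f F) = \<phi> (f x) + \<phi> (finsum M f F)"
      using assms(2) unfolding linear_functional_def by (auto intro!: M.finsum_closed)
    with insert show ?case by (simp add: M.finsum_insert)
  qed
qed

lemma linear_between_zero:
  assumes "module class_ring A" "module class_ring B" "linear_between A B f"
  shows "f \<zero>\<^bsub>A\<^esub> = \<zero>\<^bsub>B\<^esub>"
proof -
  interpret A: module class_ring A by fact
  interpret B: module class_ring B by fact
  have "f \<zero>\<^bsub>A\<^esub> \<in> carrier B" using assms(3) unfolding linear_between_def by auto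
  moreover have "f (0 \<odot>\<^bsub>A\<^esub> \<zero>\<^bsub>A\<^esub>) = 0 \<odot>\<^bsub>B\<^esub> f \<zero>\<^bsub>A\<^esub>"
    using assms(3) unfolding linear_between_def by blast
  moreover have "0 \<odot>\<^bsub>A\<^esub> \<zero>\<^bsub>A\<^esub> = \<zero>\<^bsub>A\<^esub>" using A.smult_r_null[of 0] by simp
  ultimately show ?thesis using B.smult_l_null[of "f \<zero>\<^bsub>A\<^esub>"] by simp
qed

lemma linear_between_comp:
  "linear_between A B f \<Longrightarrow> linear_between B C g \<Longrightarrow> linear_between A C (\<lambda>x. g (f x))"
  unfolding linear_between_def by (simp add: Pi_iff)

lemma linear_between_finsum:
  assumes B: "module class_ring B" and fin: "finite S"
    and f: "\<And>i. i \<in> S \<Longrightarrow> linear_between A B (f i)"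
  shows "linear_between A B (\<lambda>x. \<Oplus>\<^bsub>B\<^esub>i\<in>S. a i \<odot>\<^bsub>B\<^esub> f i x)"
proof -
  interpret B: module class_ring B by fact
  have fc: "f i x \<in> carrier B" if "i \<in> S" "x \<in> carrier A" for i x
    using f[OF that(1)] that(2) unfolding linear_between_def by blast
  have sc: "b \<odot>\<^bsub>B\<^esub> y \<in> carrier B" if "y \<in> carrier B" for b y
    using B.smult_closed[of b y] that by simp
  show ?thesis unfolding linear_between_def
  proof (intro conjI ballI allI funcsetI)
    fix x assume x: "x \<in> carrier A"
    show "(\<Oplus>\<^bsub>B\<^esub>i\<in>S. a i \<odot>\<^bsub>B\<^esub> f i x) \<in> carrier B"
      using fc sc x by (intro B.M.finsum_closed) auto
    have "f i (c \<odot>\<^bsub>A\<^esub> x) = c \<odot>\<^bsub>B\<^esub> f i x" if "i \<in> S" for c i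
      using f[OF that] x unfolding linear_between_def by blast
    moreover have "a i \<odot>\<^bsub>B\<^esub> (c \<odot>\<^bsub>B\<^esub> y) = c \<odot>\<^bsub>B\<^esub> (a i \<odot>\<^bsub>B\<^esub> y)" if "y \<in> carrier B" for c i y
      using B.smult_assoc1[of "a i" c y] B.smult_assoc1[of c "a i" y] that by (simp add: mult.commute)
    ultimately have "(\<Oplus>\<^bsub>B\<^esub>i\<in>S. a i \<odot>\<^bsub>B\<^esub> f i (c \<odot>\<^bsub>A\<^esub> x)) = (\<Oplus>\<^bsub>B\<^esub>i\<in>S. c \<odot>\<^bsub>B\<^esub> (a i \<odot>\<^bsub>B\<^esub> f i x))" for c
      using fc sc x by (intro B.M.finsum_cong'[OF refl]) auto
    then show "(\<Oplus>\<^bsub>B\<^esub>i\<in>S. a i \<odot>\<^bsub>B\<^esub> f i (c \<odot>\<^bsub>A\<^esub> x)) = c \<odot>\<^bsub>B\<^esub> (\<Oplus>\<^bsub>B\<^esub>i\<in>S. a i \<odot>\<^bsub>B\<^esub> f i x)" for c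
      using B.finsum_smult_ldistr[OF fin, of c "\<lambda>i. a i \<odot>\<^bsub>B\<^esub> f i x"] fc sc x by auto
    fix y assume y: "y \<in> carrier A"
    have "f i (x \<oplus>\<^bsub>A\<^esub> y) = f i x \<oplus>\<^bsub>B\<^esub> f i y" if "i \<in> S" for i
      using f[OF that] x y unfolding linear_between_def by blast
    then have "(\<Oplus>\<^bsub>B\<^esub>i\<in>S. a i \<odot>\<^bsub>B\<^esub> f i (x \<oplus>\<^bsub>A\<^esub> y)) = (\<Oplus>\<^bsub>B\<^esub>i\<in>S. a i \<odot>\<^bsub>B\<^esub> f i x \<oplus>\<^bsub>B\<^esub> a i \<odot>\<^bsub>B\<^esub> f i y)"
      using fc sc x y B.smult_r_distr by (intro B.M.finsum_cong'[OF refl]) auto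
    also have "\<dots> = (\<Oplus>\<^bsub>B\<^esub>i\<in>S. a i \<odot>\<^bsub>B\<^esub> f i x) \<oplus>\<^bsub>B\<^esub> (\<Oplus>\<^bsub>B\<^esub>i\<in>S. a i \<odot>\<^bsub>B\<^esub> f i y)"
      using fc sc x y by (intro B.M.finsum_addf) auto
    finally show "(\<Oplus>\<^bsub>B\<^esub>i\<in>S. a i \<odot>\<^bsub>B\<^esub> f i (x \<oplus>\<^bsub>A\<^esub> y)) =
        (\<Oplus>\<^bsub>B\<^esub>i\<in>S. a i \<odot>\<^bsub>B\<^esub> f i x) \<oplus>\<^bsub>B\<^esub> (\<Oplus>\<^bsub>B\<^esub>i\<in>S. a i \<odot>\<^bsub>B\<^esub> f i y)" .
  qed
qed

lemma linear_subspace_image: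
  assumes "module class_ring A" "module class_ring B" "linear_between A B f"
  shows "linear_subspace B (f ` carrier A)"
proof -
  interpret A: module class_ring A by fact
  interpret B: module class_ring B by fact
  note f = assms(3)[unfolded linear_between_def]
  show ?thesis unfolding linear_subspace_def
  proof (intro conjI ballI allI)
    show "f ` carrier A \<subseteq> carrier B" using f by auto
    show "\<zero>\<^bsub>B\<^esub> \<in> f ` carrier A"
      using linear_between_zero[OF assms] by (metis A.zero_closed image_eqI)
  next
    fix x y assume "x \<in> f ` carrier A" "y \<in> f ` carrier A"
    then obtain a b where "a \<in> carrier A" "b \<in> carrier A" "x = f a" "y = f b" by auto
    then show "x \<oplus>\<^bsub>B\<^esub> y \<in> f ` carrier A" using f by (metis A.a_closed imageI)
  next
    fix c x assume "x \<in> f ` carrier A"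
    then obtain a where "a \<in> carrier A" "x = f a" by auto
    then show "c \<odot>\<^bsub>B\<^esub> x \<in> f ` carrier A"
      using f A.smult_closed[of c a] by (metis UNIV_I imageI partial_object.select_convs(1))
  qed
qed

lemma linear_subspace_minus:
  assumes "module class_ring M" "linear_subspace M T" "x \<in> T"
  shows "\<ominus>\<^bsub>M\<^esub> x \<in> T"
proof -
  interpret module class_ring M by fact
  have x: "x \<in> carrier M" using assms unfolding linear_subspace_def by auto
  have "(- 1) \<odot>\<^bsub>M\<^esub> x = \<ominus>\<^bsub>M\<^esub> x"
    using smult_l_minus[of 1 x] x smult_one[OF x] by (simp add: class_ring_simps)
  moreover have "(- 1) \<odot>\<^bsub>M\<^esub> x \<in> T" using assms unfolding linear_subspace_def by blast
  ultimately show ?thesis by simp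
qed

lemma linear_subspace_abelian_subgroup:
  assumes "module class_ring M" "linear_subspace M N"
  shows "abelian_subgroup N M"
proof -
  interpret module class_ring M by fact
  have "subgroup N (add_monoid M)"
    using assms(2) linear_subspace_minus[OF assms]
    by (intro group.subgroupI[OF M.a_group]) (auto simp: linear_subspace_def a_inv_def)
  then show ?thesis
    by (intro abelian_subgroupI3 additive_subgroupI) (auto intro: M.abelian_group_axioms)
qed

text \<open>Scalar multiplication on \<^const>\<open>quotient_module\<close> is a union over all representatives of a
  coset; all of them give the same coset.\<close>

lemma quotient_smult:
  assumes "module class_ring M" "linear_subspace M N" "x \<in> carrier M"
  shows "(\<Union>a\<in>N +>\<^bsub>M\<^esub> x. N +>\<^bsub>M\<^esub> (c \<odot>\<^bsub>M\<^esub> a)) = N +>\<^bsub>M\<^esub> (c \<odot>\<^bsub>M\<^esub> x)"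
proof -
  interpret module class_ring M by fact
  interpret N: abelian_subgroup N M by (rule linear_subspace_abelian_subgroup[OF assms(1,2)])
  have "N +>\<^bsub>M\<^esub> (c \<odot>\<^bsub>M\<^esub> a) = N +>\<^bsub>M\<^esub> (c \<odot>\<^bsub>M\<^esub> x)" if a: "a \<in> N +>\<^bsub>M\<^esub> x" for a
  proof -
    from a obtain h where h: "h \<in> N" "a = h \<oplus>\<^bsub>M\<^esub> x"
      by (auto simp: a_r_coset_def r_coset_def)
    have hM: "h \<in> carrier M" using h by auto
    have "c \<odot>\<^bsub>M\<^esub> a = c \<odot>\<^bsub>M\<^esub> h \<oplus>\<^bsub>M\<^esub> c \<odot>\<^bsub>M\<^esub> x"
      using h hM assms(3) smult_r_distr[of c h x] by simp
    moreover have "c \<odot>\<^bsub>M\<^esub> h \<in> N" using assms(2) h unfolding linear_subspace_def by blast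
    ultimately have "c \<odot>\<^bsub>M\<^esub> a \<in> N +>\<^bsub>M\<^esub> (c \<odot>\<^bsub>M\<^esub> x)"
      by (auto simp: a_r_coset_def r_coset_def)
    then show ?thesis
      using N.a_repr_independence'[of "c \<odot>\<^bsub>M\<^esub> a" "c \<odot>\<^bsub>M\<^esub> x"] smult_closed[of c x] assms(3) by simp
  qed
  moreover have "x \<in> N +>\<^bsub>M\<^esub> x" by (rule N.a_rcos_self) fact
  ultimately show ?thesis by (intro SUP_eq_const) blast+
qed

lemma quotient_module_simps:
  "carrier (quotient_module M N) = a_rcosets\<^bsub>M\<^esub> N"
  "mult (quotient_module M N) = rcoset_mult M N"
  "one (quotient_module M N) = N +>\<^bsub>M\<^esub> \<one>\<^bsub>M\<^esub>"
  "zero (quotient_module M N) = N"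
  "add (quotient_module M N) = set_add M"
  "smult (quotient_module M N) = (\<lambda>c X. \<Union>a\<in>X. N +>\<^bsub>M\<^esub> (c \<odot>\<^bsub>M\<^esub> a))"
  by (simp_all add: quotient_module_def ring.defs module.defs FactRing_def)

text \<open>The image of a subspace \<open>D\<close> in \<open>M / N\<close> has dimension \<open>card B\<close> as soon as there is a family
  in \<open>D\<close>, indexed by \<open>B\<close>, which together with \<open>N\<close> spans \<open>D\<close>, and a family of functionals that
  vanish on \<open>N\<close> and are dual, up to nonzero factors, to that family.\<close>

lemma subquotient_dim:
  fixes M :: "('k::field, 'a, 'm) module_scheme"
  assumes M: "module class_ring M"
    and N: "linear_subspace M N"
    and D: "linear_subspace M D"
    and finB: "finite B"
    and e: "\<And>\<beta>. \<beta> \<in> B \<Longrightarrow> e \<beta> \<in> D"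
    and lin: "\<And>\<beta>. \<beta> \<in> B \<Longrightarrow> linear_functional M (\<phi> \<beta>)"
    and kills: "\<And>\<beta> x. \<beta> \<in> B \<Longrightarrow> x \<in> N \<Longrightarrow> \<phi> \<beta> x = 0"
    and diag: "\<And>\<beta>. \<beta> \<in> B \<Longrightarrow> \<phi> \<beta> (e \<beta>) \<noteq> 0"
    and off: "\<And>\<beta> \<gamma>. \<beta> \<in> B \<Longrightarrow> \<gamma> \<in> B \<Longrightarrow> \<beta> \<noteq> \<gamma> \<Longrightarrow> \<phi> \<beta> (e \<gamma>) = 0"
    and gen: "\<And>T. linear_subspace M T \<Longrightarrow> N \<subseteq> T \<Longrightarrow> e ` B \<subseteq> T \<Longrightarrow> D \<subseteq> T"
    and Q: "Q = (quotient_module M N)\<lparr>carrier := {N +>\<^bsub>M\<^esub> c | c. c \<in> D}\<rparr>"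
  shows "vectorspace class_ring Q" "vectorspace.fin_dim class_ring Q"
    "vectorspace.dim class_ring Q = card B"
proof -
  interpret M: module class_ring M by fact
  interpret N: abelian_subgroup N M by (rule linear_subspace_abelian_subgroup[OF M N])
  let ?q = "\<lambda>x. N +>\<^bsub>M\<^esub> x"
  have DM: "x \<in> carrier M" if "x \<in> D" for x using D that unfolding linear_subspace_def by auto
  have Dadd: "x \<oplus>\<^bsub>M\<^esub> y \<in> D" if "x \<in> D" "y \<in> D" for x y
    using D that unfolding linear_subspace_def by auto
  have Dsm: "c \<odot>\<^bsub>M\<^esub> x \<in> D" if "x \<in> D" for x c
    using D that unfolding linear_subspace_def by auto
  have D0: "\<zero>\<^bsub>M\<^esub> \<in> D" using D unfolding linear_subspace_def by auto
  have q0: "?q \<zero>\<^bsub>M\<^esub> = N" by (rule N.a_rcos_const) simp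
  have Qcar: "carrier Q = ?q ` D" by (auto simp: Q)
  have Qzero: "\<zero>\<^bsub>Q\<^esub> = ?q \<zero>\<^bsub>M\<^esub>" by (simp add: Q quotient_module_simps q0)
  have Qadd: "?q x \<oplus>\<^bsub>Q\<^esub> ?q y = ?q (x \<oplus>\<^bsub>M\<^esub> y)"
    if "x \<in> carrier M" "y \<in> carrier M" for x y
    using that by (simp add: Q quotient_module_simps N.a_rcos_sum)
  have Qsm: "c \<odot>\<^bsub>Q\<^esub> ?q x = ?q (c \<odot>\<^bsub>M\<^esub> x)" if "x \<in> carrier M" for x c
    using that by (simp add: Q quotient_module_simps quotient_smult[OF M N])
  have Qin: "?q x \<in> carrier Q" if "x \<in> D" for x using that Qcar by auto
  have modQ: "module class_ring Q"
  proof (rule module_criteria[OF cring_class_ring])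
    show "\<zero>\<^bsub>Q\<^esub> \<in> carrier Q" using Qzero Qin D0 by simp
    show "\<forall>v w. v \<in> carrier Q \<and> w \<in> carrier Q \<longrightarrow> v \<oplus>\<^bsub>Q\<^esub> w \<in> carrier Q"
      by (auto simp: Qcar Qadd Dadd DM)
    show "\<forall>v\<in>carrier Q. \<exists>neg_v\<in>carrier Q. v \<oplus>\<^bsub>Q\<^esub> neg_v = \<zero>\<^bsub>Q\<^esub>"
    proof
      fix v assume "v \<in> carrier Q"
      then obtain x where x: "x \<in> D" "v = ?q x" by (auto simp: Qcar)
      have "\<ominus>\<^bsub>M\<^esub> x \<in> D" by (rule linear_subspace_minus[OF M D x(1)])
      then show "\<exists>neg_v\<in>carrier Q. v \<oplus>\<^bsub>Q\<^esub> neg_v = \<zero>\<^bsub>Q\<^esub>"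
        using x by (intro bexI[of _ "?q (\<ominus>\<^bsub>M\<^esub> x)"]) (auto simp: Qadd Qzero Qcar M.M.r_neg DM)
    qed
    show "\<forall>c v. c \<in> carrier class_ring \<and> v \<in> carrier Q \<longrightarrow> c \<odot>\<^bsub>Q\<^esub> v \<in> carrier Q"
      by (auto simp: Qcar Qsm Dsm DM)
    show "\<forall>v w. v \<in> carrier Q \<and> w \<in> carrier Q \<longrightarrow> v \<oplus>\<^bsub>Q\<^esub> w = w \<oplus>\<^bsub>Q\<^esub> v"
      by (auto simp: Qcar Qadd M.M.a_comm DM)
    show "\<forall>v w x. v \<in> carrier Q \<and> w \<in> carrier Q \<and> x \<in> carrier Q \<longrightarrow>
        v \<oplus>\<^bsub>Q\<^esub> w \<oplus>\<^bsub>Q\<^esub> x = v \<oplus>\<^bsub>Q\<^esub> (w \<oplus>\<^bsub>Q\<^esub> x)"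
      by (auto simp: Qcar Qadd Dadd M.M.a_assoc DM)
    show "\<forall>v\<in>carrier Q. v \<oplus>\<^bsub>Q\<^esub> \<zero>\<^bsub>Q\<^esub> = v"
      by (auto simp: Qcar Qzero Qadd D0 DM)
    show "\<forall>a b v. a \<in> carrier class_ring \<and> b \<in> carrier class_ring \<and> v \<in> carrier Q \<longrightarrow>
        (a \<otimes>\<^bsub>class_ring\<^esub> b) \<odot>\<^bsub>Q\<^esub> v = a \<odot>\<^bsub>Q\<^esub> (b \<odot>\<^bsub>Q\<^esub> v)"
      using M.smult_assoc1 by (auto simp: Qcar Qsm Dsm DM)
    show "\<forall>v\<in>carrier Q. \<one>\<^bsub>class_ring\<^esub> \<odot>\<^bsub>Q\<^esub> v = v"
      using M.smult_one by (auto simp: Qcar Qsm DM)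
    show "\<forall>a b v. a \<in> carrier class_ring \<and> b \<in> carrier class_ring \<and> v \<in> carrier Q \<longrightarrow>
        (a \<oplus>\<^bsub>class_ring\<^esub> b) \<odot>\<^bsub>Q\<^esub> v = a \<odot>\<^bsub>Q\<^esub> v \<oplus>\<^bsub>Q\<^esub> b \<odot>\<^bsub>Q\<^esub> v"
      using M.smult_l_distr by (auto simp: Qcar Qsm Qadd Dsm DM)
    show "\<forall>a v w. a \<in> carrier class_ring \<and> v \<in> carrier Q \<and> w \<in> carrier Q \<longrightarrow>
        a \<odot>\<^bsub>Q\<^esub> (v \<oplus>\<^bsub>Q\<^esub> w) = a \<odot>\<^bsub>Q\<^esub> v \<oplus>\<^bsub>Q\<^esub> a \<odot>\<^bsub>Q\<^esub> w"
      using M.smult_r_distr by (auto simp: Qcar Qsm Qadd Dsm Dadd DM)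
  qed
  show vsQ: "vectorspace class_ring Q"
    using modQ class_field by (simp add: vectorspace_def)
  interpret Q: vectorspace class_ring Q by fact
  have \<phi>q: "\<phi> \<beta> x = 0" if "\<beta> \<in> B" "x \<in> D" "?q x = \<zero>\<^bsub>Q\<^esub>" for \<beta> x
  proof -
    have "x \<in> N" using that q0 Qzero N.a_rcos_self[OF DM[OF that(2)]] by simp
    then show ?thesis using kills that by simp
  qed
  have inj: "inj_on (\<lambda>\<beta>. ?q (e \<beta>)) B"
  proof (rule inj_onI, rule ccontr)
    fix \<beta> \<gamma> assume b: "\<beta> \<in> B" "\<gamma> \<in> B" "?q (e \<beta>) = ?q (e \<gamma>)" "\<beta> \<noteq> \<gamma>"
    then have "e \<beta> \<in> ?q (e \<gamma>)" using N.a_rcos_self[OF DM[OF e[OF b(1)]]] by simp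
    then obtain h where h: "h \<in> N" "e \<beta> = h \<oplus>\<^bsub>M\<^esub> e \<gamma>"
      by (auto simp: a_r_coset_def r_coset_def)
    then have "\<phi> \<beta> (e \<beta>) = \<phi> \<beta> h + \<phi> \<beta> (e \<gamma>)"
      using lin[OF b(1)] DM[OF e[OF b(2)]] unfolding linear_functional_def by auto
    then show False using kills[OF b(1) h(1)] off[OF b(1,2,4)] diag[OF b(1)] by simp
  qed
  let ?S = "(\<lambda>\<beta>. ?q (e \<beta>)) ` B"
  have S: "finite ?S" "?S \<subseteq> carrier Q" using finB e Qcar by auto
  have qsum: "(\<Oplus>\<^bsub>Q\<^esub>\<beta>\<in>A. a \<beta> \<odot>\<^bsub>Q\<^esub> ?q (e \<beta>)) = ?q (\<Oplus>\<^bsub>M\<^esub>\<beta>\<in>A. a \<beta> \<odot>\<^bsub>M\<^esub> e \<beta>)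
      \<and> (\<Oplus>\<^bsub>M\<^esub>\<beta>\<in>A. a \<beta> \<odot>\<^bsub>M\<^esub> e \<beta>) \<in> D" if "A \<subseteq> B" for A a
    using finite_subset[OF that finB] that
  proof (induction A rule: finite_induct)
    case empty
    then show ?case by (simp add: Qzero D0)
  next
    case (insert \<beta> A)
    have eM: "e \<gamma> \<in> D" if "\<gamma> \<in> insert \<beta> A" for \<gamma> using insert.prems that e by auto
    have f1: "(\<lambda>\<beta>. a \<beta> \<odot>\<^bsub>M\<^esub> e \<beta>) \<in> A \<rightarrow> carrier M"
      "a \<beta> \<odot>\<^bsub>M\<^esub> e \<beta> \<in> D" using eM Dsm DM by auto
    have f2: "(\<lambda>\<beta>. a \<beta> \<odot>\<^bsub>Q\<^esub> ?q (e \<beta>)) \<in> A \<rightarrow> carrier Q"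
      "a \<beta> \<odot>\<^bsub>Q\<^esub> ?q (e \<beta>) \<in> carrier Q" using eM Dsm DM Qin by (auto simp: Qsm DM)
    let ?s = "\<Oplus>\<^bsub>M\<^esub>\<beta>\<in>A. a \<beta> \<odot>\<^bsub>M\<^esub> e \<beta>"
    have IH: "(\<Oplus>\<^bsub>Q\<^esub>\<beta>\<in>A. a \<beta> \<odot>\<^bsub>Q\<^esub> ?q (e \<beta>)) = ?q ?s" "?s \<in> D"
      using insert.IH insert.prems by auto
    have "(\<Oplus>\<^bsub>Q\<^esub>\<beta>\<in>insert \<beta> A. a \<beta> \<odot>\<^bsub>Q\<^esub> ?q (e \<beta>)) = a \<beta> \<odot>\<^bsub>Q\<^esub> ?q (e \<beta>) \<oplus>\<^bsub>Q\<^esub> ?q ?s"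
      unfolding IH(1)[symmetric] by (rule Q.module.M.finsum_insert) (use insert.hyps f2 in auto)
    also have "\<dots> = ?q (a \<beta> \<odot>\<^bsub>M\<^esub> e \<beta> \<oplus>\<^bsub>M\<^esub> ?s)"
      using eM[of \<beta>] IH(2) by (simp add: Qsm Qadd Dsm DM)
    finally have 1: "(\<Oplus>\<^bsub>Q\<^esub>\<beta>\<in>insert \<beta> A. a \<beta> \<odot>\<^bsub>Q\<^esub> ?q (e \<beta>)) = ?q (a \<beta> \<odot>\<^bsub>M\<^esub> e \<beta> \<oplus>\<^bsub>M\<^esub> ?s)" .
    have 2: "(\<Oplus>\<^bsub>M\<^esub>\<beta>\<in>insert \<beta> A. a \<beta> \<odot>\<^bsub>M\<^esub> e \<beta>) = a \<beta> \<odot>\<^bsub>M\<^esub> e \<beta> \<oplus>\<^bsub>M\<^esub> ?s"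
      by (rule M.M.finsum_insert) (use insert.hyps f1 DM in auto)
    show ?case unfolding 1 2 using f1(2) IH(2) Dadd by simp
  qed
  have li: "Q.lin_indpt ?S"
  proof (rule Q.finite_lin_indpt2[OF S])
    fix a :: "'a set \<Rightarrow> 'k" assume lc: "Q.lincomb a ?S = \<zero>\<^bsub>Q\<^esub>"
    let ?a = "\<lambda>\<beta>. a (?q (e \<beta>))" and ?c = "\<Oplus>\<^bsub>M\<^esub>\<beta>\<in>B. a (?q (e \<beta>)) \<odot>\<^bsub>M\<^esub> e \<beta>"
    have "Q.lincomb a ?S = (\<Oplus>\<^bsub>Q\<^esub>\<beta>\<in>B. ?a \<beta> \<odot>\<^bsub>Q\<^esub> ?q (e \<beta>))"
      unfolding Q.lincomb_def
      by (rule Q.module.M.finsum_reindex[OF _ inj]) (auto simp: Qsm e Dsm Qin DM)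
    with lc qsum[of B ?a] have c0: "?q ?c = \<zero>\<^bsub>Q\<^esub>" "?c \<in> D" by simp_all
    have "?a \<beta> = 0" if b: "\<beta> \<in> B" for \<beta>
    proof -
      have "0 = \<phi> \<beta> ?c" using \<phi>q[OF b c0(2,1)] by simp
      also have "\<dots> = (\<Sum>\<gamma>\<in>B. \<phi> \<beta> (?a \<gamma> \<odot>\<^bsub>M\<^esub> e \<gamma>))"
        by (rule linear_functional_finsum[OF M lin[OF b]]) (auto simp: e DM Dsm)
      also have "\<dots> = (\<Sum>\<gamma>\<in>B. ?a \<gamma> * \<phi> \<beta> (e \<gamma>))"
        using lin[OF b] DM[OF e] unfolding linear_functional_def by (intro sum.cong) auto
      also have "\<dots> = (\<Sum>\<gamma>\<in>{\<beta>}. ?a \<gamma> * \<phi> \<beta> (e \<gamma>))"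
        using b finB off by (intro sum.mono_neutral_right) auto
      finally show ?thesis using diag[OF b] by simp
    qed
    then show "\<forall>v\<in>?S. a v = \<zero>\<^bsub>class_ring\<^esub>" by auto
  qed
  have sub: "LinearCombinations.submodule class_ring (Q.span ?S) Q"
    using Q.module.span_is_submodule[OF S(2)] .
  let ?T = "{x \<in> carrier M. ?q x \<in> Q.span ?S}"
  have T: "linear_subspace M ?T"
    unfolding linear_subspace_def
  proof (intro conjI ballI allI)
    show "?T \<subseteq> carrier M" by auto
    show "\<zero>\<^bsub>M\<^esub> \<in> ?T"
      using LinearCombinations.submodule.zero_closed[OF sub] Qzero by simp
  next
    fix x y assume "x \<in> ?T" "y \<in> ?T"
    then show "x \<oplus>\<^bsub>M\<^esub> y \<in> ?T"
      using LinearCombinations.submodule.m_closed[OF sub, of "?q x" "?q y"] by (simp add: Qadd)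
  next
    fix c x assume "x \<in> ?T"
    then show "c \<odot>\<^bsub>M\<^esub> x \<in> ?T"
      using LinearCombinations.submodule.smult_closed[OF sub, of c "?q x"] M.smult_closed[of c x]
      by (simp add: Qsm)
  qed
  have "D \<subseteq> ?T"
  proof (rule gen[OF T])
    show "e ` B \<subseteq> ?T" using e DM Q.span_mem[OF S(2)] by auto
    have "?q x \<in> Q.span ?S" if "x \<in> N" for x
      using that LinearCombinations.submodule.zero_closed[OF sub] Qzero q0 N.a_rcos_const by simp
    then show "N \<subseteq> ?T" by auto
  qed
  then have "Q.span ?S = carrier Q"
    using Q.span_is_subset2[OF S(2)] by (auto simp: Qcar)
  then have basis: "Q.basis ?S" using li S by (simp add: Q.basis_def)
  show "Q.fin_dim" unfolding Q.fin_dim_def using S \<open>Q.span ?S = carrier Q\<close> by blast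
  show "Q.dim = card B" using Q.dim_basis[OF S(1) basis] card_image[OF inj] by simp
qed
lemma module_product_algebra:
  assumes "\<And>i. i \<in> I \<Longrightarrow> module (class_ring :: 'k::field ring) (A i)"
  shows "module class_ring (product_algebra I A)"
proof (rule module_criteria[OF cring_class_ring])
  have A: "abelian_group (A i)" if "i \<in> I" for i using assms[OF that] by (simp add: module_def)
  have m: "abelian_monoid (A i)" if "i \<in> I" for i using A[OF that] by (simp add: abelian_group_def)
  have s: "carrier (product_algebra I A) = (\<Pi>\<^sub>E i\<in>I. carrier (A i))"
    "\<zero>\<^bsub>product_algebra I A\<^esub> = (\<lambda>i\<in>I. \<zero>\<^bsub>A i\<^esub>)"
    "\<And>c d. c \<oplus>\<^bsub>product_algebra I A\<^esub> d = (\<lambda>i\<in>I. c i \<oplus>\<^bsub>A i\<^esub> d i)"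
    "\<And>a c. a \<odot>\<^bsub>product_algebra I A\<^esub> c = (\<lambda>i\<in>I. a \<odot>\<^bsub>A i\<^esub> c i)"
    by (simp_all add: product_algebra_def)
  have ac: "x \<oplus>\<^bsub>A i\<^esub> y \<in> carrier (A i)" if "i \<in> I" "x \<in> carrier (A i)" "y \<in> carrier (A i)" for i x y
    using abelian_monoid.a_closed[OF m] that by blast
  have sc: "a \<odot>\<^bsub>A i\<^esub> x \<in> carrier (A i)" if "i \<in> I" "x \<in> carrier (A i)" for i x a
    using module.smult_closed[OF assms[OF that(1)], of a x] that by simp
  let ?P = "product_algebra I A"
  show "\<zero>\<^bsub>?P\<^esub> \<in> carrier ?P" using abelian_monoid.zero_closed[OF m] by (simp add: s)
  show "\<forall>v w. v \<in> carrier ?P \<and> w \<in> carrier ?P \<longrightarrow> v \<oplus>\<^bsub>?P\<^esub> w \<in> carrier ?P"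
    by (auto simp: s intro!: ac)
  show "\<forall>v\<in>carrier ?P. \<exists>neg_v\<in>carrier ?P. v \<oplus>\<^bsub>?P\<^esub> neg_v = \<zero>\<^bsub>?P\<^esub>"
  proof
    fix v assume v: "v \<in> carrier ?P"
    show "\<exists>neg_v\<in>carrier ?P. v \<oplus>\<^bsub>?P\<^esub> neg_v = \<zero>\<^bsub>?P\<^esub>"
      by (rule bexI[of _ "\<lambda>i\<in>I. \<ominus>\<^bsub>A i\<^esub> v i"])
        (use v in \<open>auto simp: s abelian_group.a_inv_closed[OF A] abelian_group.r_neg[OF A] intro!: restrict_ext dest: PiE_mem\<close>)
  qed
  show "\<forall>c v. c \<in> carrier class_ring \<and> v \<in> carrier ?P \<longrightarrow> c \<odot>\<^bsub>?P\<^esub> v \<in> carrier ?P"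
    by (auto simp: s intro!: sc)
  show "\<forall>v w. v \<in> carrier ?P \<and> w \<in> carrier ?P \<longrightarrow> v \<oplus>\<^bsub>?P\<^esub> w = w \<oplus>\<^bsub>?P\<^esub> v"
    by (auto simp: s intro!: restrict_ext abelian_monoid.a_comm[OF m] dest: PiE_mem)
  show "\<forall>v w x. v \<in> carrier ?P \<and> w \<in> carrier ?P \<and> x \<in> carrier ?P \<longrightarrow>
      v \<oplus>\<^bsub>?P\<^esub> w \<oplus>\<^bsub>?P\<^esub> x = v \<oplus>\<^bsub>?P\<^esub> (w \<oplus>\<^bsub>?P\<^esub> x)"
    by (auto simp: s intro!: restrict_ext abelian_monoid.a_assoc[OF m] dest: PiE_mem)
  show "\<forall>v\<in>carrier ?P. v \<oplus>\<^bsub>?P\<^esub> \<zero>\<^bsub>?P\<^esub> = v"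
    by (auto simp: s fun_eq_iff restrict_def abelian_monoid.r_zero[OF m] dest: PiE_mem PiE_arb)
  show "\<forall>a b v. a \<in> carrier class_ring \<and> b \<in> carrier class_ring \<and> v \<in> carrier ?P \<longrightarrow>
      (a \<otimes>\<^bsub>class_ring\<^esub> b) \<odot>\<^bsub>?P\<^esub> v = a \<odot>\<^bsub>?P\<^esub> (b \<odot>\<^bsub>?P\<^esub> v)"
    using module.smult_assoc1[OF assms] by (auto simp: s intro!: restrict_ext dest: PiE_mem)
  show "\<forall>v\<in>carrier ?P. \<one>\<^bsub>class_ring\<^esub> \<odot>\<^bsub>?P\<^esub> v = v"
    using module.smult_one[OF assms] by (auto simp: s fun_eq_iff restrict_def dest: PiE_mem PiE_arb)
  show "\<forall>a b v. a \<in> carrier class_ring \<and> b \<in> carrier class_ring \<and> v \<in> carrier ?P \<longrightarrow>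
      (a \<oplus>\<^bsub>class_ring\<^esub> b) \<odot>\<^bsub>?P\<^esub> v = a \<odot>\<^bsub>?P\<^esub> v \<oplus>\<^bsub>?P\<^esub> b \<odot>\<^bsub>?P\<^esub> v"
    using module.smult_l_distr[OF assms] by (auto simp: s intro!: restrict_ext dest: PiE_mem)
  show "\<forall>a v w. a \<in> carrier class_ring \<and> v \<in> carrier ?P \<and> w \<in> carrier ?P \<longrightarrow>
      a \<odot>\<^bsub>?P\<^esub> (v \<oplus>\<^bsub>?P\<^esub> w) = a \<odot>\<^bsub>?P\<^esub> v \<oplus>\<^bsub>?P\<^esub> a \<odot>\<^bsub>?P\<^esub> w"
    by (auto simp: s intro!: restrict_ext module.smult_r_distr[OF assms] dest: PiE_mem)
qed

section \<open>Polynomials and edge rings\<close>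

abbreviation lookup :: "('a \<Rightarrow>\<^sub>0 'b::zero) \<Rightarrow> 'a \<Rightarrow> 'b" where "lookup \<equiv> Poly_Mapping.lookup"
abbreviation keys :: "('a \<Rightarrow>\<^sub>0 'b::zero) \<Rightarrow> 'a set" where "keys \<equiv> Poly_Mapping.keys"
abbreviation single :: "'a \<Rightarrow> 'b::zero \<Rightarrow> 'a \<Rightarrow>\<^sub>0 'b" where "single \<equiv> Poly_Mapping.single"

text \<open>Polynomials in the variables \<open>'v\<close> with coefficients in \<open>'k\<close>.\<close>

type_synonym ('v, 'k) mpoly = "('v \<Rightarrow>\<^sub>0 nat) \<Rightarrow>\<^sub>0 'k"

lemma lookup_single_times:
  fixes \<mu> \<nu> :: "'v \<Rightarrow>\<^sub>0 nat" and c :: "'k::comm_semiring_1"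
  shows "lookup (single \<mu> c * p) (\<mu> + \<nu>) = c * lookup p \<nu>"
  by (simp add: lookup_mult lookup_single when_mult)

lemma lookup_single_times_eq_0:
  fixes \<mu> \<nu> :: "'v \<Rightarrow>\<^sub>0 nat" and c :: "'k::comm_semiring_1"
  assumes "lookup \<nu> v < lookup \<mu> v"
  shows "lookup (single \<mu> c * p) \<nu> = 0"
proof -
  have "\<nu> \<noteq> \<mu> + \<rho>" for \<rho> using assms by (auto simp: lookup_add)
  then show ?thesis by (simp add: lookup_mult lookup_single when_mult)
qed

lemma poly_algebra_simps:
  "carrier (poly_algebra V) = {p. \<forall>\<mu>\<in>keys p. keys \<mu> \<subseteq> V}"
  "mult (poly_algebra V) = (*)" "one (poly_algebra V) = 1"
  "zero (poly_algebra V) = 0" "add (poly_algebra V) = (+)"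
  "smult (poly_algebra V) = (\<lambda>c p. single 0 c * p)"
  by (simp_all add: poly_algebra_def)

lemma keys_add_nat: "keys ((\<mu>::'v \<Rightarrow>\<^sub>0 nat) + \<nu>) = keys \<mu> \<union> keys \<nu>"
  by (auto simp: in_keys_iff lookup_add)

lemma poly_algebra_mult_closed:
  assumes "p \<in> carrier (poly_algebra V)" "q \<in> carrier (poly_algebra V)"
  shows "p * q \<in> carrier (poly_algebra V :: ('k::field, _) module)"
proof -
  have "keys \<mu> \<subseteq> V" if \<mu>: "\<mu> \<in> keys (p * q)" for \<mu>
  proof -
    obtain a b where "\<mu> = a + b" "a \<in> keys p" "b \<in> keys q"
      using \<mu> keys_mult[of p q] by blast
    then show ?thesis using assms by (simp add: keys_add_nat poly_algebra_simps)
  qed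
  then show ?thesis by (simp add: poly_algebra_simps)
qed

lemma poly_algebra_add_closed:
  assumes "p \<in> carrier (poly_algebra V)" "q \<in> carrier (poly_algebra V)"
  shows "p + q \<in> carrier (poly_algebra V :: ('k::field, _) module)"
  using assms keys_add[of p q] by (auto simp: poly_algebra_simps)

lemma poly_algebra_uminus_closed:
  assumes "p \<in> carrier (poly_algebra V)"
  shows "- p \<in> carrier (poly_algebra V :: ('k::field, _) module)"
  using assms by (auto simp: poly_algebra_simps in_keys_iff)

lemma poly_algebra_single_closed:
  "keys \<mu> \<subseteq> V \<Longrightarrow> single \<mu> c \<in> carrier (poly_algebra V :: ('k::field, _) module)"
  by (simp add: poly_algebra_simps)

lemma poly_algebra_zero_closed: "0 \<in> carrier (poly_algebra V :: ('k::field, _) module)"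
  by (simp add: poly_algebra_simps(1))

lemma poly_algebra_sum_closed:
  "(\<And>i. i \<in> A \<Longrightarrow> f i \<in> carrier (poly_algebra V)) \<Longrightarrow>
     sum f A \<in> carrier (poly_algebra V :: ('k::field, _) module)"
  by (induction A rule: infinite_finite_induct)
    (auto intro: poly_algebra_add_closed poly_algebra_zero_closed)

lemma cring_poly_algebra: "cring (poly_algebra V :: ('k::field, ('v, 'k) mpoly) module)"
proof (rule cringI)
  show "abelian_group (poly_algebra V :: ('k, ('v, 'k) mpoly) module)"
  proof (rule abelian_groupI)
    fix p :: "('v, 'k) mpoly" assume "p \<in> carrier (poly_algebra V)"
    then show "\<exists>y\<in>carrier (poly_algebra V). y \<oplus>\<^bsub>poly_algebra V\<^esub> p = \<zero>\<^bsub>poly_algebra V\<^esub>"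
      by (intro bexI[of _ "- p"]) (auto intro: poly_algebra_uminus_closed simp: poly_algebra_simps(2-))
  qed (auto intro: poly_algebra_add_closed poly_algebra_zero_closed simp: poly_algebra_simps(2-) add_ac)
  show "comm_monoid (poly_algebra V :: ('k, ('v, 'k) mpoly) module)"
    by (rule comm_monoidI)
      (auto intro: poly_algebra_mult_closed poly_algebra_single_closed[of 0 _ 1, simplified]
        simp: poly_algebra_simps(2-) mult_ac)
qed (auto simp: poly_algebra_simps(2-) algebra_simps)

lemma module_poly_algebra:
  "module class_ring (poly_algebra V :: ('k::field, ('v, 'k) mpoly) module)"
proof -
  interpret cring "poly_algebra V :: ('k, ('v, 'k) mpoly) module" by (rule cring_poly_algebra)
  show ?thesis
  proof (rule moduleI[OF cring_class_ring abelian_group_axioms])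
    fix a b :: 'k and p :: "('v, 'k) mpoly"
    show "(a \<otimes>\<^bsub>class_ring\<^esub> b) \<odot>\<^bsub>poly_algebra V\<^esub> p = a \<odot>\<^bsub>poly_algebra V\<^esub> (b \<odot>\<^bsub>poly_algebra V\<^esub> p)"
      by (simp add: poly_algebra_simps(2-) mult_single mult.assoc[symmetric])
  qed (auto intro!: poly_algebra_mult_closed poly_algebra_single_closed
      simp: poly_algebra_simps(2-) single_add algebra_simps)
qed

text \<open>A set of vertices is independent if it contains no edge.\<close>

definition independent :: "'v set set \<Rightarrow> 'v set \<Rightarrow> bool" where
  "independent E S \<longleftrightarrow> (\<forall>e\<in>E. \<not> e \<subseteq> S)"

lemma independent_mono: "independent E S \<Longrightarrow> T \<subseteq> S \<Longrightarrow> independent E T"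
  unfolding independent_def by blast

lemma poly_var_in_carrier: "v \<in> V \<Longrightarrow> poly_var v \<in> carrier (poly_algebra V :: ('k::field, _) module)"
  unfolding poly_var_def by (rule poly_algebra_single_closed) simp

text \<open>The edge ideal is spanned by the monomials with dependent support: coefficients at monomials with
  independent support vanish on it, and by \<open>dependent_monomial_in_edge_ideal\<close> below the other
  monomials lie in it. Hence the former coefficients are well defined on the edge ring.\<close>

lemma lookup_edge_ideal:
  fixes p :: "('v, 'k::field) mpoly"
  assumes "simple_graph V E" "p \<in> edge_ideal V E" "independent E (keys \<mu>)"
  shows "lookup p \<mu> = 0"
proof -
  interpret P: cring "poly_algebra V :: ('k, ('v, 'k) mpoly) module" by (rule cring_poly_algebra)
  let ?J = "{p \<in> carrier (poly_algebra V :: ('k, ('v, 'k) mpoly) module).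
      \<forall>\<mu>. independent E (keys \<mu>) \<longrightarrow> lookup p \<mu> = 0}"
  have mult: "lookup (p * q) \<mu> = 0"
    if p: "\<And>\<nu>. independent E (keys \<nu>) \<Longrightarrow> lookup p \<nu> = 0"
      and \<mu>: "independent E (keys \<mu>)" for p q :: "('v, 'k) mpoly" and \<mu>
  proof -
    have "\<mu> \<notin> keys (p * q)"
    proof
      assume "\<mu> \<in> keys (p * q)"
      then obtain a b where ab: "\<mu> = a + b" "a \<in> keys p"
        using keys_mult[of p q] by blast
      then have "independent E (keys a)"
        using \<mu> independent_mono by (metis keys_add_nat sup_ge1)
      with p ab show False by (simp add: in_keys_iff)
    qed
    then show ?thesis by (simp add: in_keys_iff)
  qed
  have "ideal ?J (poly_algebra V)"
  proof (rule idealI)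
    show "subgroup ?J (add_monoid (poly_algebra V))"
    proof (rule group.subgroupI[OF P.a_group])
      have "0 \<in> ?J" by (simp add: poly_algebra_simps)
      then show "?J \<noteq> {}" by blast
      fix a b assume a: "a \<in> ?J" and b: "b \<in> ?J"
      then show "a \<otimes>\<^bsub>add_monoid (poly_algebra V)\<^esub> b \<in> ?J"
        by (auto intro: poly_algebra_add_closed simp: poly_algebra_simps(2-) lookup_add)
      have "inv\<^bsub>add_monoid (poly_algebra V)\<^esub> a = - a"
        using a by (intro group.inv_equality[OF P.a_group])
          (auto intro: poly_algebra_uminus_closed simp: poly_algebra_simps(2-))
      then show "inv\<^bsub>add_monoid (poly_algebra V)\<^esub> a \<in> ?J"
        using a by (auto intro: poly_algebra_uminus_closed)
    qed auto
  next
    fix a q assume a: "a \<in> ?J" and q: "q \<in> carrier (poly_algebra V :: ('k, ('v, 'k) mpoly) module)"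
    then show "a \<otimes>\<^bsub>poly_algebra V\<^esub> q \<in> ?J"
      by (auto intro: poly_algebra_mult_closed mult simp: poly_algebra_simps(2))
    then show "q \<otimes>\<^bsub>poly_algebra V\<^esub> a \<in> ?J" using a q P.m_comm by auto
  qed (rule P.ring_axioms)
  moreover have "{poly_var u * poly_var v | u v. {u, v} \<in> E} \<subseteq> ?J"
  proof clarify
    fix u v assume uv: "{u, v} \<in> E"
    have "poly_var u * poly_var v =
        (single (single u 1 + single v 1) 1 :: ('v, 'k) mpoly)"
      by (simp add: poly_var_def mult_single)
    moreover have "single u 1 + single v 1 \<noteq> \<mu>"
      if "independent E (keys \<mu>)" for \<mu> :: "'v \<Rightarrow>\<^sub>0 nat"
      using that uv by (auto simp: independent_def keys_add_nat)
    moreover have "poly_var u * poly_var v \<in> carrier (poly_algebra V :: ('k, ('v, 'k) mpoly) module)"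
      using uv assms(1) by (intro poly_algebra_mult_closed poly_var_in_carrier) (auto simp: simple_graph_def)
    ultimately show "poly_var u * poly_var v \<in> carrier (poly_algebra V :: ('k, ('v, 'k) mpoly) module) \<and>
       (\<forall>\<mu>. independent E (keys \<mu>) \<longrightarrow>
         lookup (poly_var u * poly_var v :: ('v, 'k) mpoly) \<mu> = 0)"
      by (simp add: lookup_single)
  qed
  ultimately have "edge_ideal V E \<subseteq> ?J"
    unfolding edge_ideal_def by (rule P.genideal_minimal)
  then show ?thesis using assms by blast
qed

lemma ideal_edge_ideal:
  assumes "simple_graph V E"
  shows "ideal (edge_ideal V E) (poly_algebra V :: ('k::field, ('v, 'k) mpoly) module)"
proof -
  interpret P: cring "poly_algebra V :: ('k, ('v, 'k) mpoly) module" by (rule cring_poly_algebra)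
  show ?thesis unfolding edge_ideal_def
    using assms by (intro P.genideal_ideal)
      (auto simp: simple_graph_def intro!: poly_algebra_mult_closed poly_var_in_carrier)
qed

lemma dependent_monomial_in_edge_ideal:
  fixes \<mu> :: "'v \<Rightarrow>\<^sub>0 nat" and c :: "'k::field"
  assumes G: "simple_graph V E" and \<mu>: "keys \<mu> \<subseteq> V" "\<not> independent E (keys \<mu>)"
  shows "single \<mu> c \<in> edge_ideal V E"
proof -
  interpret P: cring "poly_algebra V :: ('k, ('v, 'k) mpoly) module" by (rule cring_poly_algebra)
  interpret I: ideal "edge_ideal V E" "poly_algebra V :: ('k, ('v, 'k) mpoly) module"
    by (rule ideal_edge_ideal[OF G])
  obtain e where e: "e \<in> E" "e \<subseteq> keys \<mu>" using \<mu>(2) unfolding independent_def by blast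
  then obtain u v where uv: "e = {u, v}" "u \<noteq> v"
    using G unfolding simple_graph_def by (metis card_2_iff)
  let ?\<delta> = "single u 1 + single v 1 :: 'v \<Rightarrow>\<^sub>0 nat"
  have "\<mu> = (\<mu> - ?\<delta>) + ?\<delta>"
    using e uv by (intro poly_mapping_eqI)
      (auto simp: lookup_add lookup_minus lookup_single when_def in_keys_iff)
  then have "single \<mu> c = single (\<mu> - ?\<delta>) c * (poly_var u * poly_var v)"
    by (simp add: poly_var_def mult_single)
  moreover have "poly_var u * poly_var v \<in> (edge_ideal V E :: ('v, 'k) mpoly set)"
    unfolding edge_ideal_def
    by (rule subsetD[OF P.genideal_self]) (use e uv G in \<open>auto simp: simple_graph_def intro!: poly_algebra_mult_closed poly_var_in_carrier\<close>)
  moreover have "single (\<mu> - ?\<delta>) c \<in> carrier (poly_algebra V :: ('k, ('v, 'k) mpoly) module)"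
    using \<mu>(1) by (intro poly_algebra_single_closed) (auto simp: in_keys_iff lookup_minus)
  ultimately show ?thesis
    using I.I_l_closed by (simp add: poly_algebra_simps(2))
qed

text \<open>The residue class of a polynomial in the edge ring.\<close>

abbreviation poly_class :: "'v set \<Rightarrow> 'v set set \<Rightarrow> ('v, 'k::field) mpoly \<Rightarrow> ('v, 'k) mpoly set"
  where "poly_class V E p \<equiv> edge_ideal V E +>\<^bsub>poly_algebra V\<^esub> p"

lemma linear_subspace_edge_ideal:
  assumes "simple_graph V E"
  shows "linear_subspace (poly_algebra V :: ('k::field, ('v, 'k) mpoly) module) (edge_ideal V E)"
proof -
  interpret I: ideal "edge_ideal V E" "poly_algebra V :: ('k, ('v, 'k) mpoly) module"
    by (rule ideal_edge_ideal[OF assms])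
  show ?thesis
    unfolding linear_subspace_def
    using I.I_l_closed[OF _ poly_algebra_single_closed[of 0]] I.a_subset
      additive_subgroup.zero_closed[OF I.additive_subgroup_axioms]
      additive_subgroup.a_closed[OF I.additive_subgroup_axioms]
    by (auto simp: poly_algebra_simps(2-))
qed

lemma poly_class_eq_iff:
  fixes p q :: "('v, 'k::field) mpoly"
  assumes G: "simple_graph V E" and "p \<in> carrier (poly_algebra V)" "q \<in> carrier (poly_algebra V)"
  shows "poly_class V E p = poly_class V E q \<longleftrightarrow> p - q \<in> edge_ideal V E"
proof -
  interpret P: cring "poly_algebra V :: ('k, ('v, 'k) mpoly) module" by (rule cring_poly_algebra)
  interpret I: ideal "edge_ideal V E" "poly_algebra V :: ('k, ('v, 'k) mpoly) module"
    by (rule ideal_edge_ideal[OF G])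
  have "\<ominus>\<^bsub>poly_algebra V\<^esub> q = - q"
    using assms(3) by (intro P.minus_equality) (auto intro: poly_algebra_uminus_closed simp: poly_algebra_simps(2-))
  then have "p \<oplus>\<^bsub>poly_algebra V\<^esub> \<ominus>\<^bsub>poly_algebra V\<^esub> q = p - q" by (simp add: poly_algebra_simps(2-))
  then have "p \<in> poly_class V E q \<longleftrightarrow> p - q \<in> edge_ideal V E"
    using I.a_rcos_module[OF assms(3,2)] by simp
  moreover have "poly_class V E p = poly_class V E q \<longleftrightarrow> p \<in> poly_class V E q"
    using I.a_repr_independence'[of p q] I.a_rcos_self[of p] assms by auto
  ultimately show ?thesis by simp
qed

lemma edge_ring_simps:
  fixes V :: "'v set"
  assumes "simple_graph V E"
  defines "R \<equiv> edge_ring V E :: ('k::field, ('v, 'k) mpoly set) module"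
  shows "carrier R = poly_class V E ` carrier (poly_algebra V)"
    "\<one>\<^bsub>R\<^esub> = poly_class V E 1" "\<zero>\<^bsub>R\<^esub> = poly_class V E 0"
    "\<And>p q. p \<in> carrier (poly_algebra V) \<Longrightarrow> q \<in> carrier (poly_algebra V) \<Longrightarrow>
       poly_class V E p \<oplus>\<^bsub>R\<^esub> poly_class V E q = poly_class V E (p + q)"
    "\<And>p q. p \<in> carrier (poly_algebra V) \<Longrightarrow> q \<in> carrier (poly_algebra V) \<Longrightarrow>
       poly_class V E p \<otimes>\<^bsub>R\<^esub> poly_class V E q = poly_class V E (p * q)"
    "\<And>c p. p \<in> carrier (poly_algebra V) \<Longrightarrow>
       c \<odot>\<^bsub>R\<^esub> poly_class V E p = poly_class V E (single 0 c * p)"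
proof -
  interpret P: cring "poly_algebra V :: ('k, ('v, 'k) mpoly) module" by (rule cring_poly_algebra)
  interpret I: ideal "edge_ideal V E" "poly_algebra V :: ('k, ('v, 'k) mpoly) module"
    by (rule ideal_edge_ideal[OF assms(1)])
  note s = R_def edge_ring_def quotient_module_simps
  show "carrier R = poly_class V E ` carrier (poly_algebra V)"
    by (auto simp: s A_RCOSETS_def RCOSETS_def a_r_coset_def)
  show "\<one>\<^bsub>R\<^esub> = poly_class V E 1" by (simp add: s poly_algebra_simps(2-))
  show "\<zero>\<^bsub>R\<^esub> = poly_class V E 0"
    using I.a_rcos_const[OF additive_subgroup.zero_closed[OF I.additive_subgroup_axioms]] by (simp add: s poly_algebra_simps(2-))
  fix p q :: "('v, 'k) mpoly"
  assume p: "p \<in> carrier (poly_algebra V)"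
  show "c \<odot>\<^bsub>R\<^esub> poly_class V E p = poly_class V E (single 0 c * p)" for c
    using quotient_smult[OF module_poly_algebra linear_subspace_edge_ideal[OF assms(1)] p, of c]
    by (simp add: s poly_algebra_simps(2-))
  assume q: "q \<in> carrier (poly_algebra V)"
  show "poly_class V E p \<oplus>\<^bsub>R\<^esub> poly_class V E q = poly_class V E (p + q)"
    using I.a_rcos_sum[OF p q] by (simp add: s poly_algebra_simps(2-))
  show "poly_class V E p \<otimes>\<^bsub>R\<^esub> poly_class V E q = poly_class V E (p * q)"
    using I.rcoset_mult_add[OF p q] by (simp add: s poly_algebra_simps(2-))
qed

lemma algebra_edge_ring:
  fixes V :: "'v set"
  assumes G: "simple_graph V E"
  shows "algebra class_ring (edge_ring V E :: ('k::field, ('v, 'k) mpoly set) module)"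
    (is "algebra _ ?R")
proof -
  note R = edge_ring_simps[OF G, where 'k = 'k]
  note c = poly_algebra_add_closed poly_algebra_mult_closed
  have one: "1 \<in> carrier (poly_algebra V :: ('k, ('v, 'k) mpoly) module)"
    and const: "single 0 a \<in> carrier (poly_algebra V :: ('k, ('v, 'k) mpoly) module)" for a
    using poly_algebra_single_closed[of 0 V "1::'k"] poly_algebra_single_closed[of 0 V] by auto
  have abel: "abelian_group ?R"
  proof (rule abelian_groupI)
    fix x assume "x \<in> carrier ?R"
    then obtain p where "p \<in> carrier (poly_algebra V)" "x = poly_class V E p" by (auto simp: R(1))
    then show "\<exists>y\<in>carrier ?R. y \<oplus>\<^bsub>?R\<^esub> x = \<zero>\<^bsub>?R\<^esub>"
      using poly_algebra_uminus_closed[of p V]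
      by (intro bexI[of _ "poly_class V E (- p)"]) (auto simp: R(1,3,4))
  qed (auto simp: R(1,3,4) c poly_algebra_zero_closed add_ac)
  have "cring ?R"
    by (intro cringI abel comm_monoidI) (auto simp: R(1-5) c one algebra_simps)
  moreover have h: "single 0 (a * b) * p = single 0 a * (single 0 b * p)"
    for a b :: 'k and p :: "('v, 'k) mpoly"
    by (simp add: mult_single mult.assoc[symmetric])
  have "module class_ring ?R"
    by (rule moduleI[OF cring_class_ring abel])
      (auto simp: R c const single_add distrib_left distrib_right h)
  ultimately show ?thesis
    by (intro algebra.intro algebra_axioms.intro) (auto simp: R c const mult.assoc)
qed

section \<open>Localization\<close>

text \<open>The operations on a localization are unions over all representatives. Each of them is evaluated by
  checking that the united sets coincide.\<close>

lemma UN_pairs_const: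
  assumes "(a, k) \<in> X" and "\<And>b l. (b, l) \<in> X \<Longrightarrow> g b l = C"
  shows "(\<Union>(b, l)\<in>X. g b l) = C"
proof (rule SUP_eq_const)
  fix p assume "p \<in> X"
  then show "(case p of (b, l) \<Rightarrow> g b l) = C" using assms(2) by (cases p) simp
qed (use assms in blast)

text \<open>A commutative algebra over a field.\<close>

locale field_algebra = algebra "class_ring :: 'k::field ring" A
  for A :: "('k::field, 'a, 'm) module_scheme" (structure)
begin

lemma loc_frac_mem_iff:
  assumes "f \<in> carrier A" "a \<in> carrier A"
  shows "(b, l) \<in> loc_frac A f a k \<longleftrightarrow>
    b \<in> carrier A \<and> (\<exists>N::nat. f [^] (N + l) \<otimes> a = f [^] (N + k) \<otimes> b)"
  using assms by (auto simp: loc_frac_def nat_pow_mult[symmetric] m_assoc)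

lemma loc_frac_mem_sym:
  assumes "f \<in> carrier A" "a \<in> carrier A" "(b, l) \<in> loc_frac A f a k"
  shows "(a, k) \<in> loc_frac A f b l"
  using assms loc_frac_mem_iff by metis

lemma loc_frac_mem_trans:
  assumes "f \<in> carrier A" "a \<in> carrier A" "(b, l) \<in> loc_frac A f a k" "(c, m) \<in> loc_frac A f b l"
  shows "(c, m) \<in> loc_frac A f a k"
proof -
  have b: "b \<in> carrier A" using assms(3) by (simp add: loc_frac_def)
  obtain N :: nat where N: "f [^] (N + l) \<otimes> a = f [^] (N + k) \<otimes> b"
    using assms loc_frac_mem_iff by blast
  obtain M :: nat where M: "f [^] (M + m) \<otimes> b = f [^] (M + l) \<otimes> c" and c: "c \<in> carrier A"
    using assms b loc_frac_mem_iff by blast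
  have "f [^] ((N + M + l) + m) \<otimes> a = f [^] (M + m) \<otimes> (f [^] (N + l) \<otimes> a)"
    using assms by (simp add: nat_pow_mult m_assoc[symmetric] add_ac)
  also have "\<dots> = f [^] (N + k) \<otimes> (f [^] (M + m) \<otimes> b)"
    using assms b by (simp add: N m_lcomm)
  also have "\<dots> = f [^] ((N + M + l) + k) \<otimes> c"
    using assms c by (simp add: M nat_pow_mult m_assoc[symmetric] add_ac)
  finally show ?thesis using assms c by (subst loc_frac_mem_iff) blast+
qed

lemma loc_frac_self:
  assumes "f \<in> carrier A" "a \<in> carrier A"
  shows "(a, k) \<in> loc_frac A f a k"
  using assms loc_frac_mem_iff by blast

lemma loc_frac_eq_iff:
  assumes "f \<in> carrier A" "a \<in> carrier A" "b \<in> carrier A"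
  shows "loc_frac A f a k = loc_frac A f b l \<longleftrightarrow> (\<exists>N::nat. f [^] (N + l) \<otimes> a = f [^] (N + k) \<otimes> b)"
proof -
  have "loc_frac A f a k = loc_frac A f b l \<longleftrightarrow> (b, l) \<in> loc_frac A f a k"
  proof
    assume "(b, l) \<in> loc_frac A f a k"
    moreover from this have "(a, k) \<in> loc_frac A f b l" by (rule loc_frac_mem_sym[OF assms(1,2)])
    ultimately show "loc_frac A f a k = loc_frac A f b l"
      using loc_frac_mem_trans[of f] assms by (intro equalityI subrelI) blast+
  qed (use loc_frac_self[OF assms(1,3)] in simp)
  then show ?thesis using loc_frac_mem_iff assms by simp
qed

lemma loc_frac_eqI:
  fixes N :: nat
  assumes "f \<in> carrier A" "a \<in> carrier A" "b \<in> carrier A" "f [^] (N + l) \<otimes> a = f [^] (N + k) \<otimes> b"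
  shows "loc_frac A f a k = loc_frac A f b l"
  using assms loc_frac_eq_iff by blast

lemma loc_frac_memD:
  assumes "f \<in> carrier A" "a \<in> carrier A" "(b, l) \<in> loc_frac A f a k"
  obtains N :: nat where "b \<in> carrier A" "f [^] (N + l) \<otimes> a = f [^] (N + k) \<otimes> b"
  using assms loc_frac_mem_iff by blast

text \<open>Expanding fractions brings finitely many of them to a common denominator, so that the module
  axioms have to be checked only for equal denominators.\<close>

lemma loc_frac_expand:
  assumes "f \<in> carrier A" "a \<in> carrier A"
  shows "loc_frac A f (f [^] l \<otimes> a) (k + l) = loc_frac A f a k"
  using assms by (intro loc_frac_eqI[of _ _ _ 0]) (auto simp: nat_pow_mult m_assoc[symmetric])

lemma localization_simps:
  "carrier (localization A f) = {loc_frac A f a k | a k. a \<in> carrier A}"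
  "\<zero>\<^bsub>localization A f\<^esub> = loc_frac A f \<zero> 0"
  by (simp_all add: localization_def)

lemma localization_smult:
  assumes "f \<in> carrier A" "a \<in> carrier A"
  shows "c \<odot>\<^bsub>localization A f\<^esub> loc_frac A f a k = loc_frac A f (c \<odot> a) k"
proof -
  have sc: "c \<odot> x \<in> carrier A" if "x \<in> carrier A" for x using smult_closed[of c x] that by simp
  have sa: "x \<otimes> (c \<odot> y) = c \<odot> (x \<otimes> y)" if "x \<in> carrier A" "y \<in> carrier A" for x y
    using smult_assoc2[of c y x] that sc by (simp add: m_comm)
  have h: "loc_frac A f (c \<odot> b) l = loc_frac A f (c \<odot> a) k" if bl: "(b, l) \<in> loc_frac A f a k" for b l
  proof -
    obtain N :: nat where N: "b \<in> carrier A" "f [^] (N + l) \<otimes> a = f [^] (N + k) \<otimes> b"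
      using loc_frac_memD[OF assms bl] .
    show ?thesis using N assms sc by (intro loc_frac_eqI[of _ _ _ N]) (simp_all add: sa)
  qed
  show ?thesis unfolding localization_def
    using h by (simp, intro UN_pairs_const[OF loc_frac_self[OF assms]])
qed

lemma localization_add:
  assumes f: "f \<in> carrier A" and a: "a \<in> carrier A" and b: "b \<in> carrier A"
  shows "loc_frac A f a k \<oplus>\<^bsub>localization A f\<^esub> loc_frac A f b l =
    loc_frac A f (f [^] l \<otimes> a \<oplus> f [^] k \<otimes> b) (k + l)"
proof -
  have h: "loc_frac A f (f [^] l' \<otimes> a' \<oplus> f [^] k' \<otimes> b') (k' + l') =
      loc_frac A f (f [^] l \<otimes> a \<oplus> f [^] k \<otimes> b) (k + l)"
    if A: "(a', k') \<in> loc_frac A f a k" and B: "(b', l') \<in> loc_frac A f b l" for a' k' b' l'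
  proof -
    obtain N :: nat where N: "a' \<in> carrier A" "f [^] (N + k') \<otimes> a = f [^] (N + k) \<otimes> a'"
      using loc_frac_memD[OF f a A] .
    obtain M :: nat where M: "b' \<in> carrier A" "f [^] (M + l') \<otimes> b = f [^] (M + l) \<otimes> b'"
      using loc_frac_memD[OF f b B] .
    have "f [^] (N + M + (k' + l')) \<otimes> (f [^] l \<otimes> a \<oplus> f [^] k \<otimes> b) =
        f [^] (M + l' + l) \<otimes> (f [^] (N + k') \<otimes> a) \<oplus> f [^] (N + k' + k) \<otimes> (f [^] (M + l') \<otimes> b)"
      using f a b by (simp add: r_distr nat_pow_mult m_assoc[symmetric] add_ac)
    also have "\<dots> = f [^] (M + l' + l) \<otimes> (f [^] (N + k) \<otimes> a') \<oplus> f [^] (N + k' + k) \<otimes> (f [^] (M + l) \<otimes> b')"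
      by (simp only: N M)
    also have "\<dots> = f [^] (N + M + (k + l)) \<otimes> (f [^] l' \<otimes> a' \<oplus> f [^] k' \<otimes> b')"
      using f N M by (simp add: r_distr nat_pow_mult m_assoc[symmetric] add_ac)
    finally show ?thesis using f a b N M by (intro loc_frac_eqI[symmetric, of _ _ _ "N + M"]) auto
  qed
  show ?thesis unfolding localization_def
    using h by (simp, intro UN_pairs_const[OF loc_frac_self[OF f a]] UN_pairs_const[OF loc_frac_self[OF f b]])
qed

lemma localization_add_same:
  assumes "f \<in> carrier A" "a \<in> carrier A" "b \<in> carrier A"
  shows "loc_frac A f a k \<oplus>\<^bsub>localization A f\<^esub> loc_frac A f b k = loc_frac A f (a \<oplus> b) k"
  using assms by (simp add: localization_add r_distr[symmetric] loc_frac_expand)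

lemma localization_zero: "f \<in> carrier A \<Longrightarrow> \<zero>\<^bsub>localization A f\<^esub> = loc_frac A f \<zero> k"
  using loc_frac_expand[of f \<zero> k 0] by (simp add: localization_simps)

lemma localization_common2:
  assumes f: "f \<in> carrier A" and "X \<in> carrier (localization A f)" "Y \<in> carrier (localization A f)"
  obtains a b k where "a \<in> carrier A" "b \<in> carrier A" "X = loc_frac A f a k" "Y = loc_frac A f b k"
proof -
  obtain a b k l where *: "a \<in> carrier A" "b \<in> carrier A" "X = loc_frac A f a k" "Y = loc_frac A f b l"
    using assms(2,3) unfolding localization_simps(1) by blast
  show ?thesis
  proof (rule that)
    show "X = loc_frac A f (f [^] l \<otimes> a) (k + l)" using * loc_frac_expand f by simp
    show "Y = loc_frac A f (f [^] k \<otimes> b) (k + l)" using * loc_frac_expand[of f b k l] f by (simp add: add.commute)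
  qed (use * f in auto)
qed

lemma localization_common3:
  assumes f: "f \<in> carrier A" and "X \<in> carrier (localization A f)" "Y \<in> carrier (localization A f)"
    "Z \<in> carrier (localization A f)"
  obtains a b c k where "a \<in> carrier A" "b \<in> carrier A" "c \<in> carrier A"
    "X = loc_frac A f a k" "Y = loc_frac A f b k" "Z = loc_frac A f c k"
proof -
  obtain a b k where *: "a \<in> carrier A" "b \<in> carrier A" "X = loc_frac A f a k" "Y = loc_frac A f b k"
    using localization_common2[OF assms(1-3)] .
  obtain c l where **: "c \<in> carrier A" "Z = loc_frac A f c l"
    using assms(4) unfolding localization_simps(1) by blast
  show ?thesis
  proof (rule that)
    show "X = loc_frac A f (f [^] l \<otimes> a) (k + l)" using * loc_frac_expand f by simp
    show "Y = loc_frac A f (f [^] l \<otimes> b) (k + l)" using * loc_frac_expand f by simp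
    show "Z = loc_frac A f (f [^] k \<otimes> c) (k + l)" using ** loc_frac_expand[of f c k l] f by (simp add: add.commute)
  qed (use * ** f in auto)
qed

lemma localization_elem:
  assumes "X \<in> carrier (localization A f)"
  obtains a k where "a \<in> carrier A" "X = loc_frac A f a k"
  using assms unfolding localization_simps(1) by blast

lemma module_localization:
  assumes f: "f \<in> carrier A"
  shows "module class_ring (localization A f)" (is "module _ ?L")
proof -
  have in_L: "loc_frac A f a k \<in> carrier ?L" if "a \<in> carrier A" for a k
    using that by (auto simp: localization_simps)
  have sc: "c \<odot> x \<in> carrier A" if "x \<in> carrier A" for c x using smult_closed[of c x] that by simp
  note s = localization_add_same[OF f] localization_smult[OF f] sc in_L localization_zero[OF f]
  show ?thesis
  proof (rule moduleI[OF cring_class_ring])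
    show "abelian_group ?L"
    proof (rule abelian_groupI)
      fix X Y assume "X \<in> carrier ?L" "Y \<in> carrier ?L"
      then obtain a b k where *: "a \<in> carrier A" "b \<in> carrier A" "X = loc_frac A f a k" "Y = loc_frac A f b k"
        using localization_common2[OF f] by metis
      then show "X \<oplus>\<^bsub>?L\<^esub> Y \<in> carrier ?L" by (simp add: s)
      show "X \<oplus>\<^bsub>?L\<^esub> Y = Y \<oplus>\<^bsub>?L\<^esub> X" using * by (simp add: s a_comm)
    next
      show "\<zero>\<^bsub>?L\<^esub> \<in> carrier ?L" by (auto simp: localization_simps)
    next
      fix X Y Z assume X: "X \<in> carrier ?L" "Y \<in> carrier ?L" "Z \<in> carrier ?L"
      obtain a b c k where "a \<in> carrier A" "b \<in> carrier A" "c \<in> carrier A"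
        "X = loc_frac A f a k" "Y = loc_frac A f b k" "Z = loc_frac A f c k"
        using localization_common3[OF f X] .
      then show "X \<oplus>\<^bsub>?L\<^esub> Y \<oplus>\<^bsub>?L\<^esub> Z = X \<oplus>\<^bsub>?L\<^esub> (Y \<oplus>\<^bsub>?L\<^esub> Z)" by (simp add: s a_assoc)
    next
      fix X assume "X \<in> carrier ?L"
      then obtain a k where a: "a \<in> carrier A" "X = loc_frac A f a k" by (rule localization_elem)
      show "\<zero>\<^bsub>?L\<^esub> \<oplus>\<^bsub>?L\<^esub> X = X" using a f by (simp add: localization_zero[OF f, of k] localization_add_same)
      show "\<exists>Y\<in>carrier ?L. Y \<oplus>\<^bsub>?L\<^esub> X = \<zero>\<^bsub>?L\<^esub>"
        using a f by (intro bexI[of _ "loc_frac A f (\<ominus> a) k"])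
          (auto simp: localization_zero[OF f, of k] localization_add_same l_neg in_L)
    qed
  next
    fix c d :: 'k and X assume "X \<in> carrier ?L"
    then obtain a k where a: "a \<in> carrier A" "X = loc_frac A f a k" by (rule localization_elem)
    show "c \<odot>\<^bsub>?L\<^esub> X \<in> carrier ?L" using a by (simp add: s)
    show "(c \<oplus>\<^bsub>class_ring\<^esub> d) \<odot>\<^bsub>?L\<^esub> X = c \<odot>\<^bsub>?L\<^esub> X \<oplus>\<^bsub>?L\<^esub> d \<odot>\<^bsub>?L\<^esub> X"
      using a smult_l_distr[of c d a] by (simp add: s)
    show "(c \<otimes>\<^bsub>class_ring\<^esub> d) \<odot>\<^bsub>?L\<^esub> X = c \<odot>\<^bsub>?L\<^esub> (d \<odot>\<^bsub>?L\<^esub> X)"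
      using a smult_assoc1[of c d a] by (simp add: s)
    show "\<one>\<^bsub>class_ring\<^esub> \<odot>\<^bsub>?L\<^esub> X = X"
      using a smult_one[of a] by (simp add: s)
    fix Y assume "Y \<in> carrier ?L"
    with \<open>X \<in> carrier ?L\<close> obtain a b k where *: "a \<in> carrier A" "b \<in> carrier A"
        "X = loc_frac A f a k" "Y = loc_frac A f b k"
      using localization_common2[OF f] by metis
    then show "c \<odot>\<^bsub>?L\<^esub> (X \<oplus>\<^bsub>?L\<^esub> Y) = c \<odot>\<^bsub>?L\<^esub> X \<oplus>\<^bsub>?L\<^esub> c \<odot>\<^bsub>?L\<^esub> Y"
      using smult_r_distr[of c a b] by (simp add: s)
  qed
qed

lemma loc_map_frac:
  assumes f: "f \<in> carrier A" and g: "g \<in> carrier A" and a: "a \<in> carrier A"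
  shows "loc_map A g (f \<otimes> g) (loc_frac A f a k) = loc_frac A (f \<otimes> g) (a \<otimes> g [^] k) k"
proof -
  have h: "loc_frac A (f \<otimes> g) (b \<otimes> g [^] l) l = loc_frac A (f \<otimes> g) (a \<otimes> g [^] k) k"
    if bl: "(b, l) \<in> loc_frac A f a k" for b l
  proof -
    obtain N :: nat where N: "b \<in> carrier A" "f [^] (N + l) \<otimes> a = f [^] (N + k) \<otimes> b"
      using loc_frac_memD[OF f a bl] .
    have "(f \<otimes> g) [^] (N + l) \<otimes> (a \<otimes> g [^] k) = g [^] (N + k + l) \<otimes> (f [^] (N + l) \<otimes> a)"
      using f g a by (simp add: nat_pow_distrib nat_pow_mult[symmetric] m_ac)
    also have "\<dots> = (f \<otimes> g) [^] (N + k) \<otimes> (b \<otimes> g [^] l)"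
      unfolding N(2) using f g N(1) by (simp add: nat_pow_distrib nat_pow_mult[symmetric] m_ac)
    finally show ?thesis using f g a N by (intro loc_frac_eqI[symmetric, of _ _ _ N]) auto
  qed
  show ?thesis unfolding loc_map_def
    using h by (intro UN_pairs_const[OF loc_frac_self[OF f a]])
qed

lemma loc_map_linear:
  assumes f: "f \<in> carrier A" and g: "g \<in> carrier A"
  shows "linear_between (localization A f) (localization A (f \<otimes> g)) (loc_map A g (f \<otimes> g))"
  unfolding linear_between_def
proof (intro conjI ballI allI funcsetI)
  have h: "f \<otimes> g \<in> carrier A" using assms by simp
  have sc: "c \<odot> x \<in> carrier A" if "x \<in> carrier A" for c x using smult_closed[of c x] that by simp
  fix X assume X: "X \<in> carrier (localization A f)"
  then obtain a k where a: "a \<in> carrier A" "X = loc_frac A f a k" by (rule localization_elem)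
  then show "loc_map A g (f \<otimes> g) X \<in> carrier (localization A (f \<otimes> g))"
    using f g by (auto simp: loc_map_frac localization_simps)
  show "loc_map A g (f \<otimes> g) (c \<odot>\<^bsub>localization A f\<^esub> X) =
      c \<odot>\<^bsub>localization A (f \<otimes> g)\<^esub> loc_map A g (f \<otimes> g) X" for c
    using a f g h sc smult_assoc2[of c a "g [^] k"]
    by (simp add: loc_map_frac localization_smult)
  fix Y assume Y: "Y \<in> carrier (localization A f)"
  obtain a b k where "a \<in> carrier A" "b \<in> carrier A" "X = loc_frac A f a k" "Y = loc_frac A f b k"
    using localization_common2[OF f X Y] .
  then show "loc_map A g (f \<otimes> g) (X \<oplus>\<^bsub>localization A f\<^esub> Y) =
      loc_map A g (f \<otimes> g) X \<oplus>\<^bsub>localization A (f \<otimes> g)\<^esub> loc_map A g (f \<otimes> g) Y"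
    using f g h by (simp add: loc_map_frac localization_add_same l_distr)
qed

text \<open>The localization at zero is trivial.\<close>

lemma localization_at_zero:
  assumes "X \<in> carrier (localization A \<zero>)"
  shows "X = \<zero>\<^bsub>localization A \<zero>\<^esub>"
proof -
  obtain a k where a: "a \<in> carrier A" "X = loc_frac A \<zero> a k" using assms by (rule localization_elem)
  have "loc_frac A \<zero> a k = loc_frac A \<zero> \<zero> 0"
    using a by (intro loc_frac_eqI[of _ _ _ 1]) (auto simp: nat_pow_zero)
  then show ?thesis using a by (simp add: localization_simps)
qed

end

section \<open>Cech complexes\<close>

text \<open>The Cech complex of a sequence \<open>fs\<close> of elements of \<open>A\<close>. The abbreviation \<open>loc F\<close> stands for the
  localization at the product of the elements with positions in \<open>F\<close>.\<close>

locale cech_complex = field_algebra A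
  for A :: "('k::field, 'a, 'm) module_scheme" (structure) +
  fixes fs :: "'a list"
  assumes fs: "set fs \<subseteq> carrier A"
begin

abbreviation (input) loc :: "nat set \<Rightarrow> ('k, ('a \<times> nat) set) module"
  where "loc F \<equiv> localization A (face_elem A fs F)"

lemma finite_faces: "finite (faces fs p)"
  by (rule finite_subset[of _ "Pow {..<length fs}"]) (auto simp: faces_def)

lemma faces_finite: "F \<in> faces fs p \<Longrightarrow> finite F"
  by (auto simp: faces_def intro: finite_subset)

lemma faces_Diff: "F \<in> faces fs (Suc p) \<Longrightarrow> i \<in> F \<Longrightarrow> F - {i} \<in> faces fs p"
  using faces_finite[of F "Suc p"] by (auto simp: faces_def)

lemma nth_fs: "i < length fs \<Longrightarrow> fs ! i \<in> carrier A"
  using fs by auto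

lemma face_elem_closed: "F \<in> faces fs p \<Longrightarrow> face_elem A fs F \<in> carrier A"
  unfolding face_elem_def by (rule finprod_closed) (auto simp: faces_def intro: nth_fs)

lemma face_elem_Diff:
  assumes "F \<in> faces fs p" "i \<in> F"
  shows "face_elem A fs (F - {i}) \<otimes> fs ! i = face_elem A fs F"
proof -
  have F: "F \<subseteq> {..<length fs}" using assms by (simp add: faces_def)
  have "face_elem A fs (insert i (F - {i})) = fs ! i \<otimes> face_elem A fs (F - {i})"
    unfolding face_elem_def
    by (rule finprod_insert) (use F assms faces_finite[OF assms(1)] in \<open>auto intro!: nth_fs\<close>)
  moreover have "insert i (F - {i}) = F" using assms by auto
  moreover have "face_elem A fs (F - {i}) \<in> carrier A"
    unfolding face_elem_def by (rule finprod_closed) (use F in \<open>auto intro: nth_fs\<close>)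
  ultimately show ?thesis using nth_fs F assms(2) by (metis lessThan_iff m_comm subsetD)
qed

lemma module_loc: "F \<in> faces fs p \<Longrightarrow> module class_ring (loc F)"
  by (rule module_localization[OF face_elem_closed])

lemma module_cech: "module class_ring (cech A fs p)"
  unfolding cech_def by (rule module_product_algebra) (rule module_loc)

lemma cech_simps:
  "carrier (cech A fs p) = (\<Pi>\<^sub>E F\<in>faces fs p. carrier (loc F))"
  "\<zero>\<^bsub>cech A fs p\<^esub> = (\<lambda>F\<in>faces fs p. \<zero>\<^bsub>loc F\<^esub>)"
  "c \<oplus>\<^bsub>cech A fs p\<^esub> d = (\<lambda>F\<in>faces fs p. c F \<oplus>\<^bsub>loc F\<^esub> d F)"
  "a \<odot>\<^bsub>cech A fs p\<^esub> c = (\<lambda>F\<in>faces fs p. a \<odot>\<^bsub>loc F\<^esub> c F)"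
  by (simp_all add: cech_def product_algebra_def)

lemma linear_functional_component:
  assumes "F \<in> faces fs p" "linear_functional (loc F) \<psi>"
  shows "linear_functional (cech A fs p) (\<lambda>c. \<psi> (c F))"
  using assms PiE_mem unfolding linear_functional_def cech_simps by fastforce

lemma loc_map_face_linear:
  assumes "F \<in> faces fs (Suc p)" "i \<in> F"
  shows "linear_between (loc (F - {i})) (loc F) (loc_map A (fs ! i) (face_elem A fs F))"
proof -
  have "fs ! i \<in> carrier A" using assms by (intro nth_fs) (auto simp: faces_def)
  from loc_map_linear[OF face_elem_closed[OF faces_Diff[OF assms]] this]
  show ?thesis unfolding face_elem_Diff[OF assms] .
qed

lemma cech_diff_summand:
  assumes "F \<in> faces fs (Suc p)" "i \<in> F" "c \<in> carrier (cech A fs p)"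
  shows "a \<odot>\<^bsub>loc F\<^esub> loc_map A (fs ! i) (face_elem A fs F) (c (F - {i})) \<in> carrier (loc F)"
proof -
  interpret L: module class_ring "loc F" by (rule module_loc[OF assms(1)])
  have "c (F - {i}) \<in> carrier (loc (F - {i}))"
    using assms(3) faces_Diff[OF assms(1,2)] by (auto simp: cech_simps dest: PiE_mem)
  then show ?thesis
    using loc_map_face_linear[OF assms(1,2)] L.smult_closed[of a]
    unfolding linear_between_def by auto
qed

lemma component_linear:
  "F \<in> faces fs p \<Longrightarrow> linear_between (cech A fs p) (loc F) (\<lambda>c. c F)"
  unfolding linear_between_def cech_simps by auto

lemma linear_between_cech:
  assumes "\<And>F. F \<in> faces fs p \<Longrightarrow> linear_between B (loc F) (\<lambda>x. g x F)"
    and "\<And>x. g x \<in> extensional (faces fs p)"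
  shows "linear_between B (cech A fs p) g"
  unfolding linear_between_def cech_simps
proof (intro conjI ballI allI funcsetI)
  fix x assume x: "x \<in> carrier B"
  show "g x \<in> (\<Pi>\<^sub>E F\<in>faces fs p. carrier (loc F))"
    using assms x unfolding linear_between_def PiE_def by blast
  show "g (a \<odot>\<^bsub>B\<^esub> x) = (\<lambda>F\<in>faces fs p. a \<odot>\<^bsub>loc F\<^esub> g x F)" for a
    using assms x unfolding linear_between_def by (intro extensionalityI[OF assms(2)]) auto
  fix y assume y: "y \<in> carrier B"
  show "g (x \<oplus>\<^bsub>B\<^esub> y) = (\<lambda>F\<in>faces fs p. g x F \<oplus>\<^bsub>loc F\<^esub> g y F)"
    using assms x y unfolding linear_between_def by (intro extensionalityI[OF assms(2)]) auto
qed

lemma cech_diff_linear: "linear_between (cech A fs p) (cech A fs (Suc p)) (cech_diff A fs p)"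
proof (rule linear_between_cech)
  fix F assume F: "F \<in> faces fs (Suc p)"
  show "linear_between (cech A fs p) (loc F) (\<lambda>c. cech_diff A fs p c F)"
    unfolding cech_diff_def restrict_apply'[OF F]
    by (rule linear_between_finsum[OF module_loc[OF F] faces_finite[OF F]])
      (rule linear_between_comp[OF component_linear[OF faces_Diff[OF F]] loc_map_face_linear[OF F]])
qed (simp add: cech_diff_def)

lemma linear_subspace_coboundaries: "linear_subspace (cech A fs (Suc p)) (cech_coboundaries A fs (Suc p))"
  using linear_subspace_image[OF module_cech module_cech cech_diff_linear]
  by (simp add: cech_coboundaries_def)

text \<open>If all localizations in degree \<open>p + 1\<close> are localizations at zero, then all cochains of degree \<open>p\<close>
  are cocycles.\<close>

lemma cech_cocycles_top:
  assumes "\<And>F. F \<in> faces fs (Suc p) \<Longrightarrow> face_elem A fs F = \<zero>"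
  shows "cech_cocycles A fs p = carrier (cech A fs p)"
proof -
  have "cech_diff A fs p c = \<zero>\<^bsub>cech A fs (Suc p)\<^esub>" if "c \<in> carrier (cech A fs p)" for c
  proof (rule ext)
    fix F
    have "cech_diff A fs p c \<in> carrier (cech A fs (Suc p))"
      using cech_diff_linear[of p] that unfolding linear_between_def by blast
    note P = this[unfolded cech_simps(1)]
    show "cech_diff A fs p c F = \<zero>\<^bsub>cech A fs (Suc p)\<^esub> F"
    proof (cases "F \<in> faces fs (Suc p)")
      case True
      then have "cech_diff A fs p c F \<in> carrier (localization A \<zero>)"
        using PiE_mem[OF P] assms by metis
      then have "cech_diff A fs p c F = \<zero>\<^bsub>localization A \<zero>\<^esub>" by (rule localization_at_zero)
      then show ?thesis using True assms by (simp add: cech_simps(2))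
    next
      case False
      then show ?thesis using PiE_arb[OF P] by (simp add: cech_simps(2))
    qed
  qed
  then show ?thesis unfolding cech_cocycles_def a_kernel_def' by blast
qed

text \<open>The cochain with the single component \<open>X\<close> at \<open>F\<close>.\<close>

definition single_cochain :: "nat \<Rightarrow> nat set \<Rightarrow> ('a \<times> nat) set \<Rightarrow> nat set \<Rightarrow> ('a \<times> nat) set" where
  "single_cochain p F X = (\<lambda>F'\<in>faces fs p. if F' = F then X else \<zero>\<^bsub>loc F'\<^esub>)"

lemma loc_zero_closed: "F \<in> faces fs p \<Longrightarrow> \<zero>\<^bsub>loc F\<^esub> \<in> carrier (loc F)"
  using face_elem_closed by (auto simp: localization_simps)

lemma single_cochain_closed:
  "X \<in> carrier (loc F) \<Longrightarrow> single_cochain p F X \<in> carrier (cech A fs p)"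
  by (auto simp: single_cochain_def cech_simps loc_zero_closed)

lemma loc_module_facts:
  assumes "F \<in> faces fs p"
  shows "\<zero>\<^bsub>loc F\<^esub> \<oplus>\<^bsub>loc F\<^esub> \<zero>\<^bsub>loc F\<^esub> = \<zero>\<^bsub>loc F\<^esub>" "a \<odot>\<^bsub>loc F\<^esub> \<zero>\<^bsub>loc F\<^esub> = \<zero>\<^bsub>loc F\<^esub>"
    "X \<in> carrier (loc F) \<Longrightarrow> X \<oplus>\<^bsub>loc F\<^esub> \<zero>\<^bsub>loc F\<^esub> = X"
    "X \<in> carrier (loc F) \<Longrightarrow> \<zero>\<^bsub>loc F\<^esub> \<oplus>\<^bsub>loc F\<^esub> X = X"
proof -
  interpret L: module class_ring "loc F" by (rule module_loc[OF assms])
  show "\<zero>\<^bsub>loc F\<^esub> \<oplus>\<^bsub>loc F\<^esub> \<zero>\<^bsub>loc F\<^esub> = \<zero>\<^bsub>loc F\<^esub>" by simp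
  show "a \<odot>\<^bsub>loc F\<^esub> \<zero>\<^bsub>loc F\<^esub> = \<zero>\<^bsub>loc F\<^esub>" using L.smult_r_null[of a] by simp
  show "X \<in> carrier (loc F) \<Longrightarrow> X \<oplus>\<^bsub>loc F\<^esub> \<zero>\<^bsub>loc F\<^esub> = X" by simp
  show "X \<in> carrier (loc F) \<Longrightarrow> \<zero>\<^bsub>loc F\<^esub> \<oplus>\<^bsub>loc F\<^esub> X = X" by simp
qed

lemma single_cochain_add:
  "single_cochain p F X \<oplus>\<^bsub>cech A fs p\<^esub> single_cochain p F Y = single_cochain p F (X \<oplus>\<^bsub>loc F\<^esub> Y)"
  unfolding single_cochain_def cech_simps by (rule restrict_ext) (simp add: loc_module_facts)

lemma single_cochain_smult:
  "a \<odot>\<^bsub>cech A fs p\<^esub> single_cochain p F X = single_cochain p F (a \<odot>\<^bsub>loc F\<^esub> X)"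
  unfolding single_cochain_def cech_simps by (rule restrict_ext) (simp add: loc_module_facts)

lemma single_cochain_zero: "single_cochain p F \<zero>\<^bsub>loc F\<^esub> = \<zero>\<^bsub>cech A fs p\<^esub>"
  unfolding single_cochain_def cech_simps by (rule restrict_ext) simp

lemma cech_diff_single_cochain:
  assumes G: "G \<in> faces fs p" and X: "X \<in> carrier (loc G)" and F: "F \<in> faces fs (Suc p)"
  shows "G \<subseteq> F \<Longrightarrow> i \<in> F - G \<Longrightarrow> cech_diff A fs p (single_cochain p G X) F =
      (-1) ^ card {l\<in>F. l < i} \<odot>\<^bsub>loc F\<^esub> loc_map A (fs ! i) (face_elem A fs F) X"
    and "\<not> G \<subseteq> F \<Longrightarrow> cech_diff A fs p (single_cochain p G X) F = \<zero>\<^bsub>loc F\<^esub>"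
proof -
  interpret L: module class_ring "loc F" by (rule module_loc[OF F])
  let ?f = "\<lambda>i. (-1) ^ card {l\<in>F. l < i} \<odot>\<^bsub>loc F\<^esub>
    loc_map A (fs ! i) (face_elem A fs F) (single_cochain p G X (F - {i}))"
  have fin: "finite F" and finG: "finite G" using faces_finite F G by blast+
  have cF: "card F = Suc (card G)" using F G by (simp add: faces_def)
  have zero: "?f i = \<zero>\<^bsub>loc F\<^esub>" if i: "i \<in> F" "F - {i} \<noteq> G" for i
  proof -
    have "single_cochain p G X (F - {i}) = \<zero>\<^bsub>loc (F - {i})\<^esub>"
      using i faces_Diff[OF F i(1)] by (simp add: single_cochain_def)
    moreover have "loc_map A (fs ! i) (face_elem A fs F) \<zero>\<^bsub>loc (F - {i})\<^esub> = \<zero>\<^bsub>loc F\<^esub>"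
      by (rule linear_between_zero[OF module_loc[OF faces_Diff[OF F i(1)]] module_loc[OF F]
            loc_map_face_linear[OF F i(1)]])
    ultimately show ?thesis using loc_module_facts(2)[OF F] by simp
  qed
  have D: "cech_diff A fs p (single_cochain p G X) F = (\<Oplus>\<^bsub>loc F\<^esub>i\<in>F. ?f i)"
    using F by (simp add: cech_diff_def)
  show "cech_diff A fs p (single_cochain p G X) F = \<zero>\<^bsub>loc F\<^esub>" if "\<not> G \<subseteq> F"
  proof -
    have "(\<Oplus>\<^bsub>loc F\<^esub>i\<in>F. ?f i) = (\<Oplus>\<^bsub>loc F\<^esub>i\<in>F. \<zero>\<^bsub>loc F\<^esub>)"
      using that by (intro L.M.finsum_cong'[OF refl] zero) auto
    then show ?thesis using D by simp
  qed
  assume sub: "G \<subseteq> F" and i: "i \<in> F - G"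
  have FG: "F - {i} = G"
    using sub i cF fin finG by (intro card_subset_eq[symmetric]) auto
  have f: "?f i = (-1) ^ card {l\<in>F. l < i} \<odot>\<^bsub>loc F\<^esub> loc_map A (fs ! i) (face_elem A fs F) X"
    using FG G by (simp add: single_cochain_def)
  have fi: "?f i \<in> carrier (loc F)"
    using cech_diff_summand[OF F _ single_cochain_closed[OF X]] i by auto
  have ne: "F - {l} \<noteq> G" if "l \<in> F" "l \<noteq> i" for l using FG that by blast
  have "(\<Oplus>\<^bsub>loc F\<^esub>l\<in>F. ?f l) = (\<Oplus>\<^bsub>loc F\<^esub>l\<in>F. if i = l then ?f l else \<zero>\<^bsub>loc F\<^esub>)"
    using zero ne fi by (intro L.M.finsum_cong'[OF refl]) auto
  also have "\<dots> = ?f i"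
    by (rule L.M.finsum_singleton)
      (use i fin cech_diff_summand[OF F _ single_cochain_closed[OF X]] in auto)
  finally show "cech_diff A fs p (single_cochain p G X) F =
      (-1) ^ card {l\<in>F. l < i} \<odot>\<^bsub>loc F\<^esub> loc_map A (fs ! i) (face_elem A fs F) X"
    using D f by simp
qed

text \<open>A cochain is the sum of the cochains given by its components. So a subspace contains it if it
  contains those, and if it contains the cochain and the summands of all components but one, then it
  contains the remaining summand.\<close>

lemma partial_cochain_in_subspace:
  assumes T: "linear_subspace (cech A fs p) T" and c: "c \<in> carrier (cech A fs p)"
    and S: "S \<subseteq> faces fs p" "\<And>F. F \<in> S \<Longrightarrow> single_cochain p F (c F) \<in> T"
  shows "(\<lambda>F\<in>faces fs p. if F \<in> S then c F else \<zero>\<^bsub>loc F\<^esub>) \<in> T"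
  using finite_subset[OF S(1) finite_faces] S
proof (induction S rule: finite_induct)
  case empty
  have "\<zero>\<^bsub>cech A fs p\<^esub> \<in> T" using T unfolding linear_subspace_def by blast
  then show ?case by (simp only: empty_iff if_False cech_simps(2))
next
  case (insert F S)
  have cF: "c F' \<in> carrier (loc F')" if "F' \<in> faces fs p" for F'
    using c that by (auto simp: cech_simps dest: PiE_mem)
  have "(\<lambda>F'\<in>faces fs p. if F' \<in> insert F S then c F' else \<zero>\<^bsub>loc F'\<^esub>) =
      single_cochain p F (c F) \<oplus>\<^bsub>cech A fs p\<^esub> (\<lambda>F\<in>faces fs p. if F \<in> S then c F else \<zero>\<^bsub>loc F\<^esub>)"
    unfolding single_cochain_def cech_simps(3)
    by (rule restrict_ext) (use insert.hyps cF in \<open>auto simp: loc_module_facts\<close>)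
  moreover have "single_cochain p F (c F) \<in> T"
    "(\<lambda>F\<in>faces fs p. if F \<in> S then c F else \<zero>\<^bsub>loc F\<^esub>) \<in> T"
    using insert.prems insert.IH by blast+
  ultimately show ?case using T unfolding linear_subspace_def by auto
qed

lemma cochain_in_subspace:
  assumes T: "linear_subspace (cech A fs p) T" and c: "c \<in> carrier (cech A fs p)"
    and "\<And>F. F \<in> faces fs p \<Longrightarrow> single_cochain p F (c F) \<in> T"
  shows "c \<in> T"
proof -
  have "c = (\<lambda>F\<in>faces fs p. if F \<in> faces fs p then c F else \<zero>\<^bsub>loc F\<^esub>)"
  proof (rule ext)
    fix F
    show "c F = (\<lambda>F\<in>faces fs p. if F \<in> faces fs p then c F else \<zero>\<^bsub>loc F\<^esub>) F"
      using PiE_arb[OF c[unfolded cech_simps(1)]] by (cases "F \<in> faces fs p") simp_all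
  qed
  then show ?thesis using partial_cochain_in_subspace[OF T c subset_refl assms(3)] by simp
qed

lemma single_cochain_in_subspace:
  assumes T: "linear_subspace (cech A fs p) T" and c: "c \<in> T" and F: "F \<in> faces fs p"
    and "\<And>F'. F' \<in> faces fs p \<Longrightarrow> F' \<noteq> F \<Longrightarrow> single_cochain p F' (c F') \<in> T"
  shows "single_cochain p F (c F) \<in> T"
proof -
  interpret C: module class_ring "cech A fs p" by (rule module_cech)
  have cc: "c \<in> carrier (cech A fs p)" using T c by (auto simp: linear_subspace_def)
  have cF: "c F' \<in> carrier (loc F')" if "F' \<in> faces fs p" for F'
    using cc that by (auto simp: cech_simps dest: PiE_mem)
  let ?d = "\<lambda>F'\<in>faces fs p. if F' \<in> faces fs p - {F} then c F' else \<zero>\<^bsub>loc F'\<^esub>"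
  have d: "?d \<in> T" by (rule partial_cochain_in_subspace[OF T cc]) (use assms(4) in auto)
  have s: "single_cochain p F (c F) \<in> carrier (cech A fs p)" by (rule single_cochain_closed[OF cF[OF F]])
  have dc: "?d \<in> carrier (cech A fs p)" using T d by (auto simp: linear_subspace_def)
  have "c = single_cochain p F (c F) \<oplus>\<^bsub>cech A fs p\<^esub> ?d"
  proof (rule ext)
    fix F'
    show "c F' = (single_cochain p F (c F) \<oplus>\<^bsub>cech A fs p\<^esub> ?d) F'"
    proof (cases "F' \<in> faces fs p")
      case True
      show ?thesis unfolding single_cochain_def cech_simps(3) restrict_apply'[OF True]
        using cF[OF True] True F by (cases "F' = F") (simp_all add: loc_module_facts)
    next
      case False
      then show ?thesis using PiE_arb[OF cc[unfolded cech_simps(1)]] by (simp add: cech_simps(3))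
    qed
  qed
  then have "single_cochain p F (c F) = c \<oplus>\<^bsub>cech A fs p\<^esub> \<ominus>\<^bsub>cech A fs p\<^esub> ?d"
    using C.M.a_assoc[OF s dc C.M.a_inv_closed[OF dc]] C.M.r_neg[OF dc] C.M.r_zero[OF s] by simp
  moreover have "\<ominus>\<^bsub>cech A fs p\<^esub> ?d \<in> T" by (rule linear_subspace_minus[OF module_cech T d])
  ultimately show ?thesis using T c unfolding linear_subspace_def by auto
qed

end

section \<open>The Cech complex of an edge ring\<close>

text \<open>The Cech complex of the edge ring with respect to the variables. A set \<open>F\<close> of positions in the list
  \<open>vs\<close> stands for the set \<open>ver F\<close> of the vertices at these positions. The parameter \<open>K\<close> merely fixes
  the field \<open>'k\<close>.\<close>

locale edge_cech =
  fixes V :: "'v set" and E :: "'v set set" and vs :: "'v list" and K :: "'k::field itself"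
  assumes graph: "simple_graph V E" and dist: "distinct vs" and vs: "set vs = V"
begin

abbreviation R :: "('k, ('v, 'k) mpoly set) module" where "R \<equiv> edge_ring V E"
abbreviation P :: "('k, ('v, 'k) mpoly) module" where "P \<equiv> poly_algebra V"
abbreviation xs :: "('v, 'k) mpoly set list" where "xs \<equiv> map (edge_ring_var V E) vs"
abbreviation cls :: "('v, 'k) mpoly \<Rightarrow> ('v, 'k) mpoly set"
  where "cls \<equiv> poly_class V E"
abbreviation mon :: "('v \<Rightarrow>\<^sub>0 nat) \<Rightarrow> ('v, 'k) mpoly" where "mon \<mu> \<equiv> single \<mu> 1"

lemmas R_simps = edge_ring_simps[OF graph, where ?'k = 'k]

lemma nth_vs: "i < length vs \<Longrightarrow> vs ! i \<in> V"
  using vs nth_mem by blast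

sublocale C: cech_complex R xs
proof (intro cech_complex.intro field_algebra.intro cech_complex_axioms.intro)
  show "algebra class_ring R" by (rule algebra_edge_ring[OF graph])
  show "set xs \<subseteq> carrier R"
    unfolding R_simps(1) edge_ring_var_def using vs poly_var_in_carrier by fastforce
qed

abbreviation ver :: "nat set \<Rightarrow> 'v set" where "ver F \<equiv> (!) vs ` F"

text \<open>The exponent of the \<open>k\<close>-th power of the product of the variables with positions in \<open>F\<close>.\<close>

definition expo :: "nat set \<Rightarrow> nat \<Rightarrow> 'v \<Rightarrow>\<^sub>0 nat" where
  "expo F k = (\<Sum>i\<in>F. single (vs ! i) k)"

lemma lookup_expo:
  assumes "F \<subseteq> {..<length vs}"
  shows "lookup (expo F k) v = (if v \<in> ver F then k else 0)"
proof -
  have fin: "finite F" using assms finite_subset by blast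
  have "lookup (expo F k) v = (\<Sum>i\<in>F. k when vs ! i = v)"
    by (simp add: expo_def lookup_sum lookup_single)
  also have "\<dots> = (if v \<in> ver F then k else 0)"
  proof (cases "v \<in> ver F")
    case True
    then obtain i where i: "i \<in> F" "v = vs ! i" by blast
    have "(\<Sum>l\<in>F. k when vs ! l = v) = (\<Sum>l\<in>{i}. k when vs ! l = v)"
      using fin i assms dist
      by (intro sum.mono_neutral_right) (auto simp: when_def nth_eq_iff_index_eq subset_iff)
    then show ?thesis using i True by simp
  qed (auto simp: when_def intro!: sum.neutral)
  finally show ?thesis .
qed

lemma expo_add: "expo F (k + l) = expo F k + expo F l"
  by (simp add: expo_def single_add sum.distrib)

lemma expo_0: "expo F 0 = 0"
  by (simp add: expo_def)

lemma keys_expo: "F \<subseteq> {..<length vs} \<Longrightarrow> keys (expo F k) \<subseteq> ver F"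
  by (auto simp: in_keys_iff lookup_expo split: if_splits)

lemma ver_subset: "F \<subseteq> {..<length vs} \<Longrightarrow> ver F \<subseteq> V"
  using nth_vs by blast

lemma facesD: "F \<in> faces xs p \<Longrightarrow> F \<subseteq> {..<length vs} \<and> card F = p"
  by (simp add: faces_def)

lemma mon_closed: "keys \<mu> \<subseteq> V \<Longrightarrow> mon \<mu> \<in> carrier P"
  by (rule poly_algebra_single_closed)

lemma mon_expo_closed: "F \<subseteq> {..<length vs} \<Longrightarrow> mon (expo F k) \<in> carrier P"
  using keys_expo ver_subset by (intro mon_closed) blast

lemma cls_closed: "p \<in> carrier P \<Longrightarrow> cls p \<in> carrier R"
  by (simp add: R_simps(1))

lemma mon_mult: "mon \<mu> * mon \<nu> = mon (\<mu> + \<nu>)"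
  by (simp add: mult_single)

lemma face_elem_edge_ring:
  assumes "F \<subseteq> {..<length vs}"
  shows "face_elem R xs F = cls (mon (expo F 1))"
proof -
  have "finite F" using assms finite_subset by blast
  then show ?thesis using assms
  proof (induction F rule: finite_induct)
    case empty
    show ?case by (simp add: face_elem_def expo_0 R_simps(2)) (simp add: expo_def)
  next
    case (insert i F)
    have i: "i < length vs" using insert by auto
    have "face_elem R xs (insert i F) = xs ! i \<otimes>\<^bsub>R\<^esub> face_elem R xs F"
      unfolding face_elem_def
      by (rule C.finprod_insert) (use insert in \<open>auto simp del: nth_map intro!: C.nth_fs\<close>)
    also have "xs ! i = cls (poly_var (vs ! i))" using i by (simp add: edge_ring_var_def)
    also have "face_elem R xs F = cls (mon (expo F 1))" using insert.IH insert.prems by blast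
    also have "cls (poly_var (vs ! i)) \<otimes>\<^bsub>R\<^esub> cls (mon (expo F 1)) = cls (poly_var (vs ! i) * mon (expo F 1))"
      using insert.prems i by (intro R_simps(5) poly_var_in_carrier mon_expo_closed nth_vs) auto
    also have "poly_var (vs ! i) * mon (expo F 1) = mon (expo (insert i F) 1)"
      using insert by (simp add: poly_var_def mult_single expo_def)
    finally show ?case .
  qed
qed

lemma face_elem_pow:
  assumes "F \<subseteq> {..<length vs}"
  shows "face_elem R xs F [^]\<^bsub>R\<^esub> k = cls (mon (expo F k))"
proof (induction k)
  case 0
  then show ?case by (simp add: expo_0 R_simps(2))
next
  case (Suc k)
  have "face_elem R xs F [^]\<^bsub>R\<^esub> Suc k = cls (mon (expo F k) * mon (expo F 1))"
    using Suc R_simps(5)[OF mon_expo_closed[OF assms, of k] mon_expo_closed[OF assms, of 1]]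
    by (simp add: face_elem_edge_ring[OF assms])
  then show ?case using expo_add[of F k 1] by (simp add: mon_mult)
qed

lemma dependent_face_elem:
  assumes "F \<subseteq> {..<length vs}" "\<not> independent E (ver F)"
  shows "face_elem R xs F = \<zero>\<^bsub>R\<^esub>"
proof -
  have k: "keys (expo F 1) = ver F"
    using assms(1) by (auto simp: in_keys_iff lookup_expo split: if_splits)
  have "mon (expo F 1) \<in> edge_ideal V E"
    by (rule dependent_monomial_in_edge_ideal[OF graph]) (use k assms ver_subset in auto)
  then show ?thesis
    unfolding face_elem_edge_ring[OF assms(1)] R_simps(3)
    by (subst poly_class_eq_iff[OF graph mon_expo_closed[OF assms(1)] poly_algebra_zero_closed]) simp
qed

text \<open>The class of the polynomial \<open>p\<close>, divided by the \<open>k\<close>-th power of the product of the variables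
  with positions in \<open>F\<close>.\<close>

definition fr :: "nat set \<Rightarrow> ('v, 'k) mpoly \<Rightarrow> nat \<Rightarrow> (('v, 'k) mpoly set \<times> nat) set" where
  "fr F p k = loc_frac R (face_elem R xs F) (cls p) k"

lemma face_elem_closed: "F \<subseteq> {..<length vs} \<Longrightarrow> face_elem R xs F \<in> carrier R"
  by (simp add: face_elem_edge_ring cls_closed mon_expo_closed del: One_nat_def)

lemma fr_eq_iff:
  assumes F: "F \<subseteq> {..<length vs}" and p: "p \<in> carrier P" and q: "q \<in> carrier P"
  shows "fr F p k = fr F q l \<longleftrightarrow>
    (\<exists>N. mon (expo F (N + l)) * p - mon (expo F (N + k)) * q \<in> edge_ideal V E)"
proof -
  have "fr F p k = fr F q l \<longleftrightarrow>
      (\<exists>N. cls (mon (expo F (N + l))) \<otimes>\<^bsub>R\<^esub> cls p = cls (mon (expo F (N + k))) \<otimes>\<^bsub>R\<^esub> cls q)"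
    unfolding fr_def using C.loc_frac_eq_iff[OF face_elem_closed[OF F] cls_closed[OF p] cls_closed[OF q]]
    by (simp only: face_elem_pow[OF F])
  also have "\<dots> \<longleftrightarrow> (\<exists>N. cls (mon (expo F (N + l)) * p) = cls (mon (expo F (N + k)) * q))"
    using p q mon_expo_closed[OF F] by (simp add: R_simps(5))
  also have "\<dots> \<longleftrightarrow> (\<exists>N. mon (expo F (N + l)) * p - mon (expo F (N + k)) * q \<in> edge_ideal V E)"
    using p q mon_expo_closed[OF F] by (simp add: poly_class_eq_iff[OF graph] poly_algebra_mult_closed)
  finally show ?thesis .
qed

lemma fr_elem:
  assumes "X \<in> carrier (C.loc F)"
  obtains p k where "p \<in> carrier P" "X = fr F p k"
  using assms unfolding fr_def C.localization_simps R_simps(1) by blast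

lemma fr_closed: "p \<in> carrier P \<Longrightarrow> fr F p k \<in> carrier (C.loc F)"
  unfolding fr_def C.localization_simps using cls_closed by blast

lemma fr_common2:
  assumes F: "F \<subseteq> {..<length vs}" and X: "X \<in> carrier (C.loc F)"
    "Y \<in> carrier (C.loc F)"
  obtains p q k where "p \<in> carrier P" "q \<in> carrier P" "X = fr F p k" "Y = fr F q k"
proof -
  obtain a b k where "a \<in> carrier R" "b \<in> carrier R" "X = loc_frac R (face_elem R xs F) a k"
    "Y = loc_frac R (face_elem R xs F) b k"
    using C.localization_common2[OF face_elem_closed[OF F] X] .
  then show ?thesis using that unfolding fr_def R_simps(1) by blast
qed

lemma fr_add:
  assumes "F \<subseteq> {..<length vs}" "p \<in> carrier P" "q \<in> carrier P"
  shows "fr F p k \<oplus>\<^bsub>C.loc F\<^esub> fr F q k = fr F (p + q) k"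
  unfolding fr_def using assms
  by (simp add: C.localization_add_same face_elem_closed cls_closed R_simps(4))

lemma fr_smult:
  assumes "F \<subseteq> {..<length vs}" "p \<in> carrier P"
  shows "c \<odot>\<^bsub>C.loc F\<^esub> fr F p k = fr F (single 0 c * p) k"
  unfolding fr_def using assms
  by (simp add: C.localization_smult face_elem_closed cls_closed R_simps(6))

lemma fr_0:
  assumes "F \<subseteq> {..<length vs}"
  shows "fr F 0 k = \<zero>\<^bsub>C.loc F\<^esub>"
  unfolding fr_def using C.localization_zero[OF face_elem_closed[OF assms], of k]
  by (simp add: R_simps(3))

lemma fr_eq_0I:
  assumes F: "F \<subseteq> {..<length vs}" and "p \<in> carrier P" "mon (expo F N) * p \<in> edge_ideal V E"
  shows "fr F p k = \<zero>\<^bsub>C.loc F\<^esub>"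
  unfolding fr_0[OF F, symmetric, of 0]
  using assms by (subst fr_eq_iff[OF F _ poly_algebra_zero_closed]) (auto intro!: exI[of _ N])

text \<open>Localizing at an independent set \<open>F\<close> kills the monomials whose support together with \<open>F\<close> is
  dependent. Localizing at a dependent set kills everything.\<close>

lemma fr_eq_0_dependent:
  assumes F: "F \<subseteq> {..<length vs}" and "keys \<mu> \<subseteq> V"
    "\<not> independent E (ver F \<union> keys \<mu>)"
  shows "fr F (mon \<mu>) k = \<zero>\<^bsub>C.loc F\<^esub>"
proof (rule fr_eq_0I[OF F mon_closed[OF assms(2)], of 1])
  have "keys (expo F 1 + \<mu>) = ver F \<union> keys \<mu>"
    using F by (auto simp: keys_add_nat in_keys_iff lookup_expo split: if_splits)
  then show "mon (expo F 1) * mon \<mu> \<in> edge_ideal V E"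
    unfolding mon_mult using assms ver_subset[OF F]
    by (intro dependent_monomial_in_edge_ideal[OF graph]) auto
qed

lemma fr_expand:
  assumes F: "F \<subseteq> {..<length vs}" and p: "p \<in> carrier P"
  shows "fr F (mon (expo F l) * p) (k + l) = fr F p k"
proof -
  have "mon (expo F (0 + k)) * (mon (expo F l) * p) - mon (expo F (0 + (k + l))) * p = 0"
    by (simp add: expo_add mon_mult[symmetric] mult.assoc)
  moreover have "(0 :: ('v, 'k) mpoly) \<in> edge_ideal V E"
    using linear_subspace_edge_ideal[OF graph, where ?'k = 'k]
    unfolding linear_subspace_def poly_algebra_simps by blast
  ultimately have "mon (expo F (0 + k)) * (mon (expo F l) * p) - mon (expo F (0 + (k + l))) * p
      \<in> edge_ideal V E" by metis
  then show ?thesis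
    using fr_eq_iff[OF F poly_algebra_mult_closed[OF mon_expo_closed[OF F] p] p] by blast
qed

lemma loc_map_fr:
  assumes F: "F \<subseteq> {..<length vs}" and i: "i \<in> F" and p: "p \<in> carrier P"
  shows "loc_map R (xs ! i) (face_elem R xs F) (fr (F - {i}) p k) =
    fr F (mon (single (vs ! i) k) * p) k"
proof -
  have il: "i < length vs" using F i by auto
  have G: "F - {i} \<subseteq> {..<length vs}" using F by auto
  have "F \<in> faces xs (card F)" using F by (simp add: faces_def)
  then have fe: "face_elem R xs (F - {i}) \<otimes>\<^bsub>R\<^esub> xs ! i = face_elem R xs F"
    using i by (rule C.face_elem_Diff)
  have xi: "xs ! i = face_elem R xs {i}"
    using face_elem_edge_ring[of "{i}"] il by (simp add: expo_def edge_ring_var_def poly_var_def)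
  have "{i} \<subseteq> {..<length vs}" using il by simp
  then have pow: "(xs ! i) [^]\<^bsub>R\<^esub> k = cls (mon (single (vs ! i) k))"
    unfolding xi by (subst face_elem_pow) (simp_all add: expo_def)
  have xc: "xs ! i \<in> carrier R" using il by (intro C.nth_fs) simp
  have m: "mon (single (vs ! i) k) \<in> carrier P"
    using nth_vs[OF il] by (intro mon_closed) simp
  have "loc_map R (xs ! i) (face_elem R xs F) (fr (F - {i}) p k) =
      loc_frac R (face_elem R xs F) (cls p \<otimes>\<^bsub>R\<^esub> (xs ! i) [^]\<^bsub>R\<^esub> k) k"
    unfolding fr_def using C.loc_map_frac[OF face_elem_closed[OF G] xc cls_closed[OF p], of k]
    unfolding fe .
  also have "cls p \<otimes>\<^bsub>R\<^esub> (xs ! i) [^]\<^bsub>R\<^esub> k = cls (mon (single (vs ! i) k) * p)"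
    unfolding pow using R_simps(5)[OF p m] by (simp add: mult.commute)
  finally show ?thesis by (simp add: fr_def)
qed

text \<open>For an independent set \<open>F\<close>, the coefficient of the Laurent monomial with exponent \<open>- b\<close> in a
  fraction with numerator \<open>p\<close> is the coefficient of \<open>p\<close> at the exponent \<open>expo F k - b\<close>. Since the
  subtraction of exponents is truncated, the condition \<open>b \<le> expo F k\<close> has to be made explicit; in
  particular the coefficient is zero unless \<open>b\<close> is supported in \<open>F\<close>.\<close>

definition coord_rep :: "nat set \<Rightarrow> ('v \<Rightarrow>\<^sub>0 nat) \<Rightarrow> ('v, 'k) mpoly \<Rightarrow> nat \<Rightarrow> 'k" where
  "coord_rep F b p k =
     (if \<forall>v. lookup b v \<le> lookup (expo F k) v
      then lookup p (expo F k - b) else 0)"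

text \<open>The same coefficient as a function of the fraction, read off from some representative. By
  \<open>coord_rep_cong\<close> its choice does not matter.\<close>

definition coord :: "nat set \<Rightarrow> ('v \<Rightarrow>\<^sub>0 nat) \<Rightarrow> (('v, 'k) mpoly set \<times> nat) set \<Rightarrow> 'k" where
  "coord F b X = (case SOME (p, k). p \<in> carrier P \<and> X = fr F p k of (p, k) \<Rightarrow> coord_rep F b p k)"

text \<open>Expanding the fraction by the \<open>M\<close>-th power of the denominator does not change the coefficient. If
  \<open>b\<close> exceeds \<open>k\<close> at some vertex of \<open>F\<close>, then the exponent on the left is smaller than \<open>M\<close> there, so
  that the coefficient is zero.\<close>

lemma lookup_shift:
  assumes F: "F \<subseteq> {..<length vs}"
    and b: "\<forall>v. lookup b v \<le> lookup (expo F (M + k)) v"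
  shows "lookup (mon (expo F M) * p) (expo F (M + k) - b) = coord_rep F b p k"
proof (cases "\<forall>v. lookup b v \<le> lookup (expo F k) v")
  case True
  then have "expo F (M + k) - b = expo F M + (expo F k - b)"
    by (intro poly_mapping_eqI) (simp add: lookup_add lookup_minus expo_add)
  then show ?thesis using True by (simp add: coord_rep_def lookup_single_times)
next
  case False
  then obtain v where v: "lookup b v > lookup (expo F k) v"
    by (auto simp: not_le)
  have "lookup b v \<le> lookup (expo F (M + k)) v" using b by blast
  then have "lookup (expo F (M + k) - b) v < lookup (expo F M) v"
    using v by (auto simp: lookup_minus lookup_expo[OF F] split: if_splits)
  then show ?thesis unfolding coord_rep_def if_not_P[OF False] by (rule lookup_single_times_eq_0)
qed

lemma coord_rep_cong:
  assumes F: "F \<subseteq> {..<length vs}" and ind: "independent E (ver F)"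
    and p: "p \<in> carrier P" and q: "q \<in> carrier P" and eq: "fr F p k = fr F q l"
  shows "coord_rep F b p k = coord_rep F b q l"
proof -
  obtain N where N: "mon (expo F (N + l)) * p - mon (expo F (N + k)) * q \<in> edge_ideal V E"
    using eq fr_eq_iff[OF F p q] by blast
  show ?thesis
  proof (cases "\<forall>v. lookup b v \<le> lookup (expo F (N + l + k)) v")
    case True
    have comm: "N + k + l = N + l + k" by simp
    have "keys (expo F (N + l + k) - b) \<subseteq> ver F"
      using keys_expo[OF F, of "N + l + k"] by (auto simp: in_keys_iff lookup_minus lookup_expo[OF F] split: if_splits)
    then have "independent E (keys (expo F (N + l + k) - b))"
      using ind independent_mono by blast
    then have "lookup (mon (expo F (N + l)) * p) (expo F (N + l + k) - b) =
        lookup (mon (expo F (N + k)) * q) (expo F (N + k + l) - b)"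
      using lookup_edge_ideal[OF graph N] unfolding comm by (simp add: lookup_minus)
    then show ?thesis
      using lookup_shift[OF F True, of p] lookup_shift[OF F True[folded comm], of q]
      by (simp only:)
  next
    case False
    have "lookup (expo F k) v \<le> lookup (expo F (N + l + k)) v"
      "lookup (expo F l) v \<le> lookup (expo F (N + l + k)) v" for v
      by (simp_all add: expo_add lookup_add)
    then show ?thesis using False unfolding coord_rep_def by (meson order_trans)
  qed
qed

lemma coord_fr:
  assumes F: "F \<subseteq> {..<length vs}" and ind: "independent E (ver F)" and p: "p \<in> carrier P"
  shows "coord F b (fr F p k) = coord_rep F b p k"
proof -
  obtain q l where ql: "(SOME (q, l). q \<in> carrier P \<and> fr F p k = fr F q l) = (q, l)" by force
  have "case (q, l) of (q, l) \<Rightarrow> q \<in> carrier P \<and> fr F p k = fr F q l"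
    unfolding ql[symmetric] by (rule someI[of _ "(p, k)"]) (use p in simp)
  then have "coord_rep F b p k = coord_rep F b q l" using coord_rep_cong[OF F ind p] by simp
  then show ?thesis by (simp only: coord_def ql prod.case)
qed

lemma coord_linear:
  assumes F: "F \<subseteq> {..<length vs}" and ind: "independent E (ver F)"
  shows "linear_functional (C.loc F) (coord F b)"
  unfolding linear_functional_def
proof (intro conjI ballI allI)
  fix X Y assume "X \<in> carrier (C.loc F)"
    "Y \<in> carrier (C.loc F)"
  then obtain p q k where "p \<in> carrier P" "q \<in> carrier P" "X = fr F p k" "Y = fr F q k"
    using fr_common2[OF F] by metis
  then show "coord F b (X \<oplus>\<^bsub>C.loc F\<^esub> Y) = coord F b X + coord F b Y"
    by (simp add: fr_add[OF F] coord_fr[OF F ind] poly_algebra_add_closed coord_rep_def lookup_add)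
next
  fix c X assume "X \<in> carrier (C.loc F)"
  then obtain p k where p: "p \<in> carrier P" "X = fr F p k" by (rule fr_elem)
  have "single 0 c * p \<in> carrier P"
    using p by (intro poly_algebra_mult_closed poly_algebra_single_closed) auto
  moreover have "lookup (single 0 c * p) \<mu> = c * lookup p \<mu>" for \<mu>
    using lookup_single_times[of 0 c p \<mu>] by simp
  ultimately show "coord F b (c \<odot>\<^bsub>C.loc F\<^esub> X) = c * coord F b X"
    using p by (simp add: fr_smult[OF F] coord_fr[OF F ind] coord_rep_def)
qed

text \<open>The localization maps preserve the coefficients at \<open>- b\<close>. If \<open>b\<close> is zero at \<open>i\<close>, then both sides are
  the same coefficient of the numerator; otherwise both are zero, since fractions over \<open>F - {i}\<close> have
  no negative exponents at \<open>i\<close>.\<close>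

lemma coord_loc_map:
  assumes F: "F \<subseteq> {..<length vs}" and ind: "independent E (ver F)" and i: "i \<in> F"
    and X: "X \<in> carrier (C.loc (F - {i}))"
  shows "coord F b (loc_map R (xs ! i) (face_elem R xs F) X) = coord (F - {i}) b X"
proof -
  obtain p k where p: "p \<in> carrier P" "X = fr (F - {i}) p k" using X by (rule fr_elem)
  let ?v = "vs ! i" and ?G = "F - {i}"
  have G: "?G \<subseteq> {..<length vs}" and indG: "independent E (ver ?G)"
    using F independent_mono[OF ind, of "ver ?G"] by auto
  have il: "i < length vs" using F i by auto
  have m: "mon (single ?v k) * p \<in> carrier P"
    using p nth_vs[OF il] by (intro poly_algebra_mult_closed mon_closed) auto
  have vG: "?v \<notin> ver ?G" using F i dist by (auto simp: nth_eq_iff_index_eq subset_iff)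
  have fin: "finite F" using F finite_subset by blast
  have ex: "expo F k = single ?v k + expo ?G k"
    unfolding expo_def using fin i by (simp add: sum.remove)
  have "coord_rep F b (mon (single ?v k) * p) k = coord_rep ?G b p k"
  proof (cases "\<forall>v. lookup b v \<le> lookup (expo ?G k) v")
    case True
    then have "expo F k - b = single ?v k + (expo ?G k - b)"
      unfolding ex by (intro poly_mapping_eqI) (simp add: lookup_add lookup_minus)
    moreover have "\<forall>v. lookup b v \<le> lookup (expo F k) v"
      using True unfolding ex lookup_add by (meson trans_le_add2)
    ultimately show ?thesis using True by (simp add: coord_rep_def lookup_single_times)
  next
    case False
    then obtain u where u: "lookup b u > lookup (expo ?G k) u"
      by (auto simp: not_le)
    have "lookup (mon (single ?v k) * p) (expo F k - b) = 0"
      if le: "\<forall>v. lookup b v \<le> lookup (expo F k) v"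
    proof (rule lookup_single_times_eq_0)
      have "lookup b u \<le> lookup (expo F k) u" using le by blast
      then have "u = ?v" using u unfolding ex lookup_add lookup_single by (auto simp: when_def split: if_splits)
      moreover have "lookup b ?v \<le> k"
        using le lookup_expo[OF F, of k ?v] i by (metis image_eqI)
      ultimately show "lookup (expo F k - b) ?v < lookup (single ?v k) ?v"
        using u i by (auto simp: lookup_minus lookup_expo[OF F])
    qed
    then show ?thesis using False by (auto simp: coord_rep_def)
  qed
  then show ?thesis unfolding p(2) loc_map_fr[OF F i p(1)]
    using coord_fr[OF F ind m] coord_fr[OF G indG p(1)] by simp
qed

end

section \<open>Top local cohomology of a clique-whiskered graph\<close>

text \<open>The total degree of a monomial.\<close>

definition mdeg :: "('v \<Rightarrow>\<^sub>0 nat) \<Rightarrow> nat" where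
  "mdeg \<mu> = (\<Sum>v\<in>keys \<mu>. lookup \<mu> v)"

lemma mdeg_eq: "finite S \<Longrightarrow> keys \<mu> \<subseteq> S \<Longrightarrow> mdeg \<mu> = (\<Sum>v\<in>S. lookup \<mu> v)"
  unfolding mdeg_def by (rule sum.mono_neutral_left) (auto simp: in_keys_iff)

lemma mdeg_add: "mdeg (\<mu> + \<nu>) = mdeg \<mu> + mdeg \<nu>"
proof -
  let ?S = "keys \<mu> \<union> keys \<nu>"
  have "mdeg (\<mu> + \<nu>) = (\<Sum>v\<in>?S. lookup (\<mu> + \<nu>) v)"
    by (rule mdeg_eq) (auto simp: keys_add_nat)
  then show ?thesis by (simp add: lookup_add sum.distrib mdeg_eq[of ?S])
qed

lemma mdeg_single: "mdeg (single v k) = k"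
  by (simp add: mdeg_eq[of "{v}"])

lemma lookup_le_mdeg: "lookup \<mu> v \<le> mdeg \<mu>"
proof (cases "v \<in> keys \<mu>")
  case True
  then show ?thesis unfolding mdeg_def by (intro member_le_sum) auto
qed (simp add: in_keys_iff)

lemma finite_monomials:
  assumes "finite S"
  shows "finite {b :: 'v \<Rightarrow>\<^sub>0 nat. keys b \<subseteq> S \<and> mdeg b = q}"
proof (rule inj_on_finite[of "\<lambda>b. \<lambda>v\<in>S. lookup b v"])
  show "inj_on (\<lambda>b. \<lambda>v\<in>S. lookup b v) {b :: 'v \<Rightarrow>\<^sub>0 nat. keys b \<subseteq> S \<and> mdeg b = q}"
  proof (rule inj_onI, rule poly_mapping_eqI)
    fix b c :: "'v \<Rightarrow>\<^sub>0 nat" and v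
    assume bc: "b \<in> {b. keys b \<subseteq> S \<and> mdeg b = q}" "c \<in> {b. keys b \<subseteq> S \<and> mdeg b = q}"
      "(\<lambda>v\<in>S. lookup b v) = (\<lambda>v\<in>S. lookup c v)"
    show "lookup b v = lookup c v"
    proof (cases "v \<in> S")
      case True
      then show ?thesis using fun_cong[OF bc(3), of v] by simp
    next
      case False
      then have "v \<notin> keys b" "v \<notin> keys c" using bc(1,2) by auto
      then show ?thesis by (simp add: in_keys_iff)
    qed
  qed
  show "(\<lambda>b. \<lambda>v\<in>S. lookup b v) ` {b :: 'v \<Rightarrow>\<^sub>0 nat. keys b \<subseteq> S \<and> mdeg b = q} \<subseteq> (\<Pi>\<^sub>E v\<in>S. {..q})"
    using lookup_le_mdeg by auto
  show "finite (\<Pi>\<^sub>E v\<in>S. {..q})" using assms by (intro finite_PiE) auto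
qed

lemma homogeneous_polys_mult_monomial:
  assumes "p \<in> homogeneous_polys V \<delta>" "keys \<nu> \<subseteq> V"
  shows "single \<nu> c * p \<in> (homogeneous_polys V (int (mdeg \<nu>) + \<delta>) :: (_ \<Rightarrow>\<^sub>0 'k::field) set)"
proof -
  have "int (mdeg \<mu>) = int (mdeg \<nu>) + \<delta>" if \<mu>: "\<mu> \<in> keys (single \<nu> c * p)" for \<mu>
  proof -
    obtain a b where "\<mu> = a + b" "a \<in> keys (single \<nu> c)" "b \<in> keys p"
      using \<mu> keys_mult[of "single \<nu> c" p] by blast
    then show ?thesis
      using assms(1) by (auto simp: homogeneous_polys_def mdeg_add mdeg_def[symmetric] split: if_splits)
  qed
  moreover have "single \<nu> c * p \<in> carrier (poly_algebra V)"
    using assms by (intro poly_algebra_mult_closed poly_algebra_single_closed) (auto simp: homogeneous_polys_def)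
  ultimately show ?thesis by (simp add: homogeneous_polys_def mdeg_def)
qed

lemma homogeneous_polys_add:
  assumes "p \<in> homogeneous_polys V \<delta>" "q \<in> homogeneous_polys V \<delta>"
  shows "p + q \<in> (homogeneous_polys V \<delta> :: (_ \<Rightarrow>\<^sub>0 'k::field) set)"
  using assms keys_add[of p q] poly_algebra_add_closed[of p V q] by (auto simp: homogeneous_polys_def)

lemma poly_eq_sum_monomials:
  "(p :: 'a \<Rightarrow>\<^sub>0 'k::comm_monoid_add) = (\<Sum>\<mu>\<in>keys p. single \<mu> (lookup p \<mu>))"
proof (rule poly_mapping_eqI)
  fix \<nu>
  have "(\<Sum>\<mu>\<in>keys p. lookup p \<mu> when \<mu> = \<nu>) = lookup p \<nu>"
  proof (cases "\<nu> \<in> keys p")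
    case True
    then have "(\<Sum>\<mu>\<in>keys p. lookup p \<mu> when \<mu> = \<nu>) =
        (\<Sum>\<mu>\<in>{\<nu>}. lookup p \<mu> when \<mu> = \<nu>)"
      by (intro sum.mono_neutral_right) auto
    then show ?thesis by simp
  next
    case False
    then have "(\<Sum>\<mu>\<in>keys p. lookup p \<mu> when \<mu> = \<nu>) = 0"
      by (intro sum.neutral) (auto simp: when_def)
    then show ?thesis using False by (simp add: in_keys_iff)
  qed
  then show "lookup p \<nu> =
      lookup (\<Sum>\<mu>\<in>keys p. single \<mu> (lookup p \<mu>)) \<nu>"
    by (simp add: lookup_sum lookup_single)
qed

text \<open>A graph whose vertex set is partitioned into \<open>d\<close> cliques, given by a colouring \<open>col\<close> with the colours
  \<open>0, \<dots>, d - 1\<close>, where the clique of colour \<open>c\<close> contains a vertex \<open>wh c\<close>, called its whisker, whose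
  neighbours all belong to that clique. The set of whiskers is denoted by \<open>W\<close>. An independent set
  contains at most one vertex of each colour.\<close>

locale clique_cech = edge_cech V E vs K
  for V :: "'v set" and E vs and K :: "'k::field itself" +
  fixes d :: nat and col :: "'v \<Rightarrow> nat" and wh :: "nat \<Rightarrow> 'v"
  assumes col_less: "v \<in> V \<Longrightarrow> col v < d"
    and clique: "u \<in> V \<Longrightarrow> v \<in> V \<Longrightarrow> u \<noteq> v \<Longrightarrow> col u = col v \<Longrightarrow> {u, v} \<in> E"
    and wh_in: "c < d \<Longrightarrow> wh c \<in> V" and col_wh: "c < d \<Longrightarrow> col (wh c) = c"
    and wh_edge: "c < d \<Longrightarrow> {wh c, v} \<in> E \<Longrightarrow> col v = c"
begin

abbreviation W :: "'v set" where "W \<equiv> wh ` {..<d}"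
abbreviation colp :: "nat \<Rightarrow> nat" where "colp i \<equiv> col (vs ! i)"

lemma W_col: "v \<in> W \<Longrightarrow> v = wh (col v)"
  using col_wh by auto

lemma nth_inj: "i < length vs \<Longrightarrow> j < length vs \<Longrightarrow> vs ! i = vs ! j \<Longrightarrow> i = j"
  using dist by (simp add: nth_eq_iff_index_eq)

lemma finite_V: "finite V"
  using graph by (simp add: simple_graph_def)

lemma independent_same_col:
  assumes "independent E S" "S \<subseteq> V" "u \<in> S" "v \<in> S" "col u = col v"
  shows "u = v"
proof (rule ccontr)
  assume "u \<noteq> v"
  then have "{u, v} \<in> E" using clique[of u v] assms by blast
  moreover have "{u, v} \<subseteq> S" using assms by simp
  ultimately show False using assms(1) unfolding independent_def by blast
qed

lemma independent_inj_col:
  assumes F: "F \<subseteq> {..<length vs}" and ind: "independent E (ver F)"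
  shows "inj_on colp F"
proof (rule inj_onI)
  fix i j assume ij: "i \<in> F" "j \<in> F" "colp i = colp j"
  have "vs ! i = vs ! j"
    by (rule independent_same_col[OF ind ver_subset[OF F]]) (use ij in auto)
  then show "i = j" using nth_inj[of i j] ij F by auto
qed

lemma colp_subset: "F \<subseteq> {..<length vs} \<Longrightarrow> colp ` F \<subseteq> {..<d}"
  using col_less nth_vs by blast

lemma colp_onto:
  assumes "F \<in> faces xs d" "inj_on colp F"
  shows "colp ` F = {..<d}"
  using assms colp_subset[of F] facesD[OF assms(1)] card_image[OF assms(2)]
  by (intro card_subset_eq) auto

lemma face_elem_Suc_d: "F \<in> faces xs (Suc d) \<Longrightarrow> face_elem R xs F = \<zero>\<^bsub>R\<^esub>"
proof (rule dependent_face_elem)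
  assume F: "F \<in> faces xs (Suc d)"
  then show "F \<subseteq> {..<length vs}" using facesD by blast
  show "\<not> independent E (ver F)"
  proof
    assume "independent E (ver F)"
    then have "card (colp ` F) = Suc d"
      using independent_inj_col facesD[OF F] card_image by metis
    moreover have "card (colp ` F) \<le> d"
      using card_mono[OF _ colp_subset, of F] facesD[OF F] by simp
    ultimately show False by simp
  qed
qed

text \<open>There are no independent sets of \<open>d + 1\<close> vertices, so degree \<open>d\<close> is the top of the complex.\<close>

lemma cocycles_eq: "cech_cocycles R xs d = carrier (cech R xs d)"
  by (rule C.cech_cocycles_top) (rule face_elem_Suc_d)

subsection \<open>Cycles\<close>

text \<open>A set of positions with pairwise different colours can be listed by increasing position and by
  increasing colour. These are the inversions of the permutation that relates the two lists.\<close>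

definition inversions :: "nat set \<Rightarrow> (nat \<times> nat) set" where
  "inversions F = {(i, j) \<in> F \<times> F. colp i < colp j \<and> j < i}"

text \<open>Let \<open>F0\<close> be an independent set of \<open>d\<close> vertices. Choosing for each colour either the vertex of \<open>F0\<close>
  or the whisker gives an independent set, and \<open>cycle_sign F\<close> is, up to a common sign, the coefficient
  of the set \<open>F\<close> in the product of the following chains, one for each colour: the difference of the two
  vertices if they are different, and the vertex itself if they coincide. If \<open>F0\<close> contains no whisker,
  this product is the fundamental cycle of the boundary of a cross polytope.\<close>

definition cycle_sign :: "nat set \<Rightarrow> 'k" where
  "cycle_sign F = (-1) ^ (card (inversions F) + card {i\<in>F. vs ! i \<in> W})"

text \<open>The parity of the left hand side depends on \<open>i\<close> only through its colour. Together with the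
  sign of the whiskers this makes the signs of the two facets that contain a common ridge \<open>G\<close> opposite
  to each other, as the cycle condition demands.\<close>

lemma card_inversions_insert:
  assumes "finite G" "i \<notin> G" "colp i \<notin> colp ` G"
  shows "card (inversions (insert i G)) + card {l\<in>G. l < i} =
    card (inversions G) + card {j\<in>G. colp j < colp i} + 2 * card {j\<in>G. colp i < colp j \<and> j < i}"
proof -
  let ?A = "{j\<in>G. colp i < colp j \<and> j < i}" and ?B = "{j\<in>G. colp j < colp i \<and> i < j}"
    and ?C = "{j\<in>G. colp j < colp i \<and> j < i}"
  have ne: "colp j \<noteq> colp i" "j \<noteq> i" if "j \<in> G" for j using assms(2,3) that by (metis imageI)+
  have fin: "finite (inversions G)"
    by (rule finite_subset[of _ "G \<times> G"]) (use assms(1) in \<open>auto simp: inversions_def\<close>)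
  have "inversions (insert i G) = inversions G \<union> (Pair i ` ?A \<union> (\<lambda>j. (j, i)) ` ?B)"
    unfolding inversions_def by auto
  moreover have "card (inversions G \<union> (Pair i ` ?A \<union> (\<lambda>j. (j, i)) ` ?B)) =
      card (inversions G) + card (Pair i ` ?A \<union> (\<lambda>j. (j, i)) ` ?B)"
    by (rule card_Un_disjoint) (use fin assms(1,2) in \<open>auto simp: inversions_def\<close>)
  moreover have "card (Pair i ` ?A \<union> (\<lambda>j. (j, i)) ` ?B) = card (Pair i ` ?A) + card ((\<lambda>j. (j, i)) ` ?B)"
    by (rule card_Un_disjoint) (use assms in auto)
  moreover have "card (Pair i ` ?A) = card ?A" "card ((\<lambda>j. (j, i)) ` ?B) = card ?B"
    by (auto intro!: card_image inj_onI)
  ultimately have 1: "card (inversions (insert i G)) = card (inversions G) + (card ?A + card ?B)" by simp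
  have "{l\<in>G. l < i} = ?A \<union> ?C" using ne by force
  then have 2: "card {l\<in>G. l < i} = card ?A + card ?C"
    using assms(1) by (simp add: card_Un_disjoint disjoint_iff)
  have "{j\<in>G. colp j < colp i} = ?B \<union> ?C" using ne by force
  then have 3: "card {j\<in>G. colp j < colp i} = card ?B + card ?C"
    using assms(1) by (simp add: card_Un_disjoint disjoint_iff)
  show ?thesis using 1 2 3 by simp
qed

lemma cycle_sign_insert:
  assumes "finite G" "i \<notin> G" "colp i \<notin> colp ` G"
  shows "cycle_sign (insert i G) * (-1) ^ card {l\<in>insert i G. l < i} =
    (-1) ^ (card (inversions G) + card {j\<in>G. colp j < colp i} + card {l\<in>G. vs ! l \<in> W}) *
    (if vs ! i \<in> W then -1 else 1)"
proof -
  have "{l\<in>insert i G. l < i} = {l\<in>G. l < i}" by auto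
  moreover have "card {l\<in>insert i G. vs ! l \<in> W} = card {l\<in>G. vs ! l \<in> W} + (if vs ! i \<in> W then 1 else 0)"
  proof (cases "vs ! i \<in> W")
    case True
    then have "{l\<in>insert i G. vs ! l \<in> W} = insert i {l\<in>G. vs ! l \<in> W}" by auto
    then show ?thesis using True assms by simp
  next
    case False
    then have "{l\<in>insert i G. vs ! l \<in> W} = {l\<in>G. vs ! l \<in> W}" by auto
    then show ?thesis using False by simp
  qed
  ultimately have "cycle_sign (insert i G) * (-1) ^ card {l\<in>insert i G. l < i} =
      (-1) ^ (card (inversions (insert i G)) + card {l\<in>G. l < i}) * (-1) ^ card {l\<in>G. vs ! l \<in> W} *
      (if vs ! i \<in> W then -1 else 1)"
    by (simp add: cycle_sign_def power_add)
  also have "\<dots> = (-1) ^ (card (inversions G) + card {j\<in>G. colp j < colp i} + card {l\<in>G. vs ! l \<in> W}) *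
      (if vs ! i \<in> W then -1 else 1)"
    unfolding card_inversions_insert[OF assms] by (simp add: power_add power_mult)
  finally show ?thesis .
qed

text \<open>The sets that occur in that product. For independent \<open>F0\<close> they are independent, see
  \<open>cycle_support_independent\<close>.\<close>

definition cycle_support :: "nat set \<Rightarrow> nat set set" where
  "cycle_support F0 = {F \<in> faces xs d. inj_on colp F \<and> (\<forall>i\<in>F. i \<in> F0 \<or> vs ! i \<in> W)}"

lemma cycle_support_independent:
  assumes F0: "independent E (ver F0)" and F: "F \<in> cycle_support F0"
  shows "independent E (ver F)"
  unfolding independent_def
proof (intro ballI notI)
  fix e assume e: "e \<in> E" "e \<subseteq> ver F"
  then obtain i j where ij: "i \<in> F" "j \<in> F" "e = {vs ! i, vs ! j}" "vs ! i \<noteq> vs ! j"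
  proof -
    obtain u v where uv: "e = {u, v}" "u \<noteq> v" using e(1) graph unfolding simple_graph_def by (metis card_2_iff)
    then obtain i j where "i \<in> F" "u = vs ! i" "j \<in> F" "v = vs ! j" using e(2) by blast
    then show ?thesis using that uv by blast
  qed
  then have ne: "colp i \<noteq> colp j" using F by (metis (no_types, lifting) cycle_support_def inj_onD mem_Collect_eq)
  have "vs ! i \<notin> W"
  proof
    assume "vs ! i \<in> W"
    then obtain c where c: "c < d" "vs ! i = wh c" by blast
    then have "colp j = c" using wh_edge[of c "vs ! j"] e(1) ij(3) by simp
    then show False using ne c col_wh by simp
  qed
  moreover have "vs ! j \<notin> W"
  proof
    assume "vs ! j \<in> W"
    then obtain c where c: "c < d" "vs ! j = wh c" by blast
    then have "colp i = c" using wh_edge[of c "vs ! i"] e(1) ij(3) by (simp add: insert_commute)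
    then show False using ne c col_wh by simp
  qed
  ultimately have "i \<in> F0" "j \<in> F0" using F ij by (auto simp: cycle_support_def)
  then have "e \<subseteq> ver F0" using ij(3) by simp
  then show False using F0 e(1) unfolding independent_def by blast
qed

text \<open>Evaluation of top cochains on that product in the multidegree \<open>- b\<close>.\<close>

definition cycle_functional ::
  "nat set \<Rightarrow> ('v \<Rightarrow>\<^sub>0 nat) \<Rightarrow> (nat set \<Rightarrow> (('v, 'k) mpoly set \<times> nat) set) \<Rightarrow> 'k" where
  "cycle_functional F0 b c = (\<Sum>F\<in>cycle_support F0. cycle_sign F * coord F b (c F))"

lemma finite_cycle_support: "finite (cycle_support F0)"
  using C.finite_faces[of d] by (auto simp: cycle_support_def)

lemma cycle_functional_linear:
  assumes F0: "independent E (ver F0)"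
  shows "linear_functional (cech R xs d) (cycle_functional F0 b)"
proof -
  have lin: "linear_functional (cech R xs d) (\<lambda>c. coord F b (c F))" if "F \<in> cycle_support F0" for F
    using that cycle_support_independent[OF F0 that] facesD
    by (intro C.linear_functional_component coord_linear) (auto simp: cycle_support_def)
  show ?thesis unfolding linear_functional_def
  proof (intro conjI ballI allI)
    fix c c' assume "c \<in> carrier (cech R xs d)" "c' \<in> carrier (cech R xs d)"
    then have "coord F b ((c \<oplus>\<^bsub>cech R xs d\<^esub> c') F) = coord F b (c F) + coord F b (c' F)"
      if "F \<in> cycle_support F0" for F
      using lin[OF that] unfolding linear_functional_def by blast
    then show "cycle_functional F0 b (c \<oplus>\<^bsub>cech R xs d\<^esub> c') = cycle_functional F0 b c + cycle_functional F0 b c'"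
      unfolding cycle_functional_def by (simp add: distrib_left sum.distrib)
  next
    fix a c assume "c \<in> carrier (cech R xs d)"
    then have "coord F b ((a \<odot>\<^bsub>cech R xs d\<^esub> c) F) = a * coord F b (c F)"
      if "F \<in> cycle_support F0" for F
      using lin[OF that] unfolding linear_functional_def by blast
    then show "cycle_functional F0 b (a \<odot>\<^bsub>cech R xs d\<^esub> c) = a * cycle_functional F0 b c"
      unfolding cycle_functional_def by (simp add: sum_distrib_left mult.left_commute)
  qed
qed

lemma coord_cech_diff:
  assumes F: "F \<in> faces xs (Suc q)" and ind: "independent E (ver F)" and c: "c \<in> carrier (cech R xs q)"
  shows "coord F b (cech_diff R xs q c F) =
    (\<Sum>i\<in>F. (-1) ^ card {l\<in>F. l < i} * coord (F - {i}) b (c (F - {i})))"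
proof -
  have Fl: "F \<subseteq> {..<length vs}" using F facesD by blast
  have cF: "c (F - {i}) \<in> carrier (C.loc (F - {i}))" if "i \<in> F" for i
    using PiE_mem[OF c[unfolded C.cech_simps(1)] C.faces_Diff[OF F that]] .
  let ?m = "\<lambda>i. loc_map R (xs ! i) (face_elem R xs F) (c (F - {i}))"
  have m: "?m i \<in> carrier (C.loc F)" if "i \<in> F" for i
    using C.loc_map_face_linear[OF F that] cF[OF that] unfolding linear_between_def by blast
  have "coord F b (cech_diff R xs q c F) =
      (\<Sum>i\<in>F. coord F b ((-1) ^ card {l\<in>F. l < i} \<odot>\<^bsub>C.loc F\<^esub> ?m i))"
    unfolding cech_diff_def restrict_apply'[OF F]
    by (rule linear_functional_finsum[OF C.module_loc[OF F] coord_linear[OF Fl ind]])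
      (use C.cech_diff_summand[OF F _ c] in blast)
  also have "\<dots> = (\<Sum>i\<in>F. (-1) ^ card {l\<in>F. l < i} * coord F b (?m i))"
    using coord_linear[OF Fl ind, of b] m unfolding linear_functional_def by (intro sum.cong) blast+
  also have "\<dots> = (\<Sum>i\<in>F. (-1) ^ card {l\<in>F. l < i} * coord (F - {i}) b (c (F - {i})))"
    using coord_loc_map[OF Fl ind _ cF] by (intro sum.cong) auto
  finally show ?thesis .
qed

lemma coord_eq_0:
  assumes G: "G \<subseteq> {..<length vs}" and ind: "independent E (ver G)"
    and X: "X \<in> carrier (C.loc G)"
    and v: "v \<notin> ver G" "0 < lookup b v"
  shows "coord G b X = 0"
proof -
  obtain p k where p: "p \<in> carrier P" "X = fr G p k" using X by (rule fr_elem)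
  have "\<not> lookup b v \<le> lookup (expo G k) v" using v lookup_expo[OF G] by simp
  then show ?thesis unfolding p(2) coord_fr[OF G ind p(1)] coord_rep_def by auto
qed

text \<open>The evaluation of a coboundary is regrouped according to the ridges \<open>G\<close>. Only two
  sets in the support can contain \<open>G\<close>: those obtained by adding the vertex \<open>f\<close> of \<open>F0\<close> or the whisker \<open>w\<close>
  of the missing colour. Their contributions cancel if \<open>f \<noteq> w\<close>. If \<open>f = w\<close>, then \<open>b\<close> is positive at
  \<open>w\<close>, and the component at \<open>G\<close> has no coefficient at \<open>- b\<close>.\<close>

lemma cycle_functional_coboundary:
  assumes d: "d = Suc q" and F0: "F0 \<in> faces xs d" "independent E (ver F0)"
    and b: "\<And>i. i \<in> F0 \<Longrightarrow> vs ! i \<in> W \<Longrightarrow> 0 < lookup b (vs ! i)"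
    and c: "c \<in> carrier (cech R xs q)"
  shows "cycle_functional F0 b (cech_diff R xs q c) = 0"
proof -
  let ?X = "cycle_support F0" and ?I = "\<lambda>G. {i. i \<notin> G \<and> insert i G \<in> cycle_support F0}"
  let ?h = "\<lambda>F i. cycle_sign F * ((-1) ^ card {l\<in>F. l < i} * coord (F - {i}) b (c (F - {i})))"
  have XF: "F \<in> faces xs (Suc q)" "finite F" if "F \<in> ?X" for F
  proof -
    have "F \<in> faces xs d" using that unfolding cycle_support_def by blast
    then show "F \<in> faces xs (Suc q)" "finite F" using d C.faces_finite by simp_all
  qed
  have finI: "finite (?I G)" for G
  proof (rule finite_subset[of _ "{..<length vs}"])
    show "?I G \<subseteq> {..<length vs}"
      using XF(1) facesD by blast
  qed simp
  have "cycle_functional F0 b (cech_diff R xs q c) = (\<Sum>F\<in>?X. \<Sum>i\<in>F. ?h F i)"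
    unfolding cycle_functional_def
  proof (intro sum.cong refl)
    fix F assume F: "F \<in> ?X"
    show "cycle_sign F * coord F b (cech_diff R xs q c F) = (\<Sum>i\<in>F. ?h F i)"
      unfolding coord_cech_diff[OF XF(1)[OF F] cycle_support_independent[OF F0(2) F] c]
      by (simp add: sum_distrib_left)
  qed
  also have "\<dots> = (\<Sum>(F, i)\<in>Sigma ?X (\<lambda>F. F). ?h F i)"
    by (rule sum.Sigma) (use finite_cycle_support XF in auto)
  also have "\<dots> = (\<Sum>(G, i)\<in>Sigma (faces xs q) ?I. ?h (insert i G) i)"
  proof (rule sum.reindex_bij_witness[of _ "\<lambda>(G, i). (insert i G, i)" "\<lambda>(F, i). (F - {i}, i)"])
    fix Fi assume "Fi \<in> Sigma ?X (\<lambda>F. F)"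
    then obtain F i where Fi: "Fi = (F, i)" "F \<in> ?X" "i \<in> F" by blast
    then show "(\<lambda>(F, i). (F - {i}, i)) Fi \<in> Sigma (faces xs q) ?I"
      using C.faces_Diff[OF XF(1)[OF Fi(2)] Fi(3)] by (auto simp: insert_absorb)
    show "(\<lambda>(G, i). (insert i G, i)) ((\<lambda>(F, i). (F - {i}, i)) Fi) = Fi" using Fi by auto
    show "(case (case Fi of (F, i) \<Rightarrow> (F - {i}, i)) of (G, i) \<Rightarrow> ?h (insert i G) i) =
        (case Fi of (F, i) \<Rightarrow> ?h F i)"
    proof -
      have "insert i (F - {i}) = F" using Fi(3) by blast
      then show ?thesis by (simp only: Fi(1) prod.case)
    qed
  qed auto
  also have "\<dots> = (\<Sum>G\<in>faces xs q. \<Sum>i\<in>?I G. ?h (insert i G) i)"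
    by (rule sum.Sigma[symmetric]) (use C.finite_faces finI in auto)
  also have "\<dots> = 0"
  proof (rule sum.neutral, rule ballI)
    fix G assume G: "G \<in> faces xs q"
    have finG: "finite G" and Gl: "G \<subseteq> {..<length vs}" using C.faces_finite[OF G] facesD[OF G] by auto
    have h: "?h (insert i G) i = coord G b (c G) *
        (cycle_sign (insert i G) * (-1) ^ card {l\<in>insert i G. l < i})" if "i \<in> ?I G" for i
      using that by (simp add: mult_ac)
    show "(\<Sum>i\<in>?I G. ?h (insert i G) i) = 0"
    proof (cases "?I G = {}")
      case False
      then obtain i0 where i0: "i0 \<notin> G" "insert i0 G \<in> ?X" by blast
      \<comment> \<open>The only colour that is missing from \<open>G\<close>.\<close>
      define c0 where "c0 = colp i0"
      have onto: "colp ` F = {..<d}" if "F \<in> ?X" for F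
        using that colp_onto by (auto simp: cycle_support_def)
      have injG: "inj_on colp G" using i0(2) by (auto simp: cycle_support_def)
      have notin: "colp i \<notin> colp ` G" if "i \<in> ?I G" for i
        using that by (auto simp: cycle_support_def)
      have c0: "c0 < d" using onto[OF i0(2)] by (auto simp: c0_def)
      have colI: "colp i = c0" if i: "i \<in> ?I G" for i
      proof -
        have "insert (colp i) (colp ` G) = insert c0 (colp ` G)"
          using onto[OF i0(2)] onto[of "insert i G"] i by (simp add: c0_def)
        moreover have "c0 \<notin> colp ` G" using notin[of i0] i0 by (simp add: c0_def)
        ultimately show ?thesis using notin[OF i] by blast
      qed
      have F0l: "F0 \<subseteq> {..<length vs}" using facesD[OF F0(1)] by simp
      obtain f where f: "f \<in> F0" "colp f = c0"
        using colp_onto[OF F0(1) independent_inj_col[OF F0l F0(2)]] c0 by (metis imageE lessThan_iff)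
      obtain w where w: "w < length vs" "vs ! w = wh c0"
        using wh_in[OF c0] vs by (metis in_set_conv_nth)
      have cw: "colp w = c0" using w col_wh c0 by simp
      have c0G: "c0 \<notin> colp ` G" using notin[of i0] i0 by (simp add: c0_def)
      have uniq: "i = f \<or> i = w" if i: "i \<in> ?I G" for i
      proof (cases "i \<in> F0")
        case True
        then show ?thesis
          using inj_onD[OF independent_inj_col[OF F0l F0(2)], of i f] f colI[OF i] by simp
      next
        case False
        then have "vs ! i \<in> W" and il: "i < length vs"
          using i facesD[OF XF(1), of "insert i G"] by (auto simp: cycle_support_def)
        then have "vs ! i = vs ! w" using W_col[of "vs ! i"] colI[OF i] w by simp
        then show ?thesis using nth_inj il w by blast
      qed
      have inI: "i \<in> ?I G" if i: "i < length vs" "colp i = c0" "i \<in> F0 \<or> vs ! i \<in> W" for i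
      proof -
        have iG: "i \<notin> G" using c0G i by blast
        have "insert i G \<in> faces xs d" using G d i iG finG by (auto simp: faces_def)
        moreover have "inj_on colp (insert i G)" using injG c0G i iG by simp
        moreover have "\<forall>l\<in>G. l \<in> F0 \<or> vs ! l \<in> W" using i0(2) by (auto simp: cycle_support_def)
        ultimately show ?thesis using i iG by (auto simp: cycle_support_def)
      qed
      have fI: "f \<in> ?I G" using inI[of f] f F0l by auto
      have wI: "w \<in> ?I G" using inI[of w] w cw c0 by auto
      have I: "?I G = {f, w}" using fI wI uniq by blast
      show ?thesis
      proof (cases "f = w")
        case True
        have "independent E (ver G)"
          by (rule independent_mono[OF cycle_support_independent[OF F0(2) i0(2)]]) auto
        moreover have "vs ! f \<notin> ver G" using f c0G by auto
        moreover have "0 < lookup b (vs ! f)"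
          using b[OF f(1)] True w c0 by simp
        ultimately have "coord G b (c G) = 0"
          using coord_eq_0[OF Gl] PiE_mem[OF c[unfolded C.cech_simps(1)] G] by blast
        then show ?thesis using h by simp
      next
        case False
        have "vs ! f \<notin> W"
        proof
          assume "vs ! f \<in> W"
          then have "vs ! f = vs ! w" using W_col[of "vs ! f"] f w by simp
          then show False using nth_inj F0l f w False by blast
        qed
        moreover have "vs ! w \<in> W" using w c0 by simp
        ultimately have "cycle_sign (insert f G) * (-1) ^ card {l\<in>insert f G. l < f} +
            cycle_sign (insert w G) * (-1) ^ card {l\<in>insert w G. l < w} = 0"
          using cycle_sign_insert[OF finG _ notin[OF fI]] cycle_sign_insert[OF finG _ notin[OF wI]] fI wI
          by (simp add: f cw)
        then have "(\<Sum>i\<in>{f, w}. cycle_sign (insert i G) * (-1) ^ card {l\<in>insert i G. l < i}) = 0"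
          using False by simp
        then show ?thesis using h by (simp only: sum.cong[OF refl h] I sum_distrib_left[symmetric] mult_zero_right)
      qed
    next
      case True
      show ?thesis unfolding True by (rule sum.empty)
    qed
  qed
  finally show ?thesis .
qed

end

context clique_cech
begin

subsection \<open>Spanning\<close>

text \<open>The index set of a basis of the degree \<open>j\<close> part of the top local cohomology: Laurent monomials with
  exponent \<open>- b\<close> in the localization at a facet \<open>F\<close> of the independence complex, where \<open>b\<close> is
  supported in \<open>F\<close> and is positive at the whiskers in \<open>F\<close>.\<close>
definition lc_basis :: "int \<Rightarrow> (nat set \<times> ('v \<Rightarrow>\<^sub>0 nat)) set" where
  "lc_basis j = {(F, b). F \<in> faces xs d \<and> independent E (ver F) \<and> keys b \<subseteq> ver F \<and>
     (\<forall>i\<in>F. vs ! i \<in> W \<longrightarrow> 0 < lookup b (vs ! i)) \<and> int (mdeg b) = - j}"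

text \<open>The corresponding cochain, with denominator \<open>expo F q\<close> for \<open>q = - j\<close>. This is the degree of \<open>b\<close>,
  hence an upper bound for its values.\<close>

definition lc_class :: "int \<Rightarrow> nat set \<times> ('v \<Rightarrow>\<^sub>0 nat) \<Rightarrow> nat set \<Rightarrow> (('v, 'k) mpoly set \<times> nat) set" where
  "lc_class j = (\<lambda>(F, b). C.single_cochain d F (fr F (mon (expo F (nat (- j)) - b)) (nat (- j))))"

lemma keys_expo_minus: "F \<subseteq> {..<length vs} \<Longrightarrow> keys (expo F k - b) \<subseteq> ver F"
  by (auto simp: in_keys_iff lookup_minus lookup_expo split: if_splits)

lemma mon_expo_minus_closed: "F \<subseteq> {..<length vs} \<Longrightarrow> mon (expo F k - b) \<in> carrier P"
  using keys_expo_minus[of F k b] ver_subset[of F] by (intro mon_closed) blast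

lemma card_ver: "F \<subseteq> {..<length vs} \<Longrightarrow> card (ver F) = card F"
  using nth_inj by (intro card_image inj_onI) blast

lemma mdeg_expo:
  assumes "F \<subseteq> {..<length vs}"
  shows "mdeg (expo F k) = card F * k"
proof -
  have fin: "finite (ver F)" using assms finite_subset by blast
  show ?thesis
    using mdeg_eq[OF fin keys_expo[OF assms]] by (simp add: lookup_expo[OF assms] card_ver[OF assms])
qed

lemma lc_basisD:
  assumes "(F, b) \<in> lc_basis j"
  shows "F \<in> faces xs d" "F \<subseteq> {..<length vs}" "card F = d" "independent E (ver F)"
    "keys b \<subseteq> ver F" "int (mdeg b) = - j" "mdeg b = nat (- j)"
    "\<And>i. i \<in> F \<Longrightarrow> vs ! i \<in> W \<Longrightarrow> 0 < lookup b (vs ! i)"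
proof -
  have F: "F \<in> faces xs d" using assms by (simp add: lc_basis_def)
  then show "F \<in> faces xs d" "F \<subseteq> {..<length vs}" "card F = d" using facesD by blast+
qed (use assms in \<open>auto simp: lc_basis_def\<close>)

lemma finite_lc_basis: "finite (lc_basis j)"
proof (rule finite_subset)
  show "lc_basis j \<subseteq> faces xs d \<times> {b. keys b \<subseteq> V \<and> mdeg b = nat (- j)}"
  proof
    fix \<beta> assume \<beta>: "\<beta> \<in> lc_basis j"
    obtain F b where \<beta>F: "\<beta> = (F, b)" by force
    note D = lc_basisD[OF \<beta>[unfolded \<beta>F]]
    show "\<beta> \<in> faces xs d \<times> {b. keys b \<subseteq> V \<and> mdeg b = nat (- j)}"
      using D(1,5,7) ver_subset[OF D(2)] by (auto simp: \<beta>F)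
  qed
  have "finite V" using graph by (simp add: simple_graph_def)
  then show "finite (faces xs d \<times> {b. keys b \<subseteq> V \<and> mdeg b = nat (- j)})"
    using C.finite_faces finite_monomials by blast
qed

text \<open>Signs can be removed.\<close>

lemma single_cochain_sign_cancel:
  assumes T: "linear_subspace (cech R xs d) T" and F: "F \<in> faces xs d"
    and X: "X \<in> carrier (C.loc F)"
    and s: "C.single_cochain d F ((-1) ^ m \<odot>\<^bsub>C.loc F\<^esub> X) \<in> T"
  shows "C.single_cochain d F X \<in> T"
proof -
  interpret L: module class_ring "C.loc F" by (rule C.module_loc[OF F])
  have "(-1) ^ m \<odot>\<^bsub>cech R xs d\<^esub> C.single_cochain d F ((-1) ^ m \<odot>\<^bsub>C.loc F\<^esub> X) \<in> T"
    using T s unfolding linear_subspace_def by blast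
  moreover have "(-1) ^ m \<odot>\<^bsub>C.loc F\<^esub> ((-1) ^ m \<odot>\<^bsub>C.loc F\<^esub> X) = X"
    using L.smult_assoc1[of "(-1) ^ m" "(-1) ^ m" X] X L.smult_one[OF X]
    by (simp add: power_add[symmetric] mult_2[symmetric])
  ultimately show ?thesis by (simp only: C.single_cochain_smult)
qed

lemma single_cochain_smult_mem:
  assumes "linear_subspace (cech R xs d) T" "C.single_cochain d F X \<in> T"
  shows "C.single_cochain d F (a \<odot>\<^bsub>C.loc F\<^esub> X) \<in> T"
  using assms C.single_cochain_smult[of d a F X] unfolding linear_subspace_def by metis

lemma single_cochain_zero_mem:
  "linear_subspace (cech R xs d) T \<Longrightarrow> C.single_cochain d F \<zero>\<^bsub>C.loc F\<^esub> \<in> T"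
  unfolding C.single_cochain_zero linear_subspace_def by blast

text \<open>Let \<open>\<mu>\<close> be the numerator of a fraction over the \<open>k\<close>-th power of the facet \<open>F\<close>. Suppose that the
  exponent of this Laurent monomial at a vertex \<open>i\<close> of \<open>F\<close> is positive, or that it is zero and \<open>i\<close> is a
  whisker. The monomial then already lives on the ridge \<open>G = F - {i}\<close>, and the coboundary of the cochain at \<open>G\<close> given by it
  expresses the class at \<open>F\<close> by the classes of the same monomial at the other facets that contain
  \<open>G\<close>. If the exponent at \<open>i\<close> is positive, then these vanish; if \<open>i\<close> is a whisker, then these facets
  contain one whisker less, and induction applies. The fractions that admit no such step are the
  elements of the basis.\<close>

lemma monomial_cochain_in_span:
  assumes d: "d = Suc q" and T: "linear_subspace (cech R xs d) T"
    and cob: "cech_coboundaries R xs d \<subseteq> T" and bas: "lc_class j ` lc_basis j \<subseteq> T"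
    and F: "F \<in> faces xs d" and \<mu>: "keys \<mu> \<subseteq> V" "int (mdeg \<mu>) = j + int (d * k)"
  shows "C.single_cochain d F (fr F (mon \<mu>) k) \<in> T"
  using F \<mu>
proof (induction "card {i\<in>F. vs ! i \<in> W}" arbitrary: F \<mu> rule: less_induct)
  case less
  note F = less.prems(1) and \<mu> = less.prems(2,3)
  have Fl: "F \<subseteq> {..<length vs}" and cF: "card F = d" using facesD[OF F] by auto
  have finF: "finite F" by (rule C.faces_finite[OF F])
  show ?case
  proof (cases "independent E (ver F \<union> keys \<mu>)")
    case False
    then show ?thesis using fr_eq_0_dependent[OF Fl \<mu>(1)] single_cochain_zero_mem[OF T] by simp
  next
    case ind: True
    have indF: "independent E (ver F)" using independent_mono[OF ind] by blast
    have injF: "inj_on colp F" by (rule independent_inj_col[OF Fl indF])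
    have keys: "keys \<mu> \<subseteq> ver F"
    proof
      fix v assume v: "v \<in> keys \<mu>"
      then have "col v \<in> colp ` F" using colp_onto[OF F injF] col_less \<mu>(1) by auto
      then obtain i where i: "i \<in> F" "col v = colp i" by blast
      have "v = vs ! i"
        by (rule independent_same_col[OF ind]) (use v i \<mu>(1) ver_subset[OF Fl] in auto)
      then show "v \<in> ver F" using i by blast
    qed
    show ?thesis
    proof (cases "\<exists>i\<in>F. k < lookup \<mu> (vs ! i) \<or> (vs ! i \<in> W \<and> k \<le> lookup \<mu> (vs ! i))")
      case True
      then obtain i where i: "i \<in> F" and ki: "k \<le> lookup \<mu> (vs ! i)"
        and ik: "k < lookup \<mu> (vs ! i) \<or> vs ! i \<in> W" by auto
      define G where "G = F - {i}"
      \<comment> \<open>The localization map from \<open>G\<close> to \<open>F\<close> multiplies the numerator by the \<open>k\<close>-th power of the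
        variable at position \<open>i\<close>, so this power is divided out in advance.\<close>
      define \<mu>' where "\<mu>' = \<mu> - single (vs ! i) k"
      have \<mu>_eq: "\<mu> = single (vs ! i) k + \<mu>'"
        unfolding \<mu>'_def using ki
        by (intro poly_mapping_eqI) (auto simp: lookup_add lookup_minus lookup_single when_def)
      have \<mu>'V: "keys \<mu>' \<subseteq> V"
        using \<mu>(1) unfolding \<mu>_eq by (simp add: keys_add_nat)
      have pc: "mon \<mu>' \<in> carrier P" by (rule mon_closed[OF \<mu>'V])
      have FS: "F \<in> faces xs (Suc q)" using F d by simp
      have G: "G \<in> faces xs q" unfolding G_def by (rule C.faces_Diff[OF FS i])
      have iG: "i \<notin> G" by (simp add: G_def)
      have FG: "F = insert i G" using i by (auto simp: G_def)
      let ?X = "fr G (mon \<mu>') k"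
      let ?c = "cech_diff R xs q (C.single_cochain q G ?X)"
      have X: "?X \<in> carrier (C.loc G)" by (rule fr_closed[OF pc])
      have "?c \<in> cech_coboundaries R xs d"
        unfolding d cech_coboundaries_def using C.single_cochain_closed[OF X] by simp
      then have c: "?c \<in> T" using cob by blast
      have diff: "?c (insert l G) = (-1) ^ card {l'\<in>insert l G. l' < l} \<odot>\<^bsub>C.loc (insert l G)\<^esub>
          fr (insert l G) (mon (single (vs ! l) k + \<mu>')) k"
        if l: "l \<notin> G" "insert l G \<in> faces xs d" for l
      proof -
        have lS: "insert l G \<in> faces xs (Suc q)" using l d by simp
        have ll: "insert l G \<subseteq> {..<length vs}" using facesD[OF l(2)] by simp
        have "insert l G - {l} = G" using l by simp
        then have "loc_map R (xs ! l) (face_elem R xs (insert l G)) ?X =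
            fr (insert l G) (mon (single (vs ! l) k) * mon \<mu>') k"
          using loc_map_fr[OF ll _ pc, of l k] by simp
        then show ?thesis
          using C.cech_diff_single_cochain(1)[OF G X lS _, of l] l by (simp add: mon_mult subset_insertI)
      qed
      have "C.single_cochain d F (?c F) \<in> T"
      proof (rule C.single_cochain_in_subspace[OF T c F])
        fix F' assume F': "F' \<in> faces xs d" "F' \<noteq> F"
        have F'S: "F' \<in> faces xs (Suc q)" using F' d by simp
        show "C.single_cochain d F' (?c F') \<in> T"
        proof (cases "G \<subseteq> F'")
          case False
          then show ?thesis
            using C.cech_diff_single_cochain(2)[OF G X F'S] single_cochain_zero_mem[OF T] by simp
        next
          case True
          have F'l: "F' \<subseteq> {..<length vs}" and cF': "card F' = d" using facesD[OF F'(1)] by auto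
          have "card (F' - G) = 1"
            using True C.faces_finite[OF G] facesD[OF G] cF' d by (simp add: card_Diff_subset)
          then obtain l where "F' - G = {l}" by (rule card_1_singletonE)
          then have l: "F' = insert l G" "l \<notin> G" using True by auto
          have li: "l \<noteq> i" using l F'(2) FG by blast
          define \<mu>'' where "\<mu>'' = single (vs ! l) k + \<mu>'"
          have lV: "vs ! l \<in> V" using F'l l nth_vs by blast
          have \<mu>''V: "keys \<mu>'' \<subseteq> V"
            using \<mu>'V lV unfolding \<mu>''_def by (auto simp: keys_add_nat)
          have deg: "int (mdeg \<mu>'') = j + int (d * k)"
            using \<mu>(2) unfolding \<mu>''_def \<mu>_eq by (simp add: mdeg_add mdeg_single)
          have "C.single_cochain d F' (fr F' (mon \<mu>'') k) \<in> T"
          proof (cases "independent E (ver F' \<union> keys \<mu>'')")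
            case False
            then show ?thesis using fr_eq_0_dependent[OF F'l \<mu>''V] single_cochain_zero_mem[OF T] by simp
          next
            case ind': True
            have indF': "independent E (ver F')" using independent_mono[OF ind'] by blast
            have injF': "inj_on colp F'" by (rule independent_inj_col[OF F'l indF'])
            have "insert (colp l) (colp ` G) = insert (colp i) (colp ` G)"
              using colp_onto[OF F injF] colp_onto[OF F'(1) injF'] FG l by simp
            moreover have "colp i \<notin> colp ` G" using injF FG iG by simp
            ultimately have col: "colp l = colp i" by (metis insertE insertI1)
            have "l < length vs" "i < length vs" using F'l l(1) Fl i by auto
            then have ne: "vs ! l \<noteq> vs ! i" using li nth_inj by blast
            have "vs ! i \<in> W"
            proof (rule ccontr)
              assume "vs ! i \<notin> W"
              then have "vs ! i \<in> keys \<mu>''"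
                using ik unfolding \<mu>''_def \<mu>'_def by (simp add: in_keys_iff lookup_add lookup_minus)
              then have "vs ! l = vs ! i"
                by (intro independent_same_col[OF ind' _ _ _ col]) (use l \<mu>''V ver_subset[OF F'l] in auto)
              then show False using ne by simp
            qed
            moreover have "vs ! l \<notin> W"
              using W_col[of "vs ! l"] W_col[of "vs ! i"] \<open>vs ! i \<in> W\<close> col ne by metis
            moreover have "i \<notin> F'" using l(1) li iG by simp
            ultimately have "{a\<in>F'. vs ! a \<in> W} \<subseteq> {a\<in>F. vs ! a \<in> W}"
              "i \<in> {a\<in>F. vs ! a \<in> W}" "i \<notin> {a\<in>F'. vs ! a \<in> W}"
              using l(1) FG by auto
            then have "{a\<in>F'. vs ! a \<in> W} \<subset> {a\<in>F. vs ! a \<in> W}" by blast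
            then have "card {a\<in>F'. vs ! a \<in> W} < card {a\<in>F. vs ! a \<in> W}"
              using finF by (intro psubset_card_mono) auto
            then show ?thesis using less.hyps F'(1) \<mu>''V deg by blast
          qed
          then show ?thesis
            using single_cochain_smult_mem[OF T] diff[OF l(2)] F'(1) unfolding l(1) \<mu>''_def by simp
        qed
      qed
      then have "C.single_cochain d F ((-1) ^ card {l\<in>F. l < i} \<odot>\<^bsub>C.loc F\<^esub> fr F (mon \<mu>) k) \<in> T"
        using diff[OF iG] F FG \<mu>_eq by simp
      then show ?thesis
        by (rule single_cochain_sign_cancel[OF T F fr_closed[OF mon_closed[OF \<mu>(1)]]])
    next
      case False
      then have le: "lookup \<mu> (vs ! i) \<le> k"
        and lt: "vs ! i \<in> W \<Longrightarrow> lookup \<mu> (vs ! i) < k" if "i \<in> F" for i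
        using that by force+
      define b where "b = expo F k - \<mu>"
      define Q where "Q = nat (- j)"
      have \<mu>0: "lookup \<mu> v = 0" if "v \<notin> ver F" for v
        using keys that by (auto simp: in_keys_iff)
      have \<mu>le: "lookup \<mu> v \<le> lookup (expo F k) v" for v
        using le \<mu>0[of v] by (auto simp: lookup_expo[OF Fl])
      have sum: "b + \<mu> = expo F k"
        unfolding b_def using \<mu>le by (intro poly_mapping_eqI) (simp add: lookup_add lookup_minus)
      have "mdeg b + mdeg \<mu> = d * k"
        using mdeg_add[of b \<mu>] unfolding sum mdeg_expo[OF Fl] cF by simp
      then have deg: "int (mdeg b) = - j" using \<mu>(2) by linarith
      then have Q: "mdeg b = Q" by (simp add: Q_def)
      have "(F, b) \<in> lc_basis j"
        unfolding lc_basis_def using F indF keys_expo_minus[OF Fl, of k \<mu>] lt deg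
        by (auto simp: b_def lookup_minus lookup_expo[OF Fl])
      then have "lc_class j (F, b) \<in> T" using bas by blast
      moreover have "fr F (mon (expo F Q - b)) Q = fr F (mon \<mu>) k"
      proof -
        have "lookup b v \<le> lookup (expo F Q) v" for v
          using lookup_le_mdeg[of b v] Q keys_expo_minus[OF Fl, of k \<mu>]
          by (cases "v \<in> ver F") (auto simp: lookup_expo[OF Fl] b_def in_keys_iff subset_iff)
        then have "expo F Q - b + b = expo F Q"
          by (intro poly_mapping_eqI) (simp add: lookup_add lookup_minus)
        then have "expo F k + (expo F Q - b) = expo F Q + \<mu>"
          unfolding sum[symmetric] by (metis add.assoc add.commute)
        then have "mon (expo F k) * mon (expo F Q - b) = mon (expo F Q) * mon \<mu>"
          by (simp add: mon_mult)
        then show ?thesis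
          using fr_expand[OF Fl mon_expo_minus_closed[OF Fl, of Q b], of k Q]
            fr_expand[OF Fl mon_closed[OF \<mu>(1)], of Q k] by (simp add: add.commute)
      qed
      ultimately show ?thesis by (simp add: lc_class_def Q_def)
    qed
  qed
qed

text \<open>The cochains of degree \<open>d\<close> all of whose components are homogeneous of degree \<open>j\<close>.\<close>

definition homogeneous_cochains :: "int \<Rightarrow> (nat set \<Rightarrow> (('v, 'k) mpoly set \<times> nat) set) set" where
  "homogeneous_cochains j = {c \<in> carrier (cech R xs d).
     \<forall>F\<in>faces xs d. c F \<in> loc_grading R (edge_ring_grading V E) (face_elem R xs F) (card F) j}"

lemma loc_grading_iff:
  "X \<in> loc_grading R (edge_ring_grading V E) (face_elem R xs F) e j \<longleftrightarrow>
    (\<exists>p k. p \<in> homogeneous_polys V (j + int (e * k)) \<and> X = fr F p k)"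
  unfolding loc_grading_def edge_ring_grading_def fr_def by blast

lemma homogeneous_polys_closed: "p \<in> homogeneous_polys V \<delta> \<Longrightarrow> p \<in> carrier P"
  by (simp add: homogeneous_polys_def)

lemma homogeneous_cochains_in_span:
  assumes d: "d = Suc q" and T: "linear_subspace (cech R xs d) T"
    and cob: "cech_coboundaries R xs d \<subseteq> T" and bas: "lc_class j ` lc_basis j \<subseteq> T"
  shows "homogeneous_cochains j \<subseteq> T"
proof
  fix c assume c: "c \<in> homogeneous_cochains j"
  show "c \<in> T"
  proof (rule C.cochain_in_subspace[OF T])
    show "c \<in> carrier (cech R xs d)" using c by (simp add: homogeneous_cochains_def)
    fix F assume F: "F \<in> faces xs d"
    have Fl: "F \<subseteq> {..<length vs}" and cF: "card F = d" using facesD[OF F] by auto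
    obtain p k where p: "p \<in> homogeneous_polys V (j + int (d * k))" "c F = fr F p k"
      using c F loc_grading_iff[of "c F" F "card F" j] by (auto simp: homogeneous_cochains_def cF)
    have mono: "keys \<mu> \<subseteq> V \<and> C.single_cochain d F (fr F (mon \<mu>) k) \<in> T"
      if "\<mu> \<in> keys p" for \<mu>
      using monomial_cochain_in_span[OF d T cob bas F, of \<mu> k] p(1) that
      by (auto simp: homogeneous_polys_def mdeg_def poly_algebra_simps(1))
    have "C.single_cochain d F (fr F (\<Sum>\<mu>\<in>S. single \<mu> (a \<mu>)) k) \<in> T"
      if "finite S" "\<And>\<mu>. \<mu> \<in> S \<Longrightarrow> keys \<mu> \<subseteq> V \<and> C.single_cochain d F (fr F (mon \<mu>) k) \<in> T"
      for S and a :: "_ \<Rightarrow> 'k"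
      using that
    proof (induction S rule: finite_induct)
      case empty
      then show ?case using single_cochain_zero_mem[OF T] by (simp add: fr_0[OF Fl])
    next
      case (insert \<mu> S)
      have m: "mon \<mu> \<in> carrier P" using insert.prems by (intro mon_closed) auto
      have s: "single \<mu> (a \<mu>) \<in> carrier P" using insert.prems by (intro poly_algebra_single_closed) auto
      have r: "(\<Sum>\<mu>\<in>S. single \<mu> (a \<mu>)) \<in> carrier P"
        using insert.prems by (intro poly_algebra_sum_closed poly_algebra_single_closed) auto
      have "fr F (single \<mu> (a \<mu>)) k = a \<mu> \<odot>\<^bsub>C.loc F\<^esub> fr F (mon \<mu>) k"
        using fr_smult[OF Fl m, of "a \<mu>" k] by (simp add: mult_single)
      then have 1: "C.single_cochain d F (fr F (single \<mu> (a \<mu>)) k) \<in> T"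
        using single_cochain_smult_mem[OF T] insert.prems by simp
      have 2: "C.single_cochain d F (fr F (\<Sum>\<mu>\<in>S. single \<mu> (a \<mu>)) k) \<in> T"
        using insert.IH insert.prems by blast
      have "C.single_cochain d F (fr F (single \<mu> (a \<mu>)) k) \<oplus>\<^bsub>cech R xs d\<^esub>
          C.single_cochain d F (fr F (\<Sum>\<mu>\<in>S. single \<mu> (a \<mu>)) k) \<in> T"
        using T 1 2 unfolding linear_subspace_def by blast
      then show ?case using insert.hyps
        by (simp add: C.single_cochain_add fr_add[OF Fl s r])
    qed
    from this[of "keys p" "lookup p", OF finite_keys mono]
    show "C.single_cochain d F (c F) \<in> T"
      unfolding poly_eq_sum_monomials[symmetric] p(2) .
  qed
qed

lemma homogeneous_cochains_subspace: "linear_subspace (cech R xs d) (homogeneous_cochains j)"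
proof -
  let ?gr = "\<lambda>F. loc_grading R (edge_ring_grading V E) (face_elem R xs F) (card F) j"
  interpret M: module class_ring "cech R xs d" by (rule C.module_cech)
  have "\<zero>\<^bsub>C.loc F\<^esub> \<in> ?gr F" if F: "F \<in> faces xs d" for F
  proof -
    have "0 \<in> (homogeneous_polys V (j + int (card F * 0)) :: ('v, 'k) mpoly set)"
      by (simp add: homogeneous_polys_def poly_algebra_zero_closed)
    then show ?thesis unfolding loc_grading_iff using fr_0[of F 0] facesD[OF F] by metis
  qed
  moreover have "X \<oplus>\<^bsub>C.loc F\<^esub> Y \<in> ?gr F"
    if F: "F \<in> faces xs d" and XY: "X \<in> ?gr F" "Y \<in> ?gr F" for F X Y
  proof -
    have Fl: "F \<subseteq> {..<length vs}" using facesD[OF F] by simp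
    have kV: "keys (expo F l) \<subseteq> V" for l using keys_expo[OF Fl, of l] ver_subset[OF Fl] by blast
    obtain p k where p: "p \<in> homogeneous_polys V (j + int (card F * k))" "X = fr F p k"
      using XY(1) unfolding loc_grading_iff by blast
    obtain q l where q: "q \<in> homogeneous_polys V (j + int (card F * l))" "Y = fr F q l"
      using XY(2) unfolding loc_grading_iff by blast
    let ?p = "mon (expo F l) * p" and ?q = "mon (expo F k) * q"
    have X: "X = fr F ?p (k + l)"
      using fr_expand[OF Fl homogeneous_polys_closed[OF p(1)], of l k] p(2) by simp
    have Y: "Y = fr F ?q (k + l)"
      using fr_expand[OF Fl homogeneous_polys_closed[OF q(1)], of k l] q(2) by (simp add: add.commute)
    have h: "?p \<in> homogeneous_polys V (j + int (card F * (k + l)))"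
      "?q \<in> homogeneous_polys V (j + int (card F * (k + l)))"
      using homogeneous_polys_mult_monomial[OF p(1) kV, of l 1] homogeneous_polys_mult_monomial[OF q(1) kV, of k 1]
      by (simp_all add: mdeg_expo[OF Fl] algebra_simps)
    have "X \<oplus>\<^bsub>C.loc F\<^esub> Y = fr F (?p + ?q) (k + l)"
      unfolding X Y by (rule fr_add[OF Fl homogeneous_polys_closed[OF h(1)] homogeneous_polys_closed[OF h(2)]])
    then show ?thesis unfolding loc_grading_iff using homogeneous_polys_add[OF h] by blast
  qed
  moreover have "a \<odot>\<^bsub>C.loc F\<^esub> X \<in> ?gr F"
    if F: "F \<in> faces xs d" and X: "X \<in> ?gr F" for F X a
  proof -
    have Fl: "F \<subseteq> {..<length vs}" using facesD[OF F] by simp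
    obtain p k where p: "p \<in> homogeneous_polys V (j + int (card F * k))" "X = fr F p k"
      using X unfolding loc_grading_iff by blast
    have "single 0 a * p \<in> homogeneous_polys V (j + int (card F * k))"
      using homogeneous_polys_mult_monomial[OF p(1), of 0 a] by (simp add: mdeg_def)
    then show ?thesis
      unfolding loc_grading_iff p(2) using fr_smult[OF Fl homogeneous_polys_closed[OF p(1)]] by blast
  qed
  moreover have "a \<odot>\<^bsub>cech R xs d\<^esub> c \<in> carrier (cech R xs d)" if "c \<in> carrier (cech R xs d)" for a c
    using M.smult_closed[of a c] that by simp
  ultimately show ?thesis
    unfolding linear_subspace_def homogeneous_cochains_def
    by (auto simp: C.cech_simps(2-4) simp del: M.smult_closed M.a_closed
        intro: M.zero_closed[unfolded C.cech_simps(2)] M.a_closed[unfolded C.cech_simps(3)])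
qed

subsection \<open>Duality and dimension\<close>

lemma lookup_basis_le:
  assumes "(F, b) \<in> lc_basis j"
  shows "\<forall>v. lookup b v \<le> lookup (expo F (nat (- j))) v"
proof
  fix v
  have Fl: "F \<subseteq> {..<length vs}" and k: "keys b \<subseteq> ver F" and m: "mdeg b = nat (- j)"
    using lc_basisD[OF assms] by blast+
  show "lookup b v \<le> lookup (expo F (nat (- j))) v"
    using lookup_le_mdeg[of b v] k m by (cases "v \<in> ver F") (auto simp: lookup_expo[OF Fl] in_keys_iff subset_iff)
qed

text \<open>The functional of \<open>(F0, b)\<close> does not vanish on the class of \<open>(F1, b1)\<close> precisely if \<open>b = b1\<close> and \<open>F1\<close>
  belongs to the support for \<open>F0\<close>. For two indices of the basis this forces \<open>F1 = F0\<close>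
  (\<open>basis_in_cycle_support\<close>): a whisker in \<open>F1\<close> belongs to the support of \<open>b\<close>, hence to \<open>F0\<close>.\<close>

lemma cycle_functional_class:
  assumes F0: "independent E (ver F0)" and \<beta>: "(F1, b1) \<in> lc_basis j"
  shows "cycle_functional F0 b (lc_class j (F1, b1)) =
    (if F1 \<in> cycle_support F0 \<and> b = b1 then cycle_sign F1 else 0)"
proof -
  let ?q = "nat (- j)"
  have F1: "F1 \<in> faces xs d" "F1 \<subseteq> {..<length vs}" "independent E (ver F1)"
    using lc_basisD[OF \<beta>] by blast+
  let ?X = "fr F1 (mon (expo F1 ?q - b1)) ?q"
  have zero: "coord F b (lc_class j (F1, b1) F) = 0" if "F \<in> cycle_support F0" "F \<noteq> F1" for F
  proof -
    have F: "F \<in> faces xs d" using that(1) unfolding cycle_support_def by blast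
    have "linear_functional (C.loc F) (coord F b)"
      using facesD[OF F] cycle_support_independent[OF F0 that(1)] by (intro coord_linear) auto
    then show ?thesis
      using linear_functional_zero[OF C.module_loc[OF F]] F that(2)
      by (simp add: lc_class_def C.single_cochain_def)
  qed
  have c: "coord F1 b (lc_class j (F1, b1) F1) = (if b = b1 then 1 else 0)"
  proof -
    have "coord F1 b (lc_class j (F1, b1) F1) = coord_rep F1 b (mon (expo F1 ?q - b1)) ?q"
      using F1 coord_fr[OF F1(2,3) mon_expo_minus_closed[OF F1(2)]]
      by (simp add: lc_class_def C.single_cochain_def)
    also have "\<dots> = (if b = b1 then 1 else 0)"
    proof (cases "\<forall>v. lookup b v \<le> lookup (expo F1 ?q) v")
      case True
      have "expo F1 ?q - b1 = expo F1 ?q - b \<longleftrightarrow> b = b1"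
      proof
        assume eq: "expo F1 ?q - b1 = expo F1 ?q - b"
        show "b = b1"
        proof (rule poly_mapping_eqI)
          fix v
          have "lookup (expo F1 ?q) v - lookup b1 v =
              lookup (expo F1 ?q) v - lookup b v"
            using arg_cong[OF eq, of "\<lambda>p. lookup p v"] by (simp add: lookup_minus)
          then show "lookup b v = lookup b1 v"
            using True lookup_basis_le[OF \<beta>] by (metis diff_diff_cancel)
        qed
      qed simp
      then show ?thesis using True by (simp add: coord_rep_def lookup_single when_def)
    next
      case False
      then have "b \<noteq> b1" using lookup_basis_le[OF \<beta>] by blast
      then show ?thesis unfolding coord_rep_def if_not_P[OF False] by simp
    qed
    finally show ?thesis .
  qed
  have "cycle_functional F0 b (lc_class j (F1, b1)) =
      (\<Sum>F\<in>cycle_support F0. if F = F1 then cycle_sign F1 * (if b = b1 then 1 else 0) else 0)"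
    unfolding cycle_functional_def using zero c by (intro sum.cong) auto
  also have "\<dots> = (if F1 \<in> cycle_support F0 \<and> b = b1 then cycle_sign F1 else 0)"
    using finite_cycle_support by (simp add: sum.delta)
  finally show ?thesis .
qed

lemma self_in_cycle_support:
  assumes "(F, b) \<in> lc_basis j" shows "F \<in> cycle_support F"
  using lc_basisD[OF assms] independent_inj_col[of F] by (simp add: cycle_support_def)

lemma basis_in_cycle_support:
  assumes "(F0, b) \<in> lc_basis j" "(F1, b) \<in> lc_basis j" "F1 \<in> cycle_support F0"
  shows "F1 = F0"
proof -
  have F: "F0 \<in> faces xs d" "F1 \<in> faces xs d" using lc_basisD(1)[OF assms(1)] lc_basisD(1)[OF assms(2)] .
  have "F1 \<subseteq> F0"
  proof
    fix i assume i: "i \<in> F1"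
    show "i \<in> F0"
    proof (cases "vs ! i \<in> W")
      case True
      then have "vs ! i \<in> keys b" using lc_basisD(8)[OF assms(2) i] by (simp add: in_keys_iff)
      then obtain l where l: "l \<in> F0" "vs ! i = vs ! l" using lc_basisD(5)[OF assms(1)] by blast
      have "i < length vs" "l < length vs" using facesD[OF F(1)] facesD[OF F(2)] i l by auto
      then show ?thesis using nth_inj[of i l] l by simp
    next
      case False
      then show ?thesis using assms(3) i by (auto simp: cycle_support_def)
    qed
  qed
  then show ?thesis
    using facesD[OF F(1)] facesD[OF F(2)] C.faces_finite[OF F(1)] by (intro card_subset_eq) auto
qed

theorem local_cohomology_dim:
  assumes "0 < d"
  defines "H \<equiv> edge_ring_lc_part V E vs d :: int \<Rightarrow> ('k, _) module"
  shows "vectorspace class_ring (H j)" "vectorspace.fin_dim class_ring (H j)"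
    "vectorspace.dim class_ring (H j) = card (lc_basis j)"
proof -
  obtain q where d: "d = Suc q" using assms(1) gr0_conv_Suc by blast
  let ?\<phi> = "\<lambda>(F, b). cycle_functional F b"
  have N: "linear_subspace (cech R xs d) (cech_coboundaries R xs d)"
    unfolding d by (rule C.linear_subspace_coboundaries)
  have HQ: "H j = (quotient_module (cech R xs d) (cech_coboundaries R xs d))
      \<lparr>carrier := {cech_coboundaries R xs d +>\<^bsub>cech R xs d\<^esub> c | c. c \<in> homogeneous_cochains j}\<rparr>"
    unfolding H_def edge_ring_lc_part_def local_cohomology_part_def local_cohomology_def cocycles_eq
      homogeneous_cochains_def by simp
  have ind: "independent E (ver F)" if "(F, b) \<in> lc_basis j" for F b
    using that by (auto simp: lc_basis_def)
  have e: "lc_class j \<beta> \<in> homogeneous_cochains j" if \<beta>: "\<beta> \<in> lc_basis j" for \<beta>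
  proof -
    obtain F b where \<beta>F: "\<beta> = (F, b)" by force
    let ?q = "nat (- j)"
    have F: "F \<in> faces xs d" and Fl: "F \<subseteq> {..<length vs}" and cF: "card F = d"
      using lc_basisD[OF \<beta>[unfolded \<beta>F]] by blast+
    have "expo F ?q - b + b = expo F ?q"
      using lookup_basis_le \<beta> unfolding \<beta>F by (intro poly_mapping_eqI) (simp add: lookup_add lookup_minus)
    then have "mdeg (expo F ?q - b) + mdeg b = d * ?q"
      using mdeg_add[of "expo F ?q - b" b] mdeg_expo[OF Fl] cF by simp
    then have "int (mdeg (expo F ?q - b)) + int (mdeg b) = int (d * ?q)"
      unfolding of_nat_add[symmetric] by (rule arg_cong)
    then have "int (mdeg (expo F ?q - b)) = j + int (d * ?q)"
      unfolding lc_basisD(6)[OF \<beta>[unfolded \<beta>F]] by linarith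
    then have hom: "mon (expo F ?q - b) \<in> homogeneous_polys V (j + int (d * ?q))"
      using mon_expo_minus_closed[OF Fl, of ?q b] by (simp add: homogeneous_polys_def mdeg_def)
    have "lc_class j \<beta> F' \<in> loc_grading R (edge_ring_grading V E) (face_elem R xs F') (card F') j"
      if F': "F' \<in> faces xs d" for F'
    proof (cases "F' = F")
      case True
      have "lc_class j \<beta> F = fr F (mon (expo F ?q - b)) ?q"
        using F by (simp add: \<beta>F lc_class_def C.single_cochain_def)
      then show ?thesis unfolding True loc_grading_iff cF using hom by blast
    next
      case False
      have "lc_class j \<beta> F' = \<zero>\<^bsub>cech R xs d\<^esub> F'"
        using False F' by (simp add: \<beta>F lc_class_def C.single_cochain_def C.cech_simps(2))
      moreover have "\<zero>\<^bsub>cech R xs d\<^esub> \<in> homogeneous_cochains j"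
        using homogeneous_cochains_subspace unfolding linear_subspace_def by blast
      ultimately show ?thesis using F' by (simp add: homogeneous_cochains_def)
    qed
    moreover have "lc_class j \<beta> \<in> carrier (cech R xs d)"
      unfolding \<beta>F lc_class_def prod.case
      by (rule C.single_cochain_closed[OF fr_closed[OF mon_expo_minus_closed[OF Fl]]])
    ultimately show ?thesis by (simp add: homogeneous_cochains_def)
  qed
  have lin: "linear_functional (cech R xs d) (?\<phi> \<beta>)" if "\<beta> \<in> lc_basis j" for \<beta>
    using that ind by (cases \<beta>) (auto intro: cycle_functional_linear)
  have kills: "?\<phi> \<beta> x = 0" if \<beta>: "\<beta> \<in> lc_basis j" and x: "x \<in> cech_coboundaries R xs d" for \<beta> x
  proof -
    obtain F b where \<beta>F: "\<beta> = (F, b)" by force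
    obtain c where "c \<in> carrier (cech R xs q)" "x = cech_diff R xs q c"
      using x by (auto simp: d cech_coboundaries_def)
    moreover have "F \<in> faces xs d" "independent E (ver F)"
      "\<And>i. i \<in> F \<Longrightarrow> vs ! i \<in> W \<Longrightarrow> 0 < lookup b (vs ! i)"
      using \<beta> \<beta>F by (auto simp: lc_basis_def)
    ultimately show ?thesis using cycle_functional_coboundary[OF d] \<beta>F by simp
  qed
  have sign: "cycle_sign F \<noteq> 0" for F by (simp add: cycle_sign_def)
  have diag: "?\<phi> \<beta> (lc_class j \<beta>) \<noteq> 0" if \<beta>: "\<beta> \<in> lc_basis j" for \<beta>
  proof -
    obtain F b where \<beta>F: "\<beta> = (F, b)" by force
    show ?thesis using \<beta> cycle_functional_class[OF ind, of F b F b j b] self_in_cycle_support[of F b j] sign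
      unfolding \<beta>F by simp
  qed
  have off: "?\<phi> \<beta> (lc_class j \<gamma>) = 0"
    if \<beta>: "\<beta> \<in> lc_basis j" and \<gamma>: "\<gamma> \<in> lc_basis j" and ne: "\<beta> \<noteq> \<gamma>" for \<beta> \<gamma>
  proof -
    obtain F b where \<beta>F: "\<beta> = (F, b)" by force
    obtain F' b' where \<gamma>F: "\<gamma> = (F', b')" by force
    have "\<not> (F' \<in> cycle_support F \<and> b = b')"
      using basis_in_cycle_support[of F b j F'] \<beta> \<gamma> ne unfolding \<beta>F \<gamma>F by auto
    then show ?thesis
      using cycle_functional_class[OF ind[of F b] , of F' b' j b] \<beta> \<gamma> unfolding \<beta>F \<gamma>F by auto
  qed
  note * = subquotient_dim[OF C.module_cech N homogeneous_cochains_subspace finite_lc_basis e lin kills diag off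
      homogeneous_cochains_in_span[OF d] HQ]
  show "vectorspace class_ring (H j)" by (rule *(1))
  show "vectorspace.fin_dim class_ring (H j)" by (rule *(2))
  show "vectorspace.dim class_ring (H j) = card (lc_basis j)" by (rule *(3))
qed

end

section \<open>Counting monomials\<close>

lemma mdeg_0: "mdeg 0 = 0" by (simp add: mdeg_def)

text \<open>The exponent at \<open>v\<close> is split off. The set \<open>P\<close> consists of the vertices at which the exponent has
  to be positive.\<close>

lemma card_monomials_insert:
  fixes v :: 'v and P :: "'v set"
  assumes fin: "finite S" and v: "v \<notin> S"
  defines "N \<equiv> \<lambda>S q. {b :: 'v \<Rightarrow>\<^sub>0 nat. keys b \<subseteq> S \<and>
     (\<forall>u\<in>S \<inter> P. 0 < lookup b u) \<and> mdeg b = q}"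
  shows "card (N (insert v S) q) = (\<Sum>k=0..q. (if v \<in> P \<and> k = 0 then 0 else 1) * card (N S (q - k)))"
proof -
  let ?A = "\<lambda>k. if v \<in> P \<and> k = 0 then {} else N S (q - k)"
  let ?f = "\<lambda>b :: 'v \<Rightarrow>\<^sub>0 nat. (lookup b v, b - single v (lookup b v))"
  let ?g = "\<lambda>(k, c :: 'v \<Rightarrow>\<^sub>0 nat). single v k + c"
  have finN: "finite (N S k)" for k
    unfolding N_def by (rule finite_subset[OF _ finite_monomials[OF fin, of k]]) auto
  have split: "single v (lookup b v) + (b - single v (lookup b v)) = b"
    for b :: "'v \<Rightarrow>\<^sub>0 nat"
    by (intro poly_mapping_eqI) (auto simp: lookup_add lookup_minus lookup_single when_def)
  have deg: "mdeg b = lookup b v + mdeg (b - single v (lookup b v))"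
    for b :: "'v \<Rightarrow>\<^sub>0 nat"
    using mdeg_add[of "single v (lookup b v)" "b - single v (lookup b v)"]
    unfolding split mdeg_single .
  have cv: "lookup c v = 0" if "keys c \<subseteq> S" for c :: "'v \<Rightarrow>\<^sub>0 nat"
    using that v by (auto simp: in_keys_iff)
  have "bij_betw ?f (N (insert v S) q) (Sigma {0..q} ?A)"
  proof (rule bij_betw_byWitness[where f' = ?g])
    show "\<forall>b\<in>N (insert v S) q. ?g (?f b) = b" by (simp add: split)
    show "\<forall>kc\<in>Sigma {0..q} ?A. ?f (?g kc) = kc"
      using cv by (auto simp: N_def lookup_add split: if_splits)
    show "?f ` N (insert v S) q \<subseteq> Sigma {0..q} ?A"
    proof
      fix kc assume "kc \<in> ?f ` N (insert v S) q"
      then obtain b where b: "b \<in> N (insert v S) q" "kc = ?f b" by blast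
      let ?c = "b - single v (lookup b v)"
      have c: "lookup ?c u = (if u = v then 0 else lookup b u)" for u
        by (simp add: lookup_minus lookup_single when_def)
      have "keys ?c \<subseteq> S"
      proof
        fix u assume "u \<in> keys ?c"
        then have "u \<noteq> v" "u \<in> keys b" unfolding in_keys_iff c by (auto split: if_splits)
        then show "u \<in> S" using b(1) unfolding N_def by blast
      qed
      moreover have "\<forall>u\<in>S \<inter> P. 0 < lookup ?c u"
        using b(1) v by (auto simp: N_def c)
      moreover have "lookup b v + mdeg ?c = q" using deg[of b] b(1) by (simp add: N_def)
      moreover have "\<not> (v \<in> P \<and> lookup b v = 0)" using b(1) by (auto simp: N_def)
      ultimately show "kc \<in> Sigma {0..q} ?A" using b(2) by (auto simp: N_def)
    qed
    show "?g ` Sigma {0..q} ?A \<subseteq> N (insert v S) q"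
    proof
      fix b assume "b \<in> ?g ` Sigma {0..q} ?A"
      then obtain k c where kc: "k \<le> q" "c \<in> ?A k" "b = single v k + c" by auto
      have k: "\<not> (v \<in> P \<and> k = 0)" and c: "c \<in> N S (q - k)" using kc(2) by (auto split: if_splits)
      have "keys b \<subseteq> insert v S"
        using c by (auto simp: kc(3) keys_add_nat N_def split: if_splits)
      moreover have "\<forall>u\<in>insert v S \<inter> P. 0 < lookup b u"
        using c k v by (auto simp: kc(3) N_def lookup_add lookup_single when_def)
      moreover have "mdeg b = q" using c kc(1) by (simp add: kc(3) mdeg_add mdeg_single N_def)
      ultimately show "b \<in> N (insert v S) q" by (simp add: N_def)
    qed
  qed
  then have "card (N (insert v S) q) = card (Sigma {0..q} ?A)" by (rule bij_betw_same_card)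
  also have "\<dots> = (\<Sum>k=0..q. card (?A k))" by (rule card_SigmaI) (use finN in auto)
  also have "\<dots> = (\<Sum>k=0..q. (if v \<in> P \<and> k = 0 then 0 else 1) * card (N S (q - k)))"
    by (intro sum.cong) auto
  finally show ?thesis .
qed

abbreviation geometric_series :: "rat fps" where "geometric_series \<equiv> Abs_fps (\<lambda>_. 1)"

lemma geometric_series_mult: "(1 - fps_X) * geometric_series = 1"
  by (rule fps_ext) (auto simp: left_diff_distrib fps_X_mult_nth)

text \<open>Each vertex contributes the factor \<open>1 / (1 - X)\<close>, or \<open>X / (1 - X)\<close> if its exponent has to be
  positive.\<close>

lemma card_monomials_fps:
  fixes S P :: "'v set"
  assumes "finite S"
  shows "Abs_fps (\<lambda>q. of_nat (card {b :: 'v \<Rightarrow>\<^sub>0 nat. keys b \<subseteq> S \<and>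
      (\<forall>u\<in>S \<inter> P. 0 < lookup b u) \<and> mdeg b = q})) =
    geometric_series ^ card (S - P) * (fps_X * geometric_series) ^ card (S \<inter> P)"
  using assms
proof (induction S rule: finite_induct)
  case empty
  have "{b :: 'v \<Rightarrow>\<^sub>0 nat. b = 0 \<and> mdeg b = q} = (if q = 0 then {0} else {})" for q
    by (auto simp: mdeg_0)
  then show ?case by (intro fps_ext) auto
next
  case (insert v S)
  let ?N = "\<lambda>S q. {b :: 'v \<Rightarrow>\<^sub>0 nat. keys b \<subseteq> S \<and>
      (\<forall>u\<in>S \<inter> P. 0 < lookup b u) \<and> mdeg b = q}"
  let ?a = "\<lambda>k. if v \<in> P \<and> k = 0 then 0 else 1 :: rat"
  have "Abs_fps (\<lambda>q. of_nat (card (?N (insert v S) q))) = Abs_fps ?a * Abs_fps (\<lambda>q. of_nat (card (?N S q)) :: rat)"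
  proof (rule fps_ext)
    fix q
    have "of_nat (card (?N (insert v S) q)) = (\<Sum>k=0..q. ?a k * of_nat (card (?N S (q - k))) :: rat)"
      unfolding card_monomials_insert[OF insert.hyps, of P q] of_nat_sum
      by (intro sum.cong) auto
    then show "Abs_fps (\<lambda>q. of_nat (card (?N (insert v S) q))) $ q =
        (Abs_fps ?a * Abs_fps (\<lambda>q. of_nat (card (?N S q)) :: rat)) $ q"
      by (simp add: fps_mult_nth)
  qed
  also have "\<dots> = Abs_fps ?a * (geometric_series ^ card (S - P) * (fps_X * geometric_series) ^ card (S \<inter> P))"
    unfolding insert.IH ..
  also have "Abs_fps ?a = (if v \<in> P then fps_X * geometric_series else geometric_series)"
    by (rule fps_ext) (auto simp: fps_X_mult_nth)
  also have "\<dots> * (geometric_series ^ card (S - P) * (fps_X * geometric_series) ^ card (S \<inter> P)) =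
      geometric_series ^ card (insert v S - P) * (fps_X * geometric_series) ^ card (insert v S \<inter> P)"
    using insert.hyps by (simp add: insert_Diff_if Int_insert_left mult_ac)
  finally show ?case .
qed

lemma fls_X_div_eq: "fls_X / (1 - fls_X) = fps_to_fls (fps_X * geometric_series)"
proof -
  have "fps_to_fls (1 - fps_X) * fps_to_fls geometric_series = (1 :: rat fls)"
    unfolding fls_times_fps_to_fls[symmetric] geometric_series_mult by simp
  then have *: "(1 - fls_X) * fps_to_fls geometric_series = (1 :: rat fls)"
    by simp
  then have "(1 - fls_X :: rat fls) \<noteq> 0" by auto
  then show ?thesis
    using * by (simp add: fls_times_fps_to_fls divide_eq_eq mult.commute mult.left_commute)
qed

lemma one_plus_fls_X_div_eq: "1 + fls_X / (1 - fls_X) = fps_to_fls geometric_series"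
proof -
  have "1 + fps_X * geometric_series = geometric_series"
    using geometric_series_mult by (simp add: algebra_simps)
  then have "fps_to_fls (1 + fps_X * geometric_series) = fps_to_fls geometric_series" by simp
  then show ?thesis unfolding fls_X_div_eq by simp
qed

text \<open>With \<open>v = X / (1 - X)\<close> and \<open>1 + v = 1 / (1 - X)\<close>, this is the expansion of \<open>v\<^sup>d\<^sup>-\<^sup>a (1 + v)\<^sup>a\<close>.\<close>

lemma sum_binomial_powi:
  assumes "a \<le> d" "a \<le> N"
  shows "(\<Sum>i=0..N. of_nat (a choose i) * (fls_X / (1 - fls_X)) powi (int d - int i)) =
    fps_to_fls (geometric_series ^ a * (fps_X * geometric_series) ^ (d - a))"
proof -
  let ?v = "fls_X / (1 - fls_X) :: rat fls"
  have "(\<Sum>i=0..N. of_nat (a choose i) * ?v powi (int d - int i)) =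
      (\<Sum>i\<le>a. of_nat (a choose i) * ?v powi (int d - int i))"
    using assms by (intro sum.mono_neutral_right) (auto simp: binomial_eq_0)
  also have "\<dots> = (\<Sum>i\<le>a. ?v ^ (d - a) * (of_nat (a choose i) * 1 ^ i * ?v ^ (a - i)))"
  proof (intro sum.cong refl)
    fix i assume "i \<in> {..a}"
    then have "int d - int i = int (d - a + (a - i))" using assms(1) by simp
    then have "?v powi (int d - int i) = ?v ^ (d - a) * ?v ^ (a - i)"
      by (simp only: power_int_of_nat power_add)
    then show "of_nat (a choose i) * ?v powi (int d - int i) =
        ?v ^ (d - a) * (of_nat (a choose i) * 1 ^ i * ?v ^ (a - i))" by (simp add: mult_ac)
  qed
  also have "\<dots> = ?v ^ (d - a) * (1 + ?v) ^ a"
    by (simp only: sum_distrib_left[symmetric] binomial_ring)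
  also have "\<dots> = fps_to_fls (geometric_series ^ a * (fps_X * geometric_series) ^ (d - a))"
    unfolding one_plus_fls_X_div_eq unfolding fls_X_div_eq
    by (simp add: fls_times_fps_to_fls fps_to_fls_power mult_ac)
  finally show ?thesis .
qed

section \<open>Facets, minimal vertex covers and the Hilbert series\<close>

lemma vertex_cover_iff:
  assumes "simple_graph V E"
  shows "vertex_cover V E C \<longleftrightarrow> C \<subseteq> V \<and> independent E (V - C)"
proof -
  have "e \<inter> C \<noteq> {} \<longleftrightarrow> \<not> e \<subseteq> V - C" if "e \<in> E" "C \<subseteq> V" for e
  proof -
    have "e \<subseteq> V" using assms that by (simp add: simple_graph_def)
    then show ?thesis by blast
  qed
  then show ?thesis unfolding vertex_cover_def independent_def by blast
qed

context clique_cech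
begin

text \<open>All maximal independent sets have \<open>d\<close> elements: if an independent set avoids a colour, then the
  whisker of that colour can be added to it.\<close>

lemma min_vertex_cover_iff:
  assumes "C \<subseteq> V"
  shows "C \<in> min_vertex_covers V E \<longleftrightarrow> independent E (V - C) \<and> card (V - C) = d"
proof
  assume C: "C \<in> min_vertex_covers V E"
  have ind: "independent E (V - C)"
    using C unfolding min_vertex_covers_def vertex_cover_iff[OF graph] by blast
  have inj: "inj_on col (V - C)" by (rule inj_onI, rule independent_same_col[OF ind]) auto
  have "c \<in> col ` (V - C)" if c: "c < d" for c
  proof (rule ccontr)
    assume no: "c \<notin> col ` (V - C)"
    have wC: "wh c \<in> C" using no wh_in[OF c] col_wh[OF c] by force
    have "independent E (V - (C - {wh c}))"
      unfolding independent_def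
    proof (intro ballI notI)
      fix e assume e: "e \<in> E" "e \<subseteq> V - (C - {wh c})"
      have "wh c \<in> e" using e ind unfolding independent_def by blast
      then obtain v where v: "e = {wh c, v}" "wh c \<noteq> v"
        using e(1) graph unfolding simple_graph_def by (metis card_2_iff doubleton_eq_iff insertE singletonD)
      then have "col v = c" using wh_edge[OF c] e(1) by blast
      moreover have "v \<in> V - C" using e(2) v by blast
      ultimately show False using no by blast
    qed
    then have "vertex_cover V E (C - {wh c})" using assms by (auto simp: vertex_cover_iff[OF graph])
    moreover have "C - {wh c} \<subset> C" using wC by blast
    ultimately show False using C unfolding min_vertex_covers_def by blast
  qed
  then have "col ` (V - C) = {..<d}" using col_less by auto
  then have "card (V - C) = d" using card_image[OF inj] by simp
  with ind show "independent E (V - C) \<and> card (V - C) = d" by blast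
next
  assume C: "independent E (V - C) \<and> card (V - C) = d"
  have "\<not> vertex_cover V E D" if D: "D \<subset> C" for D
  proof
    assume "vertex_cover V E D"
    then have ind: "independent E (V - D)" by (simp add: vertex_cover_iff[OF graph])
    have inj: "inj_on col (V - D)" by (rule inj_onI, rule independent_same_col[OF ind]) auto
    have "card (V - D) = card (col ` (V - D))" using card_image[OF inj] by simp
    also have "\<dots> \<le> card {..<d}" using col_less by (intro card_mono) auto
    finally have "card (V - D) \<le> d" by simp
    moreover have "card (V - C) < card (V - D)"
      using D assms finite_V by (intro psubset_card_mono) auto
    ultimately show False using C by simp
  qed
  then show "C \<in> min_vertex_covers V E"
    using C assms by (auto simp: min_vertex_covers_def vertex_cover_iff[OF graph])
qed

lemma facets_bij:
  "bij_betw (\<lambda>F. V - ver F) {F \<in> faces xs d. independent E (ver F)} (min_vertex_covers V E)"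
proof (rule bij_betw_byWitness[where f' = "\<lambda>C. {i. i < length vs \<and> vs ! i \<in> V - C}"])
  have ver: "ver {i. i < length vs \<and> vs ! i \<in> V - C} = V - C" for C
  proof
    show "ver {i. i < length vs \<and> vs ! i \<in> V - C} \<subseteq> V - C" by auto
    show "V - C \<subseteq> ver {i. i < length vs \<and> vs ! i \<in> V - C}"
    proof
      fix u assume u: "u \<in> V - C"
      then obtain i where "i < length vs" "u = vs ! i" using vs by (metis DiffD1 in_set_conv_nth)
      then show "u \<in> ver {i. i < length vs \<and> vs ! i \<in> V - C}" using u by blast
    qed
  qed
  show "\<forall>F\<in>{F \<in> faces xs d. independent E (ver F)}. {i. i < length vs \<and> vs ! i \<in> V - (V - ver F)} = F"
  proof
    fix F assume "F \<in> {F \<in> faces xs d. independent E (ver F)}"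
    then have Fl: "F \<subseteq> {..<length vs}" using facesD by blast
    have "i \<in> F" if i: "i < length vs" "vs ! i \<in> ver F" for i
    proof -
      obtain l where l: "l \<in> F" "vs ! i = vs ! l" using i(2) by blast
      then show ?thesis using nth_inj[of i l] i(1) Fl by auto
    qed
    then show "{i. i < length vs \<and> vs ! i \<in> V - (V - ver F)} = F"
      using Fl ver_subset[OF Fl] by auto
  qed
  show "\<forall>C\<in>min_vertex_covers V E. V - ver {i. i < length vs \<and> vs ! i \<in> V - C} = C"
    unfolding ver by (auto simp: min_vertex_covers_def vertex_cover_def)
  show "(\<lambda>F. V - ver F) ` {F \<in> faces xs d. independent E (ver F)} \<subseteq> min_vertex_covers V E"
  proof (rule image_subsetI)
    fix F assume F: "F \<in> {F \<in> faces xs d. independent E (ver F)}"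
    then have Fl: "F \<subseteq> {..<length vs}" "card F = d" using facesD by blast+
    have "V - (V - ver F) = ver F" using ver_subset[OF Fl(1)] by blast
    then show "V - ver F \<in> min_vertex_covers V E"
      using F card_ver[OF Fl(1)] Fl(2) by (subst min_vertex_cover_iff) auto
  qed
  show "(\<lambda>C. {i. i < length vs \<and> vs ! i \<in> V - C}) ` min_vertex_covers V E \<subseteq>
      {F \<in> faces xs d. independent E (ver F)}"
  proof (rule image_subsetI)
    fix C assume C: "C \<in> min_vertex_covers V E"
    then have "C \<subseteq> V" by (simp add: min_vertex_covers_def vertex_cover_def)
    then have "independent E (V - C)" "card (V - C) = d" using C min_vertex_cover_iff by blast+
    moreover have "card (ver {i. i < length vs \<and> vs ! i \<in> V - C}) = card {i. i < length vs \<and> vs ! i \<in> V - C}"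
      by (rule card_ver) auto
    ultimately show "{i. i < length vs \<and> vs ! i \<in> V - C} \<in> {F \<in> faces xs d. independent E (ver F)}"
      unfolding faces_def mem_Collect_eq ver by auto
  qed
qed

text \<open>The basis is counted facet by facet, the facet \<open>F\<close> corresponding to the cover \<open>V - F\<close>.\<close>

lemma card_lc_basis:
  "of_nat (card (lc_basis j)) =
    fls_nth (\<Sum>C\<in>min_vertex_covers V E. fps_to_fls
      (geometric_series ^ card ((V - W) - C) * (fps_X * geometric_series) ^ (d - card ((V - W) - C)))) (- j)"
proof (cases "j \<le> 0")
  case False
  then have "lc_basis j = {}" by (auto simp: lc_basis_def)
  then show ?thesis using False by (simp add: fls_nth_sum)
next
  case True
  let ?Fs = "{F \<in> faces xs d. independent E (ver F)}"
  let ?B = "\<lambda>F. {b :: 'v \<Rightarrow>\<^sub>0 nat. keys b \<subseteq> ver F \<and>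
      (\<forall>u\<in>ver F \<inter> W. 0 < lookup b u) \<and> mdeg b = nat (- j)}"
  let ?g = "geometric_series"
  have finFs: "finite ?Fs" using C.finite_faces[of d] by simp
  have basis: "lc_basis j = Sigma ?Fs ?B"
    using True by (auto simp: lc_basis_def)
  have finB: "finite (?B F)" if "F \<in> ?Fs" for F
  proof -
    have "finite (ver F)" using that C.faces_finite by blast
    from finite_monomials[OF this, of "nat (- j)"] show ?thesis by (rule finite_subset[rotated]) auto
  qed
  have "of_nat (card (lc_basis j)) = (\<Sum>F\<in>?Fs. of_nat (card (?B F)) :: rat)"
    unfolding basis by (subst card_SigmaI) (use finFs finB in auto)
  also have "\<dots> = (\<Sum>F\<in>?Fs. (?g ^ card (ver F - W) * (fps_X * ?g) ^ card (ver F \<inter> W)) $ nat (- j))"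
  proof (intro sum.cong refl)
    fix F assume "F \<in> ?Fs"
    then have "finite (ver F)" using C.faces_finite by blast
    from arg_cong[OF card_monomials_fps[OF this, of W], of "\<lambda>f. fps_nth f (nat (- j))"]
    show "of_nat (card (?B F)) = (?g ^ card (ver F - W) * (fps_X * ?g) ^ card (ver F \<inter> W)) $ nat (- j)"
      by (simp only: fps_nth_Abs_fps)
  qed
  also have "\<dots> = (\<Sum>F\<in>?Fs. (?g ^ card ((V - W) - (V - ver F)) *
      (fps_X * ?g) ^ (d - card ((V - W) - (V - ver F)))) $ nat (- j))"
  proof (intro sum.cong refl)
    fix F assume F: "F \<in> ?Fs"
    then have F': "F \<in> faces xs d" by blast
    have Fl: "F \<subseteq> {..<length vs}" "card F = d" "finite (ver F)" using facesD[OF F'] C.faces_finite[OF F'] by auto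
    have "(V - W) - (V - ver F) = ver F - W" using ver_subset[OF Fl(1)] by blast
    moreover have "card (ver F \<inter> W) = d - card (ver F - W)"
      using card_ver[OF Fl(1)] Fl card_Int_Diff[OF Fl(3), of W] by simp
    ultimately show "(?g ^ card (ver F - W) * (fps_X * ?g) ^ card (ver F \<inter> W)) $ nat (- j) =
        (?g ^ card ((V - W) - (V - ver F)) * (fps_X * ?g) ^ (d - card ((V - W) - (V - ver F)))) $ nat (- j)"
      by simp
  qed
  also have "\<dots> = (\<Sum>C\<in>min_vertex_covers V E. (?g ^ card ((V - W) - C) *
      (fps_X * ?g) ^ (d - card ((V - W) - C))) $ nat (- j))"
    by (rule sum.reindex_bij_betw[OF facets_bij])
  also have "\<dots> = fls_nth (\<Sum>C\<in>min_vertex_covers V E. fps_to_fls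
      (?g ^ card ((V - W) - C) * (fps_X * ?g) ^ (d - card ((V - W) - C)))) (- j)"
    using True by (simp add: fls_nth_sum)
  finally show ?thesis .
qed

lemma hilbert_series:
  assumes "0 < d"
  shows "has_hilbert_series (edge_ring_lc_part V E vs d :: int \<Rightarrow> ('k, _) module)
     (\<Sum>i = 0..card (V - W). \<Sum>C\<in>min_vertex_covers V E.
        of_nat (card ((V - W) - C) choose i) * (fls_X / (1 - fls_X)) powi (int d - int i))"
proof -
  have le: "card ((V - W) - C) \<le> d" "card ((V - W) - C) \<le> card (V - W)"
    if C: "C \<in> min_vertex_covers V E" for C
  proof -
    have "C \<subseteq> V" using C by (simp add: min_vertex_covers_def vertex_cover_def)
    then have "card (V - C) = d" using C min_vertex_cover_iff by blast
    moreover have "card ((V - W) - C) \<le> card (V - C)" using finite_V by (intro card_mono) auto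
    ultimately show "card ((V - W) - C) \<le> d" by simp
    show "card ((V - W) - C) \<le> card (V - W)" using finite_V by (intro card_mono) auto
  qed
  have "(\<Sum>i = 0..card (V - W). \<Sum>C\<in>min_vertex_covers V E.
        of_nat (card ((V - W) - C) choose i) * (fls_X / (1 - fls_X)) powi (int d - int i)) =
      (\<Sum>C\<in>min_vertex_covers V E. fps_to_fls
        (geometric_series ^ card ((V - W) - C) * (fps_X * geometric_series) ^ (d - card ((V - W) - C))))"
    by (subst sum.swap) (intro sum.cong refl sum_binomial_powi le)
  then show ?thesis
    unfolding has_hilbert_series_def using local_cohomology_dim[OF assms] card_lc_basis by simp
qed

end

section \<open>Cohen--Macaulay Cameron--Walker graphs\<close>

text \<open>The cliques are the leaf edges and the pendant triangles, and the vertices \<open>w i\<close> are the whiskers. The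
  colours start with \<open>0\<close>, hence the shift of indices. The clique of colour \<open>c\<close> is called \<open>Q c\<close>.\<close>

lemma leaf_triangle_clique_cech:
  assumes G: "simple_graph V E" and S: "leaf_triangle_structure V E n m x y z w"
    and vs: "distinct vs" "set vs = V"
  obtains col where "clique_cech V E vs (n + m) col (\<lambda>c. w (Suc c))"
proof -
  define Q where "Q c = (if c < n then {x (Suc c), w (Suc c)}
      else {y (Suc c - n), z (Suc c - n), w (Suc c)})" for c
  note S' = S[unfolded leaf_triangle_structure_def]
  have inj: "inj_on x {1..n}" "inj_on y {1..m}" "inj_on z {1..m}" "inj_on w {1..n + m}"
    and dis: "x ` {1..n} \<inter> y ` {1..m} = {}" "x ` {1..n} \<inter> z ` {1..m} = {}" "x ` {1..n} \<inter> w ` {1..n + m} = {}"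
     "y ` {1..m} \<inter> z ` {1..m} = {}" "y ` {1..m} \<inter> w ` {1..n + m} = {}" "z ` {1..m} \<inter> w ` {1..n + m} = {}"
    and V: "V = x ` {1..n} \<union> y ` {1..m} \<union> z ` {1..m} \<union> w ` {1..n + m}"
    using S' by - ((elim conjE, assumption)+)
  obtain B where B: "B \<subseteq> {{x i, y j} | i j. i \<in> {1..n} \<and> j \<in> {1..m}}"
    and E: "E = B \<union> {{x i, w i} | i. i \<in> {1..n}} \<union> {{y j, z j} | j. j \<in> {1..m}}
        \<union> {{y j, w (n + j)} | j. j \<in> {1..m}} \<union> {{z j, w (n + j)} | j. j \<in> {1..m}}"
    using S' by (elim conjE exE) (rule that; assumption)
  have xy: "x i \<noteq> y j" if "i \<in> {1..n}" "j \<in> {1..m}" for i j using dis(1) that by blast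
  have xz: "x i \<noteq> z j" if "i \<in> {1..n}" "j \<in> {1..m}" for i j using dis(2) that by blast
  have xw: "x i \<noteq> w k" if "i \<in> {1..n}" "k \<in> {1..n + m}" for i k using dis(3) that by blast
  have yz: "y i \<noteq> z j" if "i \<in> {1..m}" "j \<in> {1..m}" for i j using dis(4) that by blast
  have yw: "y i \<noteq> w k" if "i \<in> {1..m}" "k \<in> {1..n + m}" for i k using dis(5) that by blast
  have zw: "z i \<noteq> w k" if "i \<in> {1..m}" "k \<in> {1..n + m}" for i k using dis(6) that by blast
  have Q_iff: "(c < n \<and> Suc c \<in> {1..n} \<and> v = x (Suc c)) \<or>
      (n \<le> c \<and> Suc c - n \<in> {1..m} \<and> v = y (Suc c - n)) \<or>
      (n \<le> c \<and> Suc c - n \<in> {1..m} \<and> v = z (Suc c - n)) \<or>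
      (Suc c \<in> {1..n + m} \<and> v = w (Suc c))" if "v \<in> Q c" "c < n + m" for v c
    using that by (cases "c < n") (auto simp: Q_def)
  have Qcases: thesis
    if "v \<in> Q c" "c < n + m"
      and "c < n \<Longrightarrow> Suc c \<in> {1..n} \<Longrightarrow> v = x (Suc c) \<Longrightarrow> thesis"
      and "n \<le> c \<Longrightarrow> Suc c - n \<in> {1..m} \<Longrightarrow> v = y (Suc c - n) \<Longrightarrow> thesis"
      and "n \<le> c \<Longrightarrow> Suc c - n \<in> {1..m} \<Longrightarrow> v = z (Suc c - n) \<Longrightarrow> thesis"
      and "Suc c \<in> {1..n + m} \<Longrightarrow> v = w (Suc c) \<Longrightarrow> thesis"
    for v c thesis
    using Q_iff[OF that(1,2)] that(3-) by blast
  have Qdisj: "c = c'" if v: "v \<in> Q c" "v \<in> Q c'" and c: "c < n + m" "c' < n + m" for v c c'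
  proof -
    note neq = xy xz xw yz yw zw
    note eqs = neq neq[THEN not_sym] inj_on_eq_iff[OF inj(1)] inj_on_eq_iff[OF inj(2)]
      inj_on_eq_iff[OF inj(3)] inj_on_eq_iff[OF inj(4)]
    show ?thesis
    proof (rule Qcases[OF v(1) c(1)])
      assume a: "c < n" "Suc c \<in> {1..n}" "v = x (Suc c)"
      show ?thesis by (rule Qcases[OF v(2) c(2)]) (use a in \<open>simp_all add: eqs\<close>)
    next
      assume a: "n \<le> c" "Suc c - n \<in> {1..m}" "v = y (Suc c - n)"
      show ?thesis by (rule Qcases[OF v(2) c(2)]) (use a in \<open>simp_all add: eqs\<close>)
    next
      assume a: "n \<le> c" "Suc c - n \<in> {1..m}" "v = z (Suc c - n)"
      show ?thesis by (rule Qcases[OF v(2) c(2)]) (use a in \<open>simp_all add: eqs\<close>)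
    next
      assume a: "Suc c \<in> {1..n + m}" "v = w (Suc c)"
      show ?thesis by (rule Qcases[OF v(2) c(2)]) (use a in \<open>simp_all add: eqs\<close>)
    qed
  qed
  define col where "col v = (SOME c. c < n + m \<and> v \<in> Q c)" for v
  have col: "col v = c" if "c < n + m" "v \<in> Q c" for v c
    unfolding col_def by (rule some_equality) (use that Qdisj in blast)+
  have exQ: "\<exists>c<n + m. v \<in> Q c" if v: "v \<in> V" for v
  proof -
    consider i where "i \<in> {1..n}" "v = x i" | j where "j \<in> {1..m}" "v = y j"
      | j where "j \<in> {1..m}" "v = z j" | k where "k \<in> {1..n + m}" "v = w k"
      using v unfolding V by blast
    then show ?thesis
    proof cases
      case 1
      then show ?thesis by (intro exI[of _ "i - 1"]) (auto simp: Q_def)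
    next
      case 2
      then show ?thesis by (intro exI[of _ "n + j - 1"]) (auto simp: Q_def)
    next
      case 3
      then show ?thesis by (intro exI[of _ "n + j - 1"]) (auto simp: Q_def)
    next
      case 4
      then show ?thesis by (intro exI[of _ "k - 1"]) (auto simp: Q_def)
    qed
  qed
  have wQ: "w (Suc c) \<in> Q c" for c by (simp add: Q_def)
  have Qclique: "{u, v} \<in> E" if uv: "u \<in> Q c" "v \<in> Q c" "u \<noteq> v" and c: "c < n + m" for u v c
  proof (cases "c < n")
    case True
    then have "{u, v} = {x (Suc c), w (Suc c)}" using uv by (auto simp: Q_def)
    moreover have "Suc c \<in> {1..n}" using True by simp
    ultimately show ?thesis unfolding E by blast
  next
    case False
    define j where "j = Suc c - n"
    have j: "j \<in> {1..m}" "Suc c = n + j" using False c by (auto simp: j_def)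
    have "Q c = {y j, z j, w (n + j)}" using False j by (simp add: Q_def)
    then have "{u, v} = {y j, z j} \<or> {u, v} = {y j, w (n + j)} \<or> {u, v} = {z j, w (n + j)}"
      using uv by (auto simp: insert_commute)
    then show ?thesis using j(1) unfolding E by blast
  qed
  have E_cases: "(\<exists>i\<in>{1..n}. \<exists>j\<in>{1..m}. e = {x i, y j}) \<or> (\<exists>i\<in>{1..n}. e = {x i, w i}) \<or>
      (\<exists>j\<in>{1..m}. e = {y j, z j}) \<or> (\<exists>j\<in>{1..m}. e = {y j, w (n + j)}) \<or>
      (\<exists>j\<in>{1..m}. e = {z j, w (n + j)})" if e: "e \<in> E" for e
  proof (cases "e \<in> B")
    case True
    with B have "e \<in> {{x i, y j} | i j. i \<in> {1..n} \<and> j \<in> {1..m}}" by (rule subsetD)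
    then show ?thesis by blast
  next
    case False
    then have "e \<in> {{x i, w i} | i. i \<in> {1..n}} \<union> {{y j, z j} | j. j \<in> {1..m}}
        \<union> {{y j, w (n + j)} | j. j \<in> {1..m}} \<union> {{z j, w (n + j)} | j. j \<in> {1..m}}"
      using e unfolding E by simp
    then show ?thesis by (elim UnE) blast+
  qed
  have Qedge: "v \<in> Q c" if e: "{w (Suc c), v} \<in> E" and c: "c < n + m" for v c
  proof -
    have k: "Suc c \<in> {1..n + m}" using c by simp
    consider i j where "i \<in> {1..n}" "j \<in> {1..m}" "{w (Suc c), v} = {x i, y j}"
      | i where "i \<in> {1..n}" "{w (Suc c), v} = {x i, w i}"
      | j where "j \<in> {1..m}" "{w (Suc c), v} = {y j, z j}"
      | j where "j \<in> {1..m}" "{w (Suc c), v} = {y j, w (n + j)}"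
      | j where "j \<in> {1..m}" "{w (Suc c), v} = {z j, w (n + j)}"
      using E_cases[OF e] by (elim disjE bexE) (rule that; assumption)+
    then show ?thesis
    proof cases
      case (1 i j)
      then show ?thesis using xw[OF _ k] yw[OF _ k] by (metis doubleton_eq_iff)
    next
      case (2 i)
      then have "v = x i" "w (Suc c) = w i" using xw[OF _ k] by (metis doubleton_eq_iff)+
      moreover have "i \<in> {1..n + m}" using 2 by simp
      ultimately have "Suc c = i" using inj_onD[OF inj(4)] k by blast
      then show ?thesis using 2(1) \<open>v = x i\<close> by (auto simp: Q_def)
    next
      case (3 j)
      then show ?thesis using yw[OF _ k] zw[OF _ k] by (metis doubleton_eq_iff)
    next
      case (4 j)
      then have "v = y j" "w (Suc c) = w (n + j)" using yw[OF _ k] by (metis doubleton_eq_iff)+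
      moreover have "n + j \<in> {1..n + m}" using 4 by simp
      ultimately have "Suc c = n + j" using inj_onD[OF inj(4)] k by blast
      then show ?thesis using 4(1) \<open>v = y j\<close> by (auto simp: Q_def)
    next
      case (5 j)
      then have "v = z j" "w (Suc c) = w (n + j)" using zw[OF _ k] by (metis doubleton_eq_iff)+
      moreover have "n + j \<in> {1..n + m}" using 5 by simp
      ultimately have "Suc c = n + j" using inj_onD[OF inj(4)] k by blast
      then show ?thesis using 5(1) \<open>v = z j\<close> by (auto simp: Q_def)
    qed
  qed
  show ?thesis
  proof (rule that, unfold_locales)
    show "simple_graph V E" "distinct vs" "set vs = V" by fact+
    show "col v < n + m" if "v \<in> V" for v using exQ[OF that] col by blast
    show "{u, v} \<in> E" if uv: "u \<in> V" "v \<in> V" "u \<noteq> v" "col u = col v" for u v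
    proof -
      obtain c c' where "c < n + m" "u \<in> Q c" "c' < n + m" "v \<in> Q c'"
        using exQ[OF uv(1)] exQ[OF uv(2)] by blast
      moreover from this have "c = c'" using col uv(4) by metis
      ultimately show ?thesis using Qclique uv(3) by blast
    qed
    show "w (Suc c) \<in> V" if "c < n + m" for c unfolding V using that by auto
    show "col (w (Suc c)) = c" if "c < n + m" for c using col[OF that wQ] .
    show "col v = c" if "c < n + m" "{w (Suc c), v} \<in> E" for c v
      using col[OF that(1) Qedge[OF that(2,1)]] .
  qed
qed

theorem corollary4p18:
  fixes V V' :: "'v set" and E :: "'v set set" and n m :: nat
    and x y z w :: "nat \<Rightarrow> 'v" and vs :: "'v list"
  assumes "cameron_walker V E"
    and "cohen_macaulay (edge_ring V E :: ('k::field, (('v \<Rightarrow>\<^sub>0 nat) \<Rightarrow>\<^sub>0 'k) set) module)"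
    and "leaf_triangle_structure V E n m x y z w"
    and "V' = x ` {1..n} \<union> y ` {1..m} \<union> z ` {1..m}"
    and "distinct vs" and "set vs = V"
  shows "has_hilbert_series
     (edge_ring_lc_part V E vs (n + m) ::
        int \<Rightarrow> ('k, (nat set \<Rightarrow> ((('v \<Rightarrow>\<^sub>0 nat) \<Rightarrow>\<^sub>0 'k) set \<times> nat) set) set) module)
     (\<Sum>i = 0..card V'. \<Sum>C\<in>min_vertex_covers V E.
        of_nat (card (V' - C) choose i) *
        (fls_X / (1 - fls_X)) powi (int (n + m) - int i))"
proof -
  have G: "simple_graph V E" and ne: "V \<noteq> {}"
    using assms(1) by (simp_all add: cameron_walker_def connected_graph_def)
  obtain col where "clique_cech V E vs (n + m) col (\<lambda>c. w (Suc c))"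
    using leaf_triangle_clique_cech[OF G assms(3,5,6)] .
  then interpret clique_cech V E vs "TYPE('k)" "n + m" col "\<lambda>c. w (Suc c)" .
  have W: "W = w ` {1..n + m}"
    by (simp add: image_image[of w Suc, symmetric] lessThan_atLeast0 image_Suc_atLeastLessThan
        atLeastLessThanSuc_atLeastAtMost del: image_image)
  have V: "V = V' \<union> W" and disj: "V' \<inter> W = {}"
    unfolding W assms(4) using assms(3) unfolding leaf_triangle_structure_def by blast+
  have "V' = V - W" using V disj by blast
  moreover have "0 < n + m"
  proof (rule ccontr)
    assume "\<not> 0 < n + m"
    then have "V = {}" using V unfolding W assms(4) by simp
    then show False using ne by simp
  qed
  ultimately show ?thesis using hilbert_series by simp
qed

end
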